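(* Let $G\in\mathcal F$ have $n\ge 1$ edges, and let $M$ be an almost perfect matching of $G$. Then, as representations of $\Sigma_{n-1}$, $$S^G|_{\Sigma_{n-1}}\cong\bigoplus_{e\in M}S^{G\backslash e}.$$
   Context: $\mathcal F$ is the set of (color-preserving isomorphism classes of) finite bipartitioned forests without isolated vertices: each vertex is colored black or white so that adjacent vertices have different colors. $G\backslash e$ is obtained from $G$ by deleting the edge $e$ (and discarding any resulting isolated vertices). A matching of $G$ is a set of edges no two of which share a vertex. A matching $M$ of $G$ is almost perfect if every isolated edge of $G$ (an edge forming a connected component by itself) lies in $M$ and every non-leaf vertex of $G$ is contained in an edge of $M$. Specht module: a diagram $D$ is a finite set of boxes $(i,j)$ with $i,j$ positive integers (row $i$, column $j$). Let $D$ have $n$ boxes, order them arbitrarily, and let the symmetric group $\Sigma_n$ act on them accordingly. Let $R_D\subset\Sigma_n$ (resp. $C_D\subset\Sigma_n$) be the subgroup of permutations that stabilize each row (resp. each column) of $D$, and put $R(D)=\sum_{\sigma\in R_D}\sigma$ and $C(D)=\sum_{\sigma\in C_D}\operatorname{sgn}(\sigma)\sigma$ in $\mathbf C[\Sigma_n]$. The Specht module of $D$ is the left ideal $S^D=\mathbf C[\Sigma_n]C(D)R(D)$, a representation of $\Sigma_n$ by left multiplication (for the empty diagram, $S^\emptyset=\mathbf C$). For a bipartitioned bipartite graph $G$, number the white vertices with distinct positive integers and likewise the black vertices, and let $D(G)$ be the diagram containing box $(i,j)$ if and only if $G$ has an edge joining white vertex $i$ and black vertex $j$; then $S^G=S^{D(G)}$,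 which up to isomorphism does not depend on the numbering. $\Sigma_{n-1}\subset\Sigma_n$ is the stabilizer of the letter $n$. *)

theory Defs
  imports
    Complex_Main
    "HOL-Library.Function_Algebras"
    "HOL-Combinatorics.Permutations"
    "HOL-Algebra.Sym_Groups"
begin

section \<open>Bipartitioned forests and almost perfect matchings\<close>

record 'v bigraph =
  whites :: "'v set"
  blacks :: "'v set"
  edges :: "'v set set"

definition bipartitioned_graph :: "'v bigraph \<Rightarrow> bool" where
  "bipartitioned_graph G \<longleftrightarrow>
     finite (whites G) \<and> finite (blacks G) \<and> whites G \<inter> blacks G = {} \<and>
     (\<forall>e \<in> edges G. \<exists>u \<in> whites G. \<exists>v \<in> blacks G. e = {u, v})"

definition no_isolated_vertices :: "'v bigraph \<Rightarrow> bool" where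
  "no_isolated_vertices G \<longleftrightarrow> (\<forall>v \<in> whites G \<union> blacks G. \<exists>e \<in> edges G. v \<in> e)"

definition is_cycle :: "'v bigraph \<Rightarrow> 'v list \<Rightarrow> bool" where
  "is_cycle G p \<longleftrightarrow>
     length p \<ge> 3 \<and> distinct p \<and>
     (\<forall>i < length p. {p ! i, p ! (Suc i mod length p)} \<in> edges G)"

definition acyclic_graph :: "'v bigraph \<Rightarrow> bool" where
  "acyclic_graph G \<longleftrightarrow> (\<nexists>p. is_cycle G p)"

text \<open>Representatives, on vertices of type \<open>'v\<close>, of the classes in \<open>\<F>\<close>.\<close>

definition bipartitioned_forests :: "'v bigraph set" where
  "bipartitioned_forests =
     {G. bipartitioned_graph G \<and> acyclic_graph G \<and> no_isolated_vertices G}"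

definition delete_edge :: "'v bigraph \<Rightarrow> 'v set \<Rightarrow> 'v bigraph" where
  "delete_edge G e =
     \<lparr> whites = {v \<in> whites G. \<exists>f \<in> edges G - {e}. v \<in> f},
       blacks = {v \<in> blacks G. \<exists>f \<in> edges G - {e}. v \<in> f},
       edges = edges G - {e} \<rparr>"

definition degree :: "'v bigraph \<Rightarrow> 'v \<Rightarrow> nat" where
  "degree G v = card {e \<in> edges G. v \<in> e}"

definition leaf :: "'v bigraph \<Rightarrow> 'v \<Rightarrow> bool" where
  "leaf G v \<longleftrightarrow> v \<in> whites G \<union> blacks G \<and> degree G v = 1"

definition isolated_edge :: "'v bigraph \<Rightarrow> 'v set \<Rightarrow> bool" where
  "isolated_edge G e \<longleftrightarrow> e \<in> edges G \<and> (\<forall>f \<in> edges G. f \<noteq> e \<longrightarrow> f \<inter> e = {})"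

definition matching :: "'v bigraph \<Rightarrow> 'v set set \<Rightarrow> bool" where
  "matching G M \<longleftrightarrow> M \<subseteq> edges G \<and> (\<forall>e \<in> M. \<forall>f \<in> M. e \<noteq> f \<longrightarrow> e \<inter> f = {})"

definition almost_perfect_matching :: "'v bigraph \<Rightarrow> 'v set set \<Rightarrow> bool" where
  "almost_perfect_matching G M \<longleftrightarrow>
     matching G M \<and>
     (\<forall>e. isolated_edge G e \<longrightarrow> e \<in> M) \<and>
     (\<forall>v \<in> whites G \<union> blacks G. \<not> leaf G v \<longrightarrow> (\<exists>e \<in> M. v \<in> e))"


section \<open>Complex representations\<close>

text \<open>Only the data is recorded: a subspace \<open>space\<close> of an ambient additive group, the scalar
  multiplication and the action. The acting group is a separate parameter of
  \<open>rep_isomorphic\<close>, so that restriction to a subgroup \<open>H\<close> means comparing over \<open>H\<close>.\<close>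

record ('g, 'v) representation =
  space :: "'v set"
  scale :: "complex \<Rightarrow> 'v \<Rightarrow> 'v"
  action :: "'g \<Rightarrow> 'v \<Rightarrow> 'v"

definition rep_isomorphic ::
  "'g set \<Rightarrow> ('g, 'v::ab_group_add) representation \<Rightarrow> ('g, 'w::ab_group_add) representation \<Rightarrow> bool"
  where
  "rep_isomorphic H V W \<longleftrightarrow>
     (\<exists>\<phi>. bij_betw \<phi> (space V) (space W) \<and>
          (\<forall>x \<in> space V. \<forall>y \<in> space V. \<phi> (x + y) = \<phi> x + \<phi> y) \<and>
          (\<forall>c. \<forall>x \<in> space V. \<phi> (scale V c x) = scale W c (\<phi> x)) \<and>
          (\<forall>g \<in> H. \<forall>x \<in> space V. \<phi> (action V g x) = action W g (\<phi> x)))"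

definition direct_sum ::
  "'i set \<Rightarrow> ('i \<Rightarrow> ('g, 'v::ab_group_add) representation) \<Rightarrow> ('g, 'i \<Rightarrow> 'v) representation"
  where
  "direct_sum I V =
     \<lparr> space = {x. (\<forall>i \<in> I. x i \<in> space (V i)) \<and> (\<forall>i. i \<notin> I \<longrightarrow> x i = 0) \<and>
                   finite {i. x i \<noteq> 0}},
       scale = (\<lambda>c x i. if i \<in> I then scale (V i) c (x i) else 0),
       action = (\<lambda>g x i. if i \<in> I then action (V i) g (x i) else 0) \<rparr>"


section \<open>The group algebra of a finite group\<close>

text \<open>The function \<open>x\<close> stands for the formal sum of the \<open>x g \<cdot> g\<close>, \<open>g \<in> carrier G\<close>. Its product is
  \<open>conv\<close>; the pointwise \<open>*\<close> on functions is never used.\<close>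

definition group_algebra :: "('g, 'm) monoid_scheme \<Rightarrow> ('g \<Rightarrow> complex) set" where
  "group_algebra G = {x. \<forall>g. g \<notin> carrier G \<longrightarrow> x g = 0}"

definition conv ::
  "('g, 'm) monoid_scheme \<Rightarrow> ('g \<Rightarrow> complex) \<Rightarrow> ('g \<Rightarrow> complex) \<Rightarrow> 'g \<Rightarrow> complex" where
  "conv G x y =
     (\<lambda>g. \<Sum>(a, b) \<in> {(a, b). a \<in> carrier G \<and> b \<in> carrier G \<and> a \<otimes>\<^bsub>G\<^esub> b = g}. x a * y b)"

definition basis_elem :: "'g \<Rightarrow> 'g \<Rightarrow> complex" where
  "basis_elem g = (\<lambda>h. if h = g then 1 else 0)"


section \<open>Specht modules of diagrams and of graphs\<close>

definition is_diagram :: "(nat \<times> nat) set \<Rightarrow> bool" where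
  "is_diagram D \<longleftrightarrow> finite D \<and> (\<forall>(i, j) \<in> D. 0 < i \<and> 0 < j)"

definition box_ordering :: "(nat \<times> nat) set \<Rightarrow> (nat \<Rightarrow> nat \<times> nat) \<Rightarrow> bool" where
  "box_ordering D t \<longleftrightarrow> bij_betw t {1..card D} D"

definition row_stabilizer :: "(nat \<times> nat) set \<Rightarrow> (nat \<Rightarrow> nat \<times> nat) \<Rightarrow> (nat \<Rightarrow> nat) set" where
  "row_stabilizer D t =
     {\<sigma> \<in> carrier (sym_group (card D)).
        \<forall>i. \<sigma> ` {k \<in> {1..card D}. fst (t k) = i} = {k \<in> {1..card D}. fst (t k) = i}}"

definition column_stabilizer :: "(nat \<times> nat) set \<Rightarrow> (nat \<Rightarrow> nat \<times> nat) \<Rightarrow> (nat \<Rightarrow> nat) set" where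
  "column_stabilizer D t =
     {\<sigma> \<in> carrier (sym_group (card D)).
        \<forall>j. \<sigma> ` {k \<in> {1..card D}. snd (t k) = j} = {k \<in> {1..card D}. snd (t k) = j}}"

definition row_symmetrizer ::
  "(nat \<times> nat) set \<Rightarrow> (nat \<Rightarrow> nat \<times> nat) \<Rightarrow> (nat \<Rightarrow> nat) \<Rightarrow> complex" where
  "row_symmetrizer D t = (\<Sum>\<sigma> \<in> row_stabilizer D t. basis_elem \<sigma>)"

definition column_antisymmetrizer ::
  "(nat \<times> nat) set \<Rightarrow> (nat \<Rightarrow> nat \<times> nat) \<Rightarrow> (nat \<Rightarrow> nat) \<Rightarrow> complex" where
  "column_antisymmetrizer D t =
     (\<Sum>\<sigma> \<in> column_stabilizer D t. (\<lambda>\<tau>. of_int (sign \<sigma>) * basis_elem \<sigma> \<tau>))"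

text \<open>For \<open>D = {}\<close> this is the group algebra of the trivial group \<open>sym_group 0\<close>, that is,
  the one-dimensional representation.\<close>

definition specht_module ::
  "(nat \<times> nat) set \<Rightarrow> (nat \<Rightarrow> nat \<times> nat) \<Rightarrow>
     (nat \<Rightarrow> nat, (nat \<Rightarrow> nat) \<Rightarrow> complex) representation" where
  "specht_module D t =
     (let S = sym_group (card D) in
      \<lparr> space = {conv S x (conv S (column_antisymmetrizer D t) (row_symmetrizer D t)) | x.
                   x \<in> group_algebra S},
        scale = (\<lambda>c x \<sigma>. c * x \<sigma>),
        action = (\<lambda>\<sigma>. conv S (basis_elem \<sigma>)) \<rparr>)"

text \<open>White and black vertices are numbered independently: a white and a black vertex may
  receive the same number.\<close>

definition numbering :: "'v bigraph \<Rightarrow> ('v \<Rightarrow> nat) \<Rightarrow> bool" where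
  "numbering G \<nu> \<longleftrightarrow>
     inj_on \<nu> (whites G) \<and> inj_on \<nu> (blacks G) \<and> (\<forall>v \<in> whites G \<union> blacks G. 0 < \<nu> v)"

definition graph_diagram :: "'v bigraph \<Rightarrow> ('v \<Rightarrow> nat) \<Rightarrow> (nat \<times> nat) set" where
  "graph_diagram G \<nu> = {(\<nu> u, \<nu> v) | u v. u \<in> whites G \<and> v \<in> blacks G \<and> {u, v} \<in> edges G}"

text \<open>The isomorphism class of \<open>S\<^sup>G\<close> depends only on \<open>G\<close>, but the module itself depends on a
  numbering of the vertices and an ordering of the boxes. All choices are admitted here.\<close>

definition is_specht_module_of ::
  "'v bigraph \<Rightarrow> (nat \<Rightarrow> nat, (nat \<Rightarrow> nat) \<Rightarrow> complex) representation \<Rightarrow> bool" where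
  "is_specht_module_of G V \<longleftrightarrow>
     (\<exists>\<nu> t. numbering G \<nu> \<and> box_ordering (graph_diagram G \<nu>) t \<and>
            V = specht_module (graph_diagram G \<nu>) t)"

lemma is_diagram_graph_diagram:
  assumes "bipartitioned_graph G" "numbering G \<nu>"
  shows "is_diagram (graph_diagram G \<nu>)"
proof -
  have "graph_diagram G \<nu> \<subseteq> (\<nu> ` whites G) \<times> (\<nu> ` blacks G)"
    by (auto simp: graph_diagram_def)
  moreover have "finite ((\<nu> ` whites G) \<times> (\<nu> ` blacks G))"
    using assms(1) by (simp add: bipartitioned_graph_def)
  ultimately have "finite (graph_diagram G \<nu>)"
    by (rule finite_subset)
  then show ?thesis
    using assms(2) by (auto simp: is_diagram_def graph_diagram_def numbering_def)
qed

lemma card_graph_diagram: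
  assumes G: "bipartitioned_graph G" and \<nu>: "numbering G \<nu>"
  shows "card (graph_diagram G \<nu>) = card (edges G)"
proof -
  let ?P = "{(u, v). u \<in> whites G \<and> v \<in> blacks G \<and> {u, v} \<in> edges G}"
  have "bij_betw (\<lambda>(u, v). (\<nu> u, \<nu> v)) ?P (graph_diagram G \<nu>)"
  proof (rule bij_betw_imageI)
    show "inj_on (\<lambda>(u, v). (\<nu> u, \<nu> v)) ?P"
      using \<nu> by (auto simp: numbering_def intro!: inj_onI dest: inj_onD)
    show "(\<lambda>(u, v). (\<nu> u, \<nu> v)) ` ?P = graph_diagram G \<nu>"
      unfolding graph_diagram_def by force
  qed
  then have "card ?P = card (graph_diagram G \<nu>)"
    by (rule bij_betw_same_card)
  moreover have "card ?P = card (edges G)"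
  proof (rule bij_betw_same_card)
    show "bij_betw (\<lambda>(u, v). {u, v}) ?P (edges G)"
    proof (rule bij_betw_imageI)
      have "whites G \<inter> blacks G = {}"
        using G by (simp add: bipartitioned_graph_def)
      then show "inj_on (\<lambda>(u, v). {u, v}) ?P"
        by (auto simp: inj_on_def doubleton_eq_iff)
      show "(\<lambda>(u, v). {u, v}) ` ?P = edges G"
      proof
        show "edges G \<subseteq> (\<lambda>(u, v). {u, v}) ` ?P"
        proof
          fix e assume e: "e \<in> edges G"
          then obtain u v where "u \<in> whites G" "v \<in> blacks G" "e = {u, v}"
            using G unfolding bipartitioned_graph_def by blast
          with e have "(u, v) \<in> ?P" "e = (\<lambda>(u, v). {u, v}) (u, v)" by auto
          then show "e \<in> (\<lambda>(u, v). {u, v}) ` ?P" by blast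
        qed
      qed auto
    qed
  qed
  ultimately show ?thesis
    by simp
qed

lemma ex_specht_module_of:
  assumes "bipartitioned_graph G"
  shows "\<exists>V. is_specht_module_of G V"
proof -
  have "finite (whites G \<union> blacks G)"
    using assms by (simp add: bipartitioned_graph_def)
  then obtain f :: "'a \<Rightarrow> nat" where "inj_on f (whites G \<union> blacks G)"
    using finite_imp_inj_to_nat_seg by blast
  then have \<nu>: "numbering G (Suc \<circ> f)"
    by (auto simp: numbering_def inj_on_def)
  then have "finite (graph_diagram G (Suc \<circ> f))"
    using is_diagram_graph_diagram[OF assms] by (simp add: is_diagram_def)
  then obtain t where "bij_betw t {1..card (graph_diagram G (Suc \<circ> f))} (graph_diagram G (Suc \<circ> f))"
    using ex_bij_betw_nat_finite_1 by blast
  with \<nu> show ?thesis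
    unfolding is_specht_module_of_def box_ordering_def by blast
qed

end

theory Submission
  imports Defs
begin

text \<open>An element of the Specht module of a diagram \<open>D\<close> with \<open>n\<close> boxes is realised as a function of row
words, that is, of maps \<open>w\<close> from the letters \<open>1, \<dots>, n\<close> to rows. The polytabloid of a column word \<open>c\<close>
is \<open>w \<mapsto> \<epsilon>(w, c)\<close>, where \<open>\<epsilon>\<close> vanishes unless \<open>k \<mapsto> (w k, c k)\<close> enumerates the boxes of \<open>D\<close>, and is
then the sign of that enumeration. The span of the polytabloids is \<open>word_module D\<close>; it is isomorphic
to the left ideal generated by \<open>C(D)R(D)\<close> (\<open>word_rep_specht_module\<close>). In this model rows and columns
enter symmetrically, and most identities are immediate because the values of \<open>\<epsilon>\<close> on the enumerations
of \<open>D\<close> are determined up to one common scalar by alternation (\<open>orientation_unique\<close>).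

A surjection. Fixing \<open>w n = i\<close> sends the polytabloid of a column word ending in \<open>j\<close> to a nonzero
multiple of a polytabloid of \<open>D - {(i, j)}\<close> if \<open>(i, j) \<in> D\<close>, and to \<open>0\<close> otherwise. Since \<open>G\<close> is a
forest, the edges of a matching can be listed as \<open>e\<^sub>1, \<dots>, e\<^sub>r\<close> such that the row of \<open>e\<^sub>l\<close> and the
column of \<open>e\<^sub>m\<close> do not meet in a box when \<open>l < m\<close> (\<open>ex_triangular_order\<close>). Fixing the last letter in
the row of \<open>e\<^sub>m\<close> and then applying an equivariant map onto the Specht module of \<open>D - {e\<^sub>m}\<close> gives a
triangular family of maps, which is therefore jointly surjective onto the direct sum (\<open>branching\<close>).

Equality of dimensions. Let \<open>g D\<close> be the dimension of the Specht module of \<open>D\<close>. By the above,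
\<open>g D\<close> is at least the sum of the \<open>g (D - {e})\<close> over a matching. Two more inequalities hold: for an
edge \<open>(c, d)\<close> of \<open>H\<close>, a new row \<open>a\<close> and a new column \<open>b\<close>,
\<open>g (H + (c, b)) + g (H + (a, d)) \<le> g (H + (a, b)) \<le> (|H| + 1) * g H\<close>
(\<open>specht_dim_attach_le\<close>, of the type of James and Peel, and \<open>specht_dim_isolated_box_le\<close>). If \<open>(c, d)\<close>
is a leaf edge, then deleting the edges of an almost perfect matching from the two forests on the left
leads, by induction, to a lower bound \<open>(|H| + 1) * g H\<close> for the left-hand side. So all inequalities
are equalities. Every nonempty forest without isolated edges is of the form \<open>H + (c, b)\<close> or \<open>H + (a, d)\<close>, up
to exchanging the colours: next to the end of a longest path there is a vertex with two leaves or a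
vertex of degree two (\<open>forest_relation_cases\<close>). Hence \<open>g D\<close> equals the sum of the \<open>g (D - {e})\<close> for
every almost perfect matching (\<open>deletion_recursion\<close>), and the surjection is an isomorphism.\<close>

section \<open>Dimensions of spaces of functions\<close>

definition cscale :: "complex \<Rightarrow> ('a \<Rightarrow> complex) \<Rightarrow> 'a \<Rightarrow> complex"
  where "cscale c f = (\<lambda>x. c * f x)"

interpretation cfun: vector_space cscale
  by unfold_locales (auto simp: cscale_def fun_eq_iff algebra_simps)

interpretation cfun_pair: vector_space_pair cscale cscale ..

abbreviation clinear :: "(('a \<Rightarrow> complex) \<Rightarrow> ('b \<Rightarrow> complex)) \<Rightarrow> bool"
  where "clinear \<equiv> Vector_Spaces.linear cscale cscale"

lemma clinear_iff:
  "clinear f \<longleftrightarrow> (\<forall>x y. f (x + y) = f x + f y) \<and> (\<forall>c x. f (cscale c x) = cscale c (f x))"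
  by (simp add: Vector_Spaces.linear_iff cfun.vector_space_axioms)

lemma (in vector_space_pair) dim_kernel_plus_dim_image:
  assumes f: "Vector_Spaces.linear s1 s2 f" and S: "vs1.subspace S" "S \<subseteq> vs1.span A" "finite A"
  shows "vs1.dim S = vs2.dim (f ` S) + vs1.dim {x \<in> S. f x = 0}"
proof -
  interpret f: Vector_Spaces.linear s1 s2 f by (fact f)
  let ?K = "{x \<in> S. f x = 0}"
  have K: "vs1.subspace ?K"
    using S(1) by (auto simp: vs1.subspace_def f.add f.scale)
  obtain B0 where B0: "B0 \<subseteq> ?K" "vs1.independent B0" "?K \<subseteq> vs1.span B0" "card B0 = vs1.dim ?K"
    using vs1.basis_exists by blast
  have "B0 \<subseteq> S" using B0(1) by auto
  then obtain B where B: "B0 \<subseteq> B" "B \<subseteq> S" "vs1.independent B" "S \<subseteq> vs1.span B"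
    using vs1.maximal_independent_subset_extend[OF _ B0(2)] by metis
  have fB: "finite B"
    using vs1.independent_span_bound[OF S(3) B(3)] B(2) S(2) by blast
  define C where "C = B - B0"
  have BC: "B = B0 \<union> C" "B0 \<inter> C = {}" "finite C" "finite B0"
    using B(1) fB by (auto simp: C_def finite_subset)
  have spanB: "vs1.span B = S"
    using B S(1) by (simp add: vs1.span_subspace)
  have inj: "inj_on f (vs1.span C)"
  proof -
    have "x = 0" if x: "x \<in> vs1.span C" "f x = 0" for x
    proof -
      have "x \<in> S" using x(1) vs1.span_mono[of C B] spanB BC by auto
      then have x0: "x \<in> vs1.span B0" using x(2) B0(3) by auto
      have "vs1.representation B x = vs1.representation C x"
        by (rule vs1.representation_extend[OF B(3) x(1)]) (use BC in auto)
      moreover have "vs1.representation B x = vs1.representation B0 x"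
        by (rule vs1.representation_extend[OF B(3) x0]) (use BC in auto)
      ultimately have "vs1.representation B x b = 0" for b
        using vs1.representation_ne_zero BC(2) by (metis disjoint_iff)
      then show "x = 0"
        using vs1.sum_nonzero_representation_eq[OF B(3), of x] \<open>x \<in> S\<close> spanB by auto
    qed
    then show ?thesis
      by (simp add: f.inj_on_iff_eq_0[OF vs1.subspace_span])
  qed
  have indC: "vs1.independent C" using B(3) BC(1) vs1.independent_mono by blast
  have "vs2.independent (f ` C)"
    by (rule f.independent_injective_image[OF indC inj])
  moreover have "f ` S \<subseteq> vs2.span (f ` C)"
  proof -
    have "f ` S = vs2.span (f ` B)" using spanB f.span_image[of B] by simp
    also have "\<dots> \<subseteq> vs2.span (f ` C)"
    proof (rule vs2.span_minimal)
      show "f ` B \<subseteq> vs2.span (f ` C)"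
        using BC(1) B0(1) by (auto simp: vs2.span_zero intro: vs2.span_base)
    qed simp
    finally show ?thesis .
  qed
  moreover have "f ` C \<subseteq> f ` S" using B(2) BC(1) by auto
  ultimately have "vs2.dim (f ` S) = card (f ` C)"
    using vs2.basis_card_eq_dim by metis
  also have "\<dots> = card C"
    using inj vs1.span_superset by (meson card_image inj_on_subset)
  finally have "vs2.dim (f ` S) = card C" .
  moreover have "vs1.dim S = card B"
    using B vs1.basis_card_eq_dim by metis
  ultimately show ?thesis using BC B0(4) by (simp add: card_Un_disjoint)
qed

lemma cfun_finite_basis:
  assumes "S \<subseteq> cfun.span A" "finite A"
  obtains B where "finite B" "B \<subseteq> S" "cfun.independent B" "S \<subseteq> cfun.span B" "card B = cfun.dim S"
proof -
  obtain B where B: "B \<subseteq> S" "cfun.independent B" "S \<subseteq> cfun.span B" "card B = cfun.dim S"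
    using cfun.basis_exists by blast
  moreover have "finite B"
    using cfun.independent_span_bound[OF assms(2) B(2)] B(1) assms(1) by blast
  ultimately show ?thesis using that by blast
qed

lemma cfun_dim_eq_0_imp_trivial:
  assumes "cfun.dim S = 0" "S \<subseteq> cfun.span A" "finite A" "x \<in> S"
  shows "x = 0"
proof -
  obtain B where B: "finite B" "S \<subseteq> cfun.span B" "card B = cfun.dim S"
    by (rule cfun_finite_basis[OF assms(2,3)]) blast
  then have "B = {}" using assms(1) by simp
  then show ?thesis using B(2) assms(4) by auto
qed

lemma cfun_subspace_eqI:
  assumes "cfun.subspace U" "U \<subseteq> S" "S \<subseteq> cfun.span A" "finite A" "cfun.dim U = cfun.dim S"
  shows "U = S"
proof (rule ccontr)
  assume "U \<noteq> S"
  then obtain x where x: "x \<in> S" "x \<notin> U" using assms(2) by auto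
  obtain B where B: "B \<subseteq> U" "cfun.independent B" "card B = cfun.dim U" and finB: "finite B"
    by (rule cfun_finite_basis[OF subset_trans[OF assms(2,3)] assms(4)]) blast
  obtain C where C: "finite C" "S \<subseteq> cfun.span C" "card C = cfun.dim S"
    by (rule cfun_finite_basis[OF assms(3,4)]) blast
  have "cfun.span B \<subseteq> U" using B(1) assms(1) by (rule cfun.span_minimal)
  then have nx: "x \<notin> cfun.span B" using x(2) by auto
  then have "cfun.independent (insert x B)" using B(2) by (rule cfun.independent_insertI)
  moreover have "insert x B \<subseteq> cfun.span C" using x(1) B(1) C(2) assms(2) by auto
  ultimately have "card (insert x B) \<le> card C"
    using cfun.independent_span_bound[OF C(1)] by blast
  moreover have "x \<notin> B" using nx cfun.span_base by blast
  ultimately show False using finB B(3) C(3) assms(5) by simp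
qed

lemma cfun_dim_inj_image:
  assumes "clinear f" "cfun.subspace S" "S \<subseteq> cfun.span A" "finite A"
    and "\<And>x. x \<in> S \<Longrightarrow> f x = 0 \<Longrightarrow> x = 0"
  shows "cfun.dim (f ` S) = cfun.dim S"
proof -
  have "{x \<in> S. f x = 0} \<subseteq> {0}" using assms(5) by auto
  then have "cfun.dim {x \<in> S. f x = 0} \<le> card ({} :: ('a \<Rightarrow> complex) set)"
    by (intro cfun.dim_le_card) auto
  then show ?thesis
    using cfun_pair.dim_kernel_plus_dim_image[OF assms(1-4)] by simp
qed

text \<open>Each map \<open>f (es ! m)\<close> is already onto on the common kernel of the earlier maps. Splitting off one map
at a time gives both the dimension formula and, by successive correction, a common preimage of any
family of targets.\<close>

lemma triangular_family:
  fixes f :: "'i \<Rightarrow> ('a \<Rightarrow> complex) \<Rightarrow> ('b \<Rightarrow> complex)"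
  assumes "cfun.subspace S" "S \<subseteq> cfun.span A" "finite A" "distinct es"
    and "\<And>e. e \<in> set es \<Longrightarrow> clinear (f e)"
    and "\<And>e. e \<in> set es \<Longrightarrow> cfun.subspace (R e)"
    and "\<And>e x. e \<in> set es \<Longrightarrow> x \<in> S \<Longrightarrow> f e x \<in> R e"
    and "\<And>m. m < length es \<Longrightarrow> R (es ! m) \<subseteq> f (es ! m) ` {x \<in> S. \<forall>l<m. f (es ! l) x = 0}"
  shows "cfun.dim S = (\<Sum>e\<in>set es. cfun.dim (R e)) + cfun.dim {x \<in> S. \<forall>e\<in>set es. f e x = 0}
     \<and> (\<forall>y. (\<forall>e\<in>set es. y e \<in> R e) \<longrightarrow> (\<exists>x\<in>S. \<forall>e\<in>set es. f e x = y e))"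
  using assms
proof (induction es arbitrary: S)
  case Nil
  then show ?case by (auto dest: cfun.subspace_0)
next
  case (Cons e es)
  let ?S' = "{x \<in> S. f e x = 0}"
  interpret fe: Vector_Spaces.linear cscale cscale "f e"
    using Cons.prems(5) by simp
  have onto: "R e \<subseteq> f e ` S"
    using Cons.prems(8)[of 0] by auto
  have into: "f e ` S \<subseteq> R e"
    using Cons.prems(7) by auto
  have S': "cfun.subspace ?S'"
    using Cons.prems(1) by (auto simp: cfun.subspace_def fe.add fe.scale)
  have IH: "cfun.dim ?S' = (\<Sum>e\<in>set es. cfun.dim (R e)) + cfun.dim {x \<in> ?S'. \<forall>e\<in>set es. f e x = 0}
     \<and> (\<forall>y. (\<forall>e\<in>set es. y e \<in> R e) \<longrightarrow> (\<exists>x\<in>?S'. \<forall>e\<in>set es. f e x = y e))"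
  proof (rule Cons.IH[OF S' _ \<open>finite A\<close>])
    fix m assume m: "m < length es"
    have "R ((e # es) ! Suc m) \<subseteq> f ((e # es) ! Suc m) ` {x \<in> S. \<forall>l<Suc m. f ((e # es) ! l) x = 0}"
      by (rule Cons.prems(8)) (use m in simp)
    then have "R (es ! m) \<subseteq> f (es ! m) ` {x \<in> S. \<forall>l<Suc m. f ((e # es) ! l) x = 0}"
      unfolding nth_Cons_Suc .
    also have "\<dots> \<subseteq> f (es ! m) ` {x \<in> ?S'. \<forall>l<m. f (es ! l) x = 0}"
      by (rule image_mono) (auto simp: less_Suc_eq_0_disj)
    finally show "R (es ! m) \<subseteq> f (es ! m) ` {x \<in> ?S'. \<forall>l<m. f (es ! l) x = 0}" .
  qed (use Cons.prems in auto)
  have "cfun.dim S = cfun.dim (R e) + cfun.dim ?S'"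
    using cfun_pair.dim_kernel_plus_dim_image[OF fe.linear_axioms Cons.prems(1-3)] into onto
    by (simp add: subset_antisym)
  moreover have "{x \<in> ?S'. \<forall>e\<in>set es. f e x = 0} = {x \<in> S. \<forall>e\<in>set (e # es). f e x = 0}"
    by auto
  moreover have "\<exists>x\<in>S. \<forall>e\<in>set (e # es). f e x = y e" if y: "\<forall>e\<in>set (e # es). y e \<in> R e" for y
  proof -
    obtain x0 where x0: "x0 \<in> S" "f e x0 = y e"
      using y onto by auto
    have "\<forall>e'\<in>set es. y e' - f e' x0 \<in> R e'"
      using y x0(1) Cons.prems(6,7) by (simp add: cfun.subspace_diff)
    then obtain x1 where x1: "x1 \<in> ?S'" "\<forall>e'\<in>set es. f e' x1 = y e' - f e' x0"
      using conjunct2[OF IH, rule_format, of "\<lambda>e'. y e' - f e' x0"] by auto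
    have "f e' (x0 + x1) = y e'" if "e' \<in> set (e # es)" for e'
    proof -
      have "f e' (x0 + x1) = f e' x0 + f e' x1"
        using Cons.prems(5)[OF that] by (simp add: clinear_iff)
      then show ?thesis using that x0(2) x1 by auto
    qed
    moreover have "x0 + x1 \<in> S"
      using x0(1) x1(1) Cons.prems(1) by (simp add: cfun.subspace_add)
    ultimately show ?thesis by blast
  qed
  ultimately show ?case
    using IH \<open>distinct (e # es)\<close> by (simp add: zero_fun_def)
qed

lemma cfun_dim_mono:
  assumes "S \<subseteq> T" "T \<subseteq> cfun.span A" "finite A"
  shows "cfun.dim S \<le> cfun.dim T"
proof -
  obtain C where C: "finite C" "T \<subseteq> cfun.span C" "card C = cfun.dim T"
    by (rule cfun_finite_basis[OF assms(2,3)]) blast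
  then have "cfun.dim S \<le> card C" using assms(1) by (intro cfun.dim_le_card) auto
  then show ?thesis using C(3) by simp
qed

lemma sum_apply: "(\<Sum>a\<in>A. f a) x = (\<Sum>a\<in>A. f a x)"
  by (induction A rule: infinite_finite_induct) simp_all

section \<open>Orientations of a diagram\<close>

definition some_ordering :: "'b set \<Rightarrow> nat \<Rightarrow> 'b" where
  "some_ordering D = (SOME t. bij_betw t {1..card D} D)"

text \<open>Zero on maps that are not enumerations, so that sums over all words need no side conditions. The
reference enumeration is arbitrary, since only signs up to a common factor matter.\<close>

definition orientation :: "'b set \<Rightarrow> (nat \<Rightarrow> 'b) \<Rightarrow> complex" where
  "orientation D p =
     (if bij_betw p {1..card D} D
      then of_int (sign (\<lambda>k. if k \<in> {1..card D}
                             then inv_into {1..card D} (some_ordering D) (p k) else k))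
      else 0)"

lemma bij_betw_some_ordering: "finite D \<Longrightarrow> bij_betw (some_ordering D) {1..card D} D"
  unfolding some_ordering_def by (rule someI_ex[OF ex_bij_betw_nat_finite_1])

lemma transition_permutes:
  assumes p: "bij_betw p {1..n} D" and t: "bij_betw t {1..n} D"
  defines "\<sigma> \<equiv> \<lambda>k. if k \<in> {1..n} then inv_into {1..n} t (p k) else k"
  shows "\<sigma> permutes {1..n}" and "k \<in> {1..n} \<Longrightarrow> p k = t (\<sigma> k)"
proof -
  have "bij_betw (inv_into {1..n} t \<circ> p) {1..n} {1..n}"
    using bij_betw_trans[OF p bij_betw_inv_into[OF t]] .
  then have "bij_betw \<sigma> {1..n} {1..n}"
    by (rule bij_betw_cong[THEN iffD1, rotated]) (simp add: \<sigma>_def)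
  then show "\<sigma> permutes {1..n}"
    by (rule bij_imp_permutes) (simp only: \<sigma>_def if_False)
  show "p k = t (\<sigma> k)" if "k \<in> {1..n}"
    using that p bij_betw_inv_into_right[OF t, of "p k"] by (simp add: \<sigma>_def bij_betw_apply)
qed

lemma bij_betw_factor:
  assumes p: "bij_betw p {1..n} D" and t: "bij_betw t {1..n} D"
  obtains \<sigma> where "\<sigma> permutes {1..n}" "\<And>k. k \<in> {1..n} \<Longrightarrow> p k = t (\<sigma> k)"
  using transition_permutes[OF p t] by (rule that)

lemma bij_betw_permutes_iff:
  assumes "\<sigma> permutes {1..n::nat}"
  shows "bij_betw (\<lambda>k. p (\<sigma> k)) {1..n} D \<longleftrightarrow> bij_betw p {1..n} D"
  using bij_betw_comp_iff[OF permutes_imp_bij[OF assms], of p D] by (simp add: o_def)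

lemma orientation_eq_0_iff: "orientation D p = 0 \<longleftrightarrow> \<not> bij_betw p {1..card D} D"
  by (auto simp: orientation_def sign_def)

lemma orientation_cong:
  assumes "\<And>k. k \<in> {1..card D} \<Longrightarrow> p k = q k"
  shows "orientation D p = orientation D q"
proof -
  have "bij_betw p {1..card D} D = bij_betw q {1..card D} D"
    by (rule bij_betw_cong) (rule assms)
  moreover have "(\<lambda>k. if k \<in> {1..card D} then inv_into {1..card D} (some_ordering D) (p k) else k)
     = (\<lambda>k. if k \<in> {1..card D} then inv_into {1..card D} (some_ordering D) (q k) else k)"
    using assms by (auto simp: fun_eq_iff)
  ultimately show ?thesis by (simp only: orientation_def)
qed

lemma orientation_permute:
  assumes \<sigma>: "\<sigma> permutes {1..card D}"
  shows "orientation D (\<lambda>k. p (\<sigma> k)) = of_int (sign \<sigma>) * orientation D p"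
proof (cases "bij_betw p {1..card D} D")
  case True
  then have fin: "finite D" using bij_betw_finite by blast
  let ?r = "\<lambda>p k. if k \<in> {1..card D} then inv_into {1..card D} (some_ordering D) (p k) else k"
  have "?r p permutes {1..card D}"
    by (rule transition_permutes(1)[OF True bij_betw_some_ordering[OF fin]])
  moreover have "?r (\<lambda>k. p (\<sigma> k)) = ?r p \<circ> \<sigma>"
  proof
    fix k
    show "?r (\<lambda>k. p (\<sigma> k)) k = (?r p \<circ> \<sigma>) k"
      using permutes_in_image[OF \<sigma>, of k] permutes_not_in[OF \<sigma>, of k]
      by (cases "k \<in> {1..card D}") (simp_all only: o_apply if_True if_False not_False_eq_True simp_thms)
  qed
  moreover have "permutation (?r p)" "permutation \<sigma>"
    using calculation(1) \<sigma> permutation_permutes finite_atLeastAtMost by blast+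
  ultimately have "sign (?r (\<lambda>k. p (\<sigma> k))) = sign (?r p) * sign \<sigma>"
    by (simp only: sign_compose)
  then show ?thesis
    using True bij_betw_permutes_iff[OF \<sigma>, of p D] by (simp only: orientation_def if_True of_int_mult mult.commute[of "of_int (sign \<sigma>)"])
next
  case False
  then show ?thesis
    using bij_betw_permutes_iff[OF \<sigma>, of p D] by (simp add: orientation_def)
qed

text \<open>The enumerations of \<open>D\<close> form one orbit under permutations of the letters, so an alternating function
supported on them is determined by a single value. This replaces all explicit computations of signs.\<close>

lemma orientation_unique:
  assumes "finite D" "card D = n"
    and "\<And>p q. (\<And>k. k \<in> {1..n} \<Longrightarrow> p k = q k) \<Longrightarrow> F p = F q"
    and "\<And>p \<sigma>. \<sigma> permutes {1..n} \<Longrightarrow> F (\<lambda>k. p (\<sigma> k)) = of_int (sign \<sigma>) * F p"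
    and "\<And>p. F p = (0::complex) \<longleftrightarrow> \<not> bij_betw p {1..n} D"
  shows "\<exists>z. z \<noteq> 0 \<and> (\<forall>p. F p = z * orientation D p)"
proof -
  let ?t = "some_ordering D"
  have t: "bij_betw ?t {1..n} D" using bij_betw_some_ordering[OF assms(1)] assms(2) by simp
  define z where "z = F ?t / orientation D ?t"
  have nz: "orientation D ?t \<noteq> 0" "F ?t \<noteq> 0"
    using t assms(5)[of ?t] orientation_eq_0_iff[of D ?t] unfolding assms(2) by blast+
  have "F p = z * orientation D p" for p
  proof (cases "bij_betw p {1..n} D")
    case True
    obtain \<sigma> where \<sigma>: "\<sigma> permutes {1..n}" "\<And>k. k \<in> {1..n} \<Longrightarrow> p k = ?t (\<sigma> k)"
      by (rule bij_betw_factor[OF True t]) blast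
    have "F p = F (\<lambda>k. ?t (\<sigma> k))" by (rule assms(3)) (rule \<sigma>(2))
    moreover have "orientation D p = orientation D (\<lambda>k. ?t (\<sigma> k))"
      by (rule orientation_cong) (use \<sigma>(2) assms(2) in auto)
    ultimately show ?thesis
      using assms(4)[OF \<sigma>(1), of ?t] orientation_permute[of \<sigma> D ?t] \<sigma>(1) nz(1)
      unfolding assms(2) by (simp add: z_def)
  next
    case False
    then have "F p = 0" "orientation D p = 0"
      using assms(5)[of p] orientation_eq_0_iff[of D p] unfolding assms(2) by auto
    then show ?thesis by simp
  qed
  moreover have "z \<noteq> 0" using nz by (simp add: z_def)
  ultimately show ?thesis by blast
qed

lemma orientation_image:
  assumes "finite D" "inj f"
  obtains z where "z \<noteq> 0" "\<And>p. orientation (f ` D) (\<lambda>k. f (p k)) = z * orientation D p"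
proof -
  have c: "card (f ` D) = card D" by (rule card_image[OF inj_on_subset[OF assms(2) subset_UNIV]])
  define F where "F p = orientation (f ` D) (\<lambda>k. f (p k))" for p
  have "\<exists>z. z \<noteq> 0 \<and> (\<forall>p. F p = z * orientation D p)"
  proof (rule orientation_unique[OF assms(1) refl])
    show "F (\<lambda>k. p (\<sigma> k)) = of_int (sign \<sigma>) * F p"
      if "\<sigma> permutes {1..card D}" for p \<sigma>
      using orientation_permute[of \<sigma> "f ` D" "\<lambda>k. f (p k)"] that c by (simp add: F_def)
    show "(F p = 0) = (\<not> bij_betw p {1..card D} D)" for p
    proof -
      have "bij_betw (\<lambda>k. f (p k)) {1..card D} (f ` D) \<longleftrightarrow> bij_betw p {1..card D} D"
      proof -
        have "(\<lambda>k. f (p k)) ` {1..card D} = f ` (p ` {1..card D})" by (simp add: image_image)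
        moreover have "inj_on (\<lambda>k. f (p k)) {1..card D} = inj_on p {1..card D}"
          by (simp add: inj_on_def inj_eq[OF assms(2)])
        ultimately show ?thesis using assms(2) by (simp add: bij_betw_def inj_image_eq_iff)
      qed
      then show ?thesis by (simp add: F_def orientation_eq_0_iff c)
    qed
    show "F p = F q"
      if "\<And>k. k \<in> {1..card D} \<Longrightarrow> p k = q k" for p q
      unfolding F_def by (rule orientation_cong) (use that c in auto)
  qed
  then show ?thesis using that unfolding F_def by blast
qed

lemma permute_before_last:
  fixes n :: nat
  assumes \<sigma>: "\<sigma> permutes {1..n - 1}" and n: "n > 0"
  shows "\<sigma> permutes {1..n}" and "(\<lambda>k. (w(n := x)) (\<sigma> k)) = (\<lambda>k. w (\<sigma> k))(n := x)"
proof -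
  show "\<sigma> permutes {1..n}" by (rule permutes_subset[OF \<sigma>]) auto
  have "n \<notin> {1..n - 1}" using n by simp
  then have fix_n: "\<sigma> n = n" by (rule permutes_not_in[OF \<sigma>])
  have "\<sigma> k = n \<longleftrightarrow> k = n" for k
    using inj_eq[OF permutes_inj[OF \<sigma>], of k n] unfolding fix_n .
  then show "(\<lambda>k. (w(n := x)) (\<sigma> k)) = (\<lambda>k. w (\<sigma> k))(n := x)"
    by (simp add: fun_upd_def)
qed

lemma permutes_fixing_last:
  fixes n :: nat
  assumes "\<sigma> permutes {1..n}" "\<sigma> n = n"
  shows "\<sigma> permutes {1..n - 1}"
  by (rule permutes_superset[OF assms(1)]) (use assms(2) in \<open>auto simp: le_less\<close>)

text \<open>With the last letter placed on \<open>b\<close>, the orientation of \<open>D\<close> is an alternating function of the remaining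
letters, supported on the enumerations of \<open>D - {b}\<close>.\<close>

lemma orientation_remove:
  assumes D: "finite D" "b \<in> D"
  obtains z where "z \<noteq> 0"
    "\<And>p. orientation D (p(card D := b)) = z * orientation (D - {b}) p"
proof -
  let ?n = "card D"
  have n: "?n > 0" "card (D - {b}) = ?n - 1"
    using D by (auto simp: card_gt_0_iff)
  have I: "{1..?n} = insert ?n {1..?n - 1}" "?n \<notin> {1..?n - 1}" using n by auto
  define F where "F p = orientation D (p(?n := b))" for p
  have "\<exists>z. z \<noteq> 0 \<and> (\<forall>p. F p = z * orientation (D - {b}) p)"
  proof (rule orientation_unique[OF _ n(2)])
    show "finite (D - {b})" using D by simp
    show "F p = F q"
      if "\<And>k. k \<in> {1..?n - 1} \<Longrightarrow> p k = q k" for p q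
      unfolding F_def by (rule orientation_cong) (use that I in auto)
    show "F (\<lambda>k. p (\<sigma> k)) = of_int (sign \<sigma>) * F p"
      if \<sigma>: "\<sigma> permutes {1..?n - 1}" for p \<sigma>
      unfolding F_def permute_before_last(2)[OF \<sigma> n(1), symmetric]
      by (rule orientation_permute[OF permute_before_last(1)[OF \<sigma> n(1)]])
    show "(F p = 0) = (\<not> bij_betw p {1..?n - 1} (D - {b}))" for p
    proof -
      have "bij_betw (p(?n := b)) {1..?n} D \<longleftrightarrow> bij_betw (p(?n := b)) {1..?n - 1} (D - {b})"
        using notIn_Un_bij_betw3[of ?n "{1..?n - 1}" "p(?n := b)" "D - {b}"] I D(2)
        by (simp add: insert_absorb)
      also have "\<dots> \<longleftrightarrow> bij_betw p {1..?n - 1} (D - {b})"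
        by (rule bij_betw_cong) (use I in auto)
      finally show ?thesis by (simp add: F_def orientation_eq_0_iff)
    qed
  qed
  then show ?thesis using that unfolding F_def by blast
qed

text \<open>Exchanging the box \<open>y\<close> for \<open>x\<close> turns enumerations of one diagram into enumerations of the other. The sum
has at most one nonzero term, but it makes no reference to the letter that occupies \<open>y\<close>.\<close>

lemma orientation_move_box:
  assumes H: "finite H" "x \<notin> H" "y \<notin> H" and n: "n = Suc (card H)"
  obtains z where "z \<noteq> 0"
    "\<And>p. orientation (insert y H) p = z * (\<Sum>k \<in> {k \<in> {1..n}. p k = y}. orientation (insert x H) (p(k := x)))"
proof -
  let ?f = "transpose x y"
  have card: "card (insert x H) = n" "card (insert y H) = n" using H n by auto
  have im: "?f ` insert y H = insert x H"
    using H(2,3) by (auto simp: transpose_def image_iff)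
  have fin: "finite (insert y H)" using H(1) by simp
  have "inj ?f" by (rule bij_is_inj) (rule bij_transpose)
  then obtain z where z: "z \<noteq> 0" "\<And>p. orientation (insert x H) (\<lambda>k. ?f (p k)) = z * orientation (insert y H) p"
    using orientation_image[OF fin, of ?f] unfolding im by blast
  have "orientation (insert y H) p
      = 1 / z * (\<Sum>k \<in> {k \<in> {1..n}. p k = y}. orientation (insert x H) (p(k := x)))" for p
  proof (cases "bij_betw p {1..n} (insert y H)")
    case True
    then obtain k where k: "k \<in> {1..n}" "p k = y" by (metis bij_betw_def imageE insertI1)
    have inj: "inj_on p {1..n}" and "p ` {1..n} = insert y H" using True by (auto simp: bij_betw_def)
    have "{k \<in> {1..n}. p k = y} = {k}"
      using k inj by (auto dest: inj_onD)
    moreover have "orientation (insert x H) (p(k := x)) = orientation (insert x H) (\<lambda>k. ?f (p k))"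
    proof (rule orientation_cong)
      fix l assume l: "l \<in> {1..card (insert x H)}"
      then have "p l \<in> insert y H" using bij_betw_apply[OF True] card by simp
      moreover have "p l = y \<longleftrightarrow> l = k"
        using inj l k card by (metis inj_onD)
      ultimately show "(p(k := x)) l = ?f (p l)"
        using H(2,3) k(2) by (auto simp: transpose_def)
    qed
    ultimately show ?thesis using z by simp
  next
    case False
    then have "orientation (insert y H) p = 0" by (simp add: orientation_eq_0_iff card)
    moreover have "orientation (insert x H) (p(k := x)) = 0" if k: "k \<in> {1..n}" "p k = y" for k
    proof (rule ccontr)
      assume "\<not> ?thesis"
      then have b: "bij_betw (p(k := x)) {1..n} (insert x H)"
        using orientation_eq_0_iff card by metis
      have "bij_betw (p(k := x)) ({1..n} - {k}) (insert x H - {x})"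
        using b k(1) by (metis bij_betw_DiffI bij_betw_singletonI empty_subsetI fun_upd_same insert_subset insertI1 )
      then have "bij_betw p ({1..n} - {k}) H"
        using H(2) by (subst (asm) bij_betw_cong[of _ _ p]) auto
      then have "bij_betw p (insert k ({1..n} - {k})) (insert (p k) H)"
        using notIn_Un_bij_betw[of k "{1..n} - {k}" p H] k(2) H(3) by auto
      then show False using False k by (simp add: insert_absorb)
    qed
    ultimately show ?thesis by simp
  qed
  then show ?thesis using that[of "1 / z"] z(1) by simp
qed

section \<open>Polytabloids as functions of row words\<close>

text \<open>Up to scalar, this is the column-antisymmetrised row tabloid of a filling whose letters have the
columns given by \<open>c\<close>, or zero if there is no such filling. The choice of the filling affects only the sign.\<close>

definition polytabloid :: "('r \<times> 'c) set \<Rightarrow> (nat \<Rightarrow> 'c) \<Rightarrow> (nat \<Rightarrow> 'r) \<Rightarrow> complex" where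
  "polytabloid D c = (\<lambda>w. orientation D (\<lambda>k. (w k, c k)))"

definition word_module :: "('r \<times> 'c) set \<Rightarrow> ((nat \<Rightarrow> 'r) \<Rightarrow> complex) set" where
  "word_module D = cfun.span (range (polytabloid D))"

definition row_words :: "('r \<times> 'c) set \<Rightarrow> (nat \<Rightarrow> 'r) set" where
  "row_words D = {1..card D} \<rightarrow>\<^sub>E Domain D"

definition column_words :: "('r \<times> 'c) set \<Rightarrow> (nat \<Rightarrow> 'c) set" where
  "column_words D = {1..card D} \<rightarrow>\<^sub>E Range D"

lemma finite_words [simp]:
  "finite D \<Longrightarrow> finite (row_words D)" "finite D \<Longrightarrow> finite (column_words D)"
  by (simp_all add: row_words_def column_words_def finite_PiE finite_Domain finite_Range)

lemma bij_imp_restrict_in_words: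
  assumes "bij_betw (\<lambda>k. (w k, c k)) {1..card D} D"
  shows "restrict w {1..card D} \<in> row_words D" "restrict c {1..card D} \<in> column_words D"
proof -
  have "(w k, c k) \<in> D" if "k \<in> {1..card D}" for k using assms that by (rule bij_betw_apply)
  then show "restrict w {1..card D} \<in> row_words D" "restrict c {1..card D} \<in> column_words D"
    unfolding row_words_def column_words_def restrict_PiE_iff by blast+
qed

lemma subspace_word_module: "cfun.subspace (word_module D)"
  by (simp add: word_module_def)

lemma polytabloid_in_word_module: "polytabloid D c \<in> word_module D"
  by (simp add: word_module_def cfun.span_base)

lemma polytabloid_cong:
  assumes "\<And>k. k \<in> {1..card D} \<Longrightarrow> c k = c' k" "\<And>k. k \<in> {1..card D} \<Longrightarrow> w k = w' k"
  shows "polytabloid D c w = polytabloid D c' w'"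
  unfolding polytabloid_def by (rule orientation_cong) (simp add: assms)

lemma polytabloid_nonzero_imp_bij:
  "polytabloid D c w \<noteq> 0 \<Longrightarrow> bij_betw (\<lambda>k. (w k, c k)) {1..card D} D"
  using orientation_eq_0_iff unfolding polytabloid_def by blast

lemma polytabloid_permute:
  assumes "\<sigma> permutes {1..card D}"
  shows "polytabloid D (\<lambda>k. c (\<sigma> k)) (\<lambda>k. w (\<sigma> k)) = of_int (sign \<sigma>) * polytabloid D c w"
  unfolding polytabloid_def using orientation_permute[OF assms, of "\<lambda>k. (w k, c k)"] .

lemma cnj_polytabloid: "cnj (polytabloid D c w) = polytabloid D c w"
  by (simp add: polytabloid_def orientation_def)

lemma word_module_support:
  assumes "F \<in> word_module D" "F w \<noteq> 0"
  obtains c where "polytabloid D c w \<noteq> 0"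
proof -
  have "(\<forall>c. polytabloid D c w = 0) \<longrightarrow> F w = 0"
    using assms(1) unfolding word_module_def
    by (rule cfun.span_induct) (auto simp: cfun.subspace_def cscale_def)
  then show ?thesis using assms(2) that by blast
qed

lemma word_module_cong:
  assumes "F \<in> word_module D" "\<And>k. k \<in> {1..card D} \<Longrightarrow> w k = w' k"
  shows "F w = F w'"
  using assms(1) unfolding word_module_def
proof (rule cfun.span_induct)
  show "cfun.subspace {F. F w = F w'}" by (auto simp: cfun.subspace_def cscale_def)
  show "x w = x w'" if "x \<in> range (polytabloid D)" for x
    using that polytabloid_cong[of D _ _ w w'] assms(2) by auto
qed

lemma word_module_eqI:
  assumes F: "F \<in> word_module D" "\<And>w. w \<in> row_words D \<Longrightarrow> F w = 0"
  shows "F = 0"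
proof
  fix w
  show "F w = 0 w"
  proof (rule ccontr)
    assume "F w \<noteq> 0 w"
    then obtain c where "polytabloid D c w \<noteq> 0"
      using word_module_support[OF F(1), of w] by auto
    then have "bij_betw (\<lambda>k. (w k, c k)) {1..card D} D" by (rule polytabloid_nonzero_imp_bij)
    then have "restrict w {1..card D} \<in> row_words D" by (rule bij_imp_restrict_in_words)
    moreover have "F w = F (restrict w {1..card D})"
      by (rule word_module_cong[OF F(1)]) simp
    ultimately show False using F(2) \<open>F w \<noteq> 0 w\<close> by simp
  qed
qed

lemma word_module_finite_span:
  "word_module D = cfun.span (polytabloid D ` column_words D)"
proof -
  have "polytabloid D c \<in> cfun.span (polytabloid D ` column_words D)" for c
  proof (cases "polytabloid D c = 0")
    case True
    then show ?thesis by (simp add: cfun.span_zero)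
  next
    case False
    then obtain w where "polytabloid D c w \<noteq> 0" by (auto simp: fun_eq_iff)
    then have "bij_betw (\<lambda>k. (w k, c k)) {1..card D} D" by (rule polytabloid_nonzero_imp_bij)
    then have "restrict c {1..card D} \<in> column_words D" by (rule bij_imp_restrict_in_words)
    moreover have "polytabloid D c = polytabloid D (restrict c {1..card D})"
      by (rule ext, rule polytabloid_cong) simp_all
    ultimately show ?thesis by (metis cfun.span_base imageI)
  qed
  then show ?thesis
    unfolding word_module_def
    by (intro subset_antisym cfun.span_minimal cfun.subspace_span)
       (auto simp: cfun.span_base)
qed

text \<open>The composition of the matrix with entries \<open>polytabloid D c w\<close> with its adjoint: \<open>F\<close> is paired with every
polytabloid, and the results are taken as coefficients of the polytabloids. It stands in for the
orthogonal projection onto \<open>word_module D\<close>, being equivariant and bijective on that space.\<close>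

definition gram :: "('r \<times> 'c) set \<Rightarrow> ((nat \<Rightarrow> 'r) \<Rightarrow> complex) \<Rightarrow> (nat \<Rightarrow> 'r) \<Rightarrow> complex" where
  "gram D F = (\<lambda>w. \<Sum>c\<in>column_words D. (\<Sum>v\<in>row_words D. F v * polytabloid D c v) * polytabloid D c w)"

lemma clinear_gram: "clinear (gram D)"
  by (simp add: clinear_iff gram_def fun_eq_iff cscale_def algebra_simps sum.distrib sum_distrib_left)

lemma gram_in_word_module: "gram D F \<in> word_module D"
proof -
  have "gram D F = (\<Sum>c\<in>column_words D. cscale (\<Sum>v\<in>row_words D. F v * polytabloid D c v) (polytabloid D c))"
    by (simp add: gram_def fun_eq_iff sum_apply cscale_def)
  also have "\<dots> \<in> word_module D"
    by (intro cfun.subspace_sum cfun.subspace_scale subspace_word_module polytabloid_in_word_module)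
  finally show ?thesis .
qed

lemma sum_mult_cnj_eq_0:
  assumes "finite A" "(\<Sum>a\<in>A. h a * cnj (h a)) = 0" "a \<in> A"
  shows "h a = 0"
proof -
  have "(\<Sum>a\<in>A. h a * cnj (h a)) = of_real (\<Sum>a\<in>A. (cmod (h a))\<^sup>2)"
    by (simp add: complex_norm_square del: of_real_power)
  then have "(\<Sum>a\<in>A. (cmod (h a))\<^sup>2) = 0" using assms(2) by (metis of_real_eq_0_iff)
  then show ?thesis using assms(1,3) by (simp add: sum_nonneg_eq_0_iff)
qed

text \<open>If \<open>h c\<close> is the pairing of \<open>F\<close> with the polytabloid of \<open>c\<close>, then \<open>gram D F\<close> pairs with \<open>F\<close> to the sum
of the \<open>|h c|\<^sup>2\<close>. So \<open>gram D F = 0\<close> makes \<open>F\<close> orthogonal to all polytabloids, hence to itself.\<close>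

lemma gram_eq_0_imp:
  assumes D: "finite D" and F: "F \<in> word_module D" "gram D F = 0"
  shows "F = 0"
proof (rule word_module_eqI[OF F(1)])
  define h where "h c = (\<Sum>v\<in>row_words D. F v * polytabloid D c v)" for c
  have "(\<Sum>c\<in>column_words D. h c * cnj (h c))
      = (\<Sum>c\<in>column_words D. \<Sum>w\<in>row_words D. h c * polytabloid D c w * cnj (F w))"
    by (simp add: h_def[of _] cnj_polytabloid sum_distrib_left mult_ac)
  also have "\<dots> = (\<Sum>w\<in>row_words D. gram D F w * cnj (F w))"
    by (subst sum.swap) (simp add: gram_def h_def sum_distrib_right)
  also have "\<dots> = 0" using F(2) by simp
  finally have h: "h c = 0" if "c \<in> column_words D" for c
    using sum_mult_cnj_eq_0[OF finite_words(2)[OF D] _ that] by blast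
  have "(\<Sum>w\<in>row_words D. F w * cnj (G w)) = 0" if "G \<in> word_module D" for G
    using that unfolding word_module_finite_span
  proof (rule cfun.span_induct)
    show "cfun.subspace {G. (\<Sum>w\<in>row_words D. F w * cnj (G w)) = 0}"
    proof -
      have "(\<Sum>w\<in>row_words D. F w * cnj (cscale a G w)) = cnj a * (\<Sum>w\<in>row_words D. F w * cnj (G w))" for a G
        by (simp add: cscale_def sum_distrib_left mult_ac)
      then show ?thesis by (simp add: cfun.subspace_def sum.distrib algebra_simps)
    qed
    show "(\<Sum>w\<in>row_words D. F w * cnj (x w)) = 0" if "x \<in> polytabloid D ` column_words D" for x
      using that h by (auto simp: cnj_polytabloid h_def)
  qed
  from this[OF F(1)] show "F w = 0" if "w \<in> row_words D" for w
    using sum_mult_cnj_eq_0[OF finite_words(1)[OF D] _ that] by blast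
qed

lemma gram_image_word_module:
  assumes "finite D"
  shows "gram D ` word_module D = word_module D"
proof (rule cfun_subspace_eqI)
  interpret Vector_Spaces.linear cscale cscale "gram D" by (rule clinear_gram)
  show "cfun.subspace (gram D ` word_module D)" by (rule subspace_image[OF subspace_word_module])
  show "gram D ` word_module D \<subseteq> word_module D" using gram_in_word_module by auto
  show "word_module D \<subseteq> cfun.span (polytabloid D ` column_words D)"
    by (simp add: word_module_finite_span)
  show "finite (polytabloid D ` column_words D)" using finite_words(2)[OF assms] by (rule finite_imageI)
  show "cfun.dim (gram D ` word_module D) = cfun.dim (word_module D)"
    by (rule cfun_dim_inj_image[OF clinear_gram subspace_word_module _ _ gram_eq_0_imp[OF assms]])
       (use assms in \<open>auto simp: word_module_finite_span\<close>)
qed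

lemma sum_words_permute:
  assumes "\<sigma> permutes A"
  shows "(\<Sum>w\<in>A \<rightarrow>\<^sub>E B. g (\<lambda>k. w (\<sigma> k))) = (\<Sum>w\<in>A \<rightarrow>\<^sub>E B. g w)"
proof (rule sum.reindex_bij_witness[where i = "\<lambda>w k. w (inv' \<sigma> k)" and j = "\<lambda>w k. w (\<sigma> k)"])
  fix w assume w: "w \<in> A \<rightarrow>\<^sub>E B"
  have *: "(\<lambda>k. w (\<tau> k)) \<in> A \<rightarrow>\<^sub>E B" if "\<tau> permutes A" for \<tau>
    using w permutes_in_image[OF that] permutes_not_in[OF that]
    by (auto simp: PiE_def Pi_def extensional_def)
  show "(\<lambda>k. w (\<sigma> k)) \<in> A \<rightarrow>\<^sub>E B" by (rule *[OF assms])
  show "(\<lambda>k. w (inv' \<sigma> k)) \<in> A \<rightarrow>\<^sub>E B" by (rule *[OF permutes_inv[OF assms]])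
qed (simp_all add: permutes_inverses[OF assms])

lemma gram_permute:
  assumes \<sigma>: "\<sigma> permutes {1..card D}"
  shows "gram D (\<lambda>v. F (\<lambda>k. v (\<sigma> k))) = (\<lambda>w. gram D F (\<lambda>k. w (\<sigma> k)))"
proof
  fix w
  let ?s = "of_int (sign \<sigma>) :: complex"
  define H where "H c = (\<Sum>v\<in>row_words D. F v * polytabloid D c v) * polytabloid D c (\<lambda>k. w (\<sigma> k))" for c
  have s: "?s * ?s = 1" by (simp flip: of_int_mult)
  have u: "polytabloid D c v = ?s * polytabloid D (\<lambda>k. c (\<sigma> k)) (\<lambda>k. v (\<sigma> k))" for c v
    unfolding polytabloid_permute[OF \<sigma>] using s by (simp add: mult.assoc[symmetric])
  have "(\<Sum>v\<in>row_words D. F (\<lambda>k. v (\<sigma> k)) * polytabloid D c v) * polytabloid D c w = H (\<lambda>k. c (\<sigma> k))" for c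
  proof -
    have "(\<Sum>v\<in>row_words D. F (\<lambda>k. v (\<sigma> k)) * polytabloid D c v)
        = (\<Sum>v\<in>row_words D. F (\<lambda>k. v (\<sigma> k)) * (?s * polytabloid D (\<lambda>k. c (\<sigma> k)) (\<lambda>k. v (\<sigma> k))))"
      by (rule sum.cong[OF refl]) (subst u, rule refl)
    also have "\<dots> = (\<Sum>v\<in>row_words D. F v * (?s * polytabloid D (\<lambda>k. c (\<sigma> k)) v))"
      unfolding row_words_def by (rule sum_words_permute[OF \<sigma>, of "\<lambda>v. F v * (?s * polytabloid D (\<lambda>k. c (\<sigma> k)) v)"])
    also have "\<dots> = ?s * (\<Sum>v\<in>row_words D. F v * polytabloid D (\<lambda>k. c (\<sigma> k)) v)"
      by (simp add: sum_distrib_left mult_ac)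
    finally have *: "(\<Sum>v\<in>row_words D. F (\<lambda>k. v (\<sigma> k)) * polytabloid D c v) = \<dots>" .
    have "polytabloid D c w = ?s * polytabloid D (\<lambda>k. c (\<sigma> k)) (\<lambda>k. w (\<sigma> k))" by (rule u)
    then show ?thesis unfolding * H_def using s by (simp add: mult_ac)
  qed
  then have "gram D (\<lambda>v. F (\<lambda>k. v (\<sigma> k))) w = (\<Sum>c\<in>column_words D. H (\<lambda>k. c (\<sigma> k)))"
    by (simp add: gram_def)
  also have "\<dots> = (\<Sum>c\<in>column_words D. H c)"
    unfolding column_words_def by (rule sum_words_permute[OF \<sigma>])
  finally show "gram D (\<lambda>v. F (\<lambda>k. v (\<sigma> k))) w = gram D F (\<lambda>k. w (\<sigma> k))"
    by (simp add: H_def gram_def)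
qed

lemma polytabloid_act:
  assumes "\<sigma> permutes {1..card D}"
  shows "(\<lambda>w. polytabloid D c (\<lambda>k. w (\<sigma> k))) = cscale (of_int (sign \<sigma>)) (polytabloid D (\<lambda>k. c (inv' \<sigma> k)))"
  using polytabloid_permute[OF assms, of "\<lambda>k. c (inv' \<sigma> k)"]
  by (simp add: permutes_inverses[OF assms] cscale_def)

lemma word_module_act:
  assumes "\<sigma> permutes {1..card D}" "F \<in> word_module D"
  shows "(\<lambda>w. F (\<lambda>k. w (\<sigma> k))) \<in> word_module D"
proof -
  have lin: "clinear (\<lambda>F w. F (\<lambda>k. w (\<sigma> k)))" by (simp add: clinear_iff cscale_def plus_fun_def)
  have "(\<lambda>F w. F (\<lambda>k. w (\<sigma> k))) ` cfun.span (range (polytabloid D)) \<subseteq> word_module D"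
    unfolding cfun_pair.linear_span_image[OF lin, symmetric]
    by (rule cfun.span_minimal[OF _ subspace_word_module])
       (auto simp: polytabloid_act[OF assms(1)] intro!: cfun.subspace_scale[OF subspace_word_module] polytabloid_in_word_module)
  then show ?thesis using assms(2) unfolding word_module_def by blast
qed

section \<open>Removing the last letter\<close>

definition specht_dim :: "('r \<times> 'c) set \<Rightarrow> nat" where
  "specht_dim D = cfun.dim (word_module D)"

text \<open>After fixing the last letter in the row of \<open>e\<close>, the result need not lie in the Specht module of
\<open>D - {e}\<close> if that row has further boxes; \<open>gram\<close> moves it there equivariantly.\<close>

definition branch_map :: "('r \<times> 'c) set \<Rightarrow> 'r \<times> 'c \<Rightarrow> ((nat \<Rightarrow> 'r) \<Rightarrow> complex) \<Rightarrow> (nat \<Rightarrow> 'r) \<Rightarrow> complex" where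
  "branch_map D e F = gram (D - {e}) (\<lambda>w. F (w(card D := fst e)))"

lemma polytabloid_fix_last:
  assumes "finite D" "e \<in> D"
  obtains z where "z \<noteq> 0"
    "\<And>c w. polytabloid D (c(card D := snd e)) (w(card D := fst e)) = z * polytabloid (D - {e}) c w"
proof -
  obtain z where z: "z \<noteq> 0" "\<And>p. orientation D (p(card D := e)) = z * orientation (D - {e}) p"
    using orientation_remove[OF assms] by blast
  have "polytabloid D (c(card D := snd e)) (w(card D := fst e)) = z * polytabloid (D - {e}) c w" for c w
  proof -
    have "(\<lambda>k. ((w(card D := fst e)) k, (c(card D := snd e)) k)) = (\<lambda>k. (w k, c k))(card D := e)"
      by (simp add: fun_eq_iff)
    then show ?thesis unfolding polytabloid_def using z(2) by simp
  qed
  then show ?thesis using that z(1) by blast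
qed

lemma polytabloid_eq_0:
  assumes "k \<in> {1..card D}" "(w k, c k) \<notin> D"
  shows "polytabloid D c w = 0"
  using polytabloid_nonzero_imp_bij[of D c w] bij_betw_apply[OF _ assms(1)] assms(2) by blast

lemma clinear_branch_map: "clinear (branch_map D e)"
proof -
  have "clinear (gram (D - {e}))" by (rule clinear_gram)
  then show ?thesis
    unfolding clinear_iff branch_map_def by (simp add: cscale_def plus_fun_def)
qed

text \<open>The polytabloid of a column word that ends in the column of \<open>e\<^sub>m\<close> is annihilated by the earlier maps,
because the rows of \<open>e\<^sub>l\<close>, \<open>l < m\<close>, do not meet this column, while fixing the last letter in the row
of \<open>e\<^sub>m\<close> gives an arbitrary polytabloid of \<open>D - {e\<^sub>m}\<close>. So the family is triangular.\<close>

theorem branching: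
  assumes D: "finite D" and es: "distinct es" "set es \<subseteq> D"
    and sorted: "sorted_wrt (\<lambda>e f. (fst e, snd f) \<notin> D) es"
  shows "specht_dim D = (\<Sum>e\<in>set es. specht_dim (D - {e}))
            + cfun.dim {x \<in> word_module D. \<forall>e\<in>set es. branch_map D e x = 0}
     \<and> (\<forall>y. (\<forall>e\<in>set es. y e \<in> word_module (D - {e})) \<longrightarrow>
            (\<exists>x\<in>word_module D. \<forall>e\<in>set es. branch_map D e x = y e))"
  unfolding specht_dim_def
proof (rule triangular_family[where f = "branch_map D" and R = "\<lambda>e. word_module (D - {e})"
      and A = "polytabloid D ` column_words D"])
  show "word_module D \<subseteq> cfun.span (polytabloid D ` column_words D)"
    by (simp add: word_module_finite_span)
  show "finite (polytabloid D ` column_words D)" using D by simp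
  show "branch_map D e x \<in> word_module (D - {e})" for e x
    by (simp add: branch_map_def gram_in_word_module)
  fix m assume m: "m < length es"
  let ?e = "es ! m" and ?n = "card D"
  let ?U = "{x \<in> word_module D. \<forall>l<m. branch_map D (es ! l) x = 0}"
  have e: "?e \<in> D" using m es(2) by auto
  then have n: "?n \<in> {1..?n}" using D card_gt_0_iff[of D] by auto
  define P where "P F = (\<lambda>w. F (w(?n := fst ?e)))" for F :: "(nat \<Rightarrow> 'a) \<Rightarrow> complex"
  have P: "clinear P" by (simp add: clinear_iff P_def cscale_def plus_fun_def)
  have U: "cfun.subspace ?U"
  proof -
    have "branch_map D f (x + y) = branch_map D f x + branch_map D f y"
      "branch_map D f (cscale a x) = cscale a (branch_map D f x)" for f a x y
      using clinear_branch_map[of D f] unfolding clinear_iff by blast+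
    moreover have "branch_map D f 0 = 0" for f
      using clinear_branch_map[of D f] cfun_pair.linear_0 by blast
    ultimately show ?thesis
      using subspace_word_module[of D] by (auto simp: cfun.subspace_def)
  qed
  obtain z where z: "z \<noteq> 0"
    "\<And>c w. polytabloid D (c(?n := snd ?e)) (w(?n := fst ?e)) = z * polytabloid (D - {?e}) c w"
    using polytabloid_fix_last[OF D e] by blast
  have "polytabloid (D - {?e}) c \<in> P ` ?U" for c
  proof -
    let ?x = "polytabloid D (c(?n := snd ?e))"
    have "branch_map D (es ! l) ?x = 0" if "l < m" for l
    proof -
      have "(fst (es ! l), snd ?e) \<notin> D"
        using sorted_wrt_nth_less[OF sorted that m] .
      then have "(\<lambda>w. ?x (w(?n := fst (es ! l)))) = 0"
        using polytabloid_eq_0[OF n] by (auto simp: fun_eq_iff)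
      then have "branch_map D (es ! l) ?x = gram (D - {es ! l}) 0"
        unfolding branch_map_def by (rule arg_cong)
      also have "\<dots> = 0" by (rule cfun_pair.linear_0[OF clinear_gram])
      finally show ?thesis .
    qed
    then have x: "?x \<in> ?U" by (simp add: polytabloid_in_word_module)
    have "P ?x = cscale z (polytabloid (D - {?e}) c)"
      by (simp add: P_def z(2) cscale_def)
    moreover have "P (cscale (1 / z) ?x) = cscale (1 / z) (P ?x)"
      using P unfolding clinear_iff by blast
    ultimately have "P (cscale (1 / z) ?x) = polytabloid (D - {?e}) c"
      using z(1) by (simp add: cscale_def)
    moreover have "cscale (1 / z) ?x \<in> ?U" by (rule cfun.subspace_scale[OF U x])
    ultimately show ?thesis by (rule image_eqI[OF sym])
  qed
  then have "word_module (D - {?e}) \<subseteq> P ` ?U"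
    unfolding word_module_def[of "D - {?e}"]
    by (intro cfun.span_minimal cfun_pair.linear_subspace_image[OF P U]) auto
  then have "gram (D - {?e}) ` word_module (D - {?e}) \<subseteq> gram (D - {?e}) ` (P ` ?U)"
    by (rule image_mono)
  also have "\<dots> = branch_map D ?e ` ?U"
    by (simp add: image_image branch_map_def P_def)
  finally show "word_module (D - {?e}) \<subseteq> branch_map D ?e ` ?U"
    using gram_image_word_module[of "D - {?e}"] D by simp
qed (use es subspace_word_module clinear_branch_map in auto)

section \<open>Adding a box\<close>

lemma word_module_subset_finite_span:
  "finite D \<Longrightarrow> \<exists>A. finite A \<and> word_module D \<subseteq> cfun.span A"
  by (intro exI[of _ "polytabloid D ` column_words D"]) (simp add: word_module_finite_span)

text \<open>Replacing the row letter \<open>a\<close> by \<open>c\<close> maps the Specht module of \<open>H + (a, b)\<close> onto that of \<open>H + (c, b)\<close>.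
The Specht module of \<open>H + (a, d)\<close> is contained in the first one, by expanding along row \<open>a\<close>, and in the
kernel of this map: the column \<open>d\<close> contains both \<open>a\<close> and \<open>c\<close>, so after the replacement two equal rows
are antisymmetrised.\<close>

theorem specht_dim_attach_le:
  fixes H :: "('r \<times> 'c) set"
  assumes H: "finite H" "(c, d) \<in> H" and ab: "a \<notin> Domain H" "b \<notin> Range H"
  shows "specht_dim (insert (c, b) H) + specht_dim (insert (a, d) H) \<le> specht_dim (insert (a, b) H)"
proof -
  define n where "n = Suc (card H)"
  let ?E = "insert (a, b) H" and ?R = "insert (c, b) H" and ?C = "insert (a, d) H"
  have notin: "(a, b) \<notin> H" "(c, b) \<notin> H" "(a, d) \<notin> H" "a \<noteq> c" "b \<noteq> d"
    using ab H(2) by blast+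
  have card: "card ?E = n" "card ?R = n" "card ?C = n" using H(1) notin by (simp_all add: n_def)
  define \<Phi> where "\<Phi> F = (\<lambda>w. \<Sum>k\<in>{k \<in> {1..n}. w k = c}. F (w(k := a)))" for F :: "(nat \<Rightarrow> 'r) \<Rightarrow> complex"
  have \<Phi>: "clinear \<Phi>"
    by (simp add: clinear_iff \<Phi>_def cscale_def plus_fun_def sum.distrib sum_distrib_left)
  obtain z where z: "z \<noteq> 0"
    "\<And>p. orientation ?R p = z * (\<Sum>k \<in> {k \<in> {1..n}. p k = (c, b)}. orientation ?E (p(k := (a, b))))"
    using orientation_move_box[OF H(1) notin(1,2) n_def] by blast
  obtain z' where z': "z' \<noteq> 0"
    "\<And>p. orientation ?C p = z' * (\<Sum>k \<in> {k \<in> {1..n}. p k = (a, d)}. orientation ?E (p(k := (a, b))))"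
    using orientation_move_box[OF H(1) notin(1,3) n_def] by blast
  have upd: "(\<lambda>l. ((w(k := x)) l, u l)) = (\<lambda>l. (w l, u l))(k := (x, u k))"
    "(\<lambda>l. (w l, (u(k := y)) l)) = (\<lambda>l. (w l, u l))(k := (w k, y))" for w :: "nat \<Rightarrow> 'r" and u :: "nat \<Rightarrow> 'c" and k x y
    by (simp_all add: fun_eq_iff)
  have R: "\<Phi> (polytabloid ?E u) = cscale (1 / z) (polytabloid ?R u)" for u
  proof
    fix w
    let ?K = "{k \<in> {1..n}. (w k, u k) = (c, b)}"
    have "(\<Sum>k\<in>{k \<in> {1..n}. w k = c}. polytabloid ?E u (w(k := a)))
        = (\<Sum>k \<in> ?K. polytabloid ?E u (w(k := a)))"
    proof (rule sum.mono_neutral_right)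
      show "\<forall>k\<in>{k \<in> {1..n}. w k = c} - ?K. polytabloid ?E u (w(k := a)) = 0"
      proof
        fix k assume "k \<in> {k \<in> {1..n}. w k = c} - ?K"
        then have "k \<in> {1..n}" "u k \<noteq> b" by auto
        then show "polytabloid ?E u (w(k := a)) = 0"
          using ab(1) by (intro polytabloid_eq_0[of k]) (auto simp: card)
      qed
    qed auto
    also have "\<dots> = (\<Sum>k \<in> ?K. orientation ?E ((\<lambda>l. (w l, u l))(k := (a, b))))"
    proof (rule sum.cong[OF refl])
      fix k assume "k \<in> ?K"
      then have "u k = b" by simp
      then show "polytabloid ?E u (w(k := a)) = orientation ?E ((\<lambda>l. (w l, u l))(k := (a, b)))"
        unfolding polytabloid_def upd by (simp only:)
    qed
    also have "\<dots> = 1 / z * polytabloid ?R u w"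
      using z(1) z(2)[of "\<lambda>l. (w l, u l)"] by (simp add: polytabloid_def)
    finally show "\<Phi> (polytabloid ?E u) w = cscale (1 / z) (polytabloid ?R u) w"
      by (simp add: \<Phi>_def cscale_def)
  qed
  \<comment> \<open>Expansion along row \<open>a\<close>: the terms stand for the letters that may occupy its box.\<close>
  have C: "polytabloid ?C u = (\<Sum>k\<in>{k \<in> {1..n}. u k = d}. cscale z' (polytabloid ?E (u(k := b))))" for u
  proof
    fix w
    let ?K = "{k \<in> {1..n}. (w k, u k) = (a, d)}"
    have "(\<Sum>k\<in>{k \<in> {1..n}. u k = d}. polytabloid ?E (u(k := b)) w)
        = (\<Sum>k \<in> ?K. polytabloid ?E (u(k := b)) w)"
    proof (rule sum.mono_neutral_right)
      show "\<forall>k\<in>{k \<in> {1..n}. u k = d} - ?K. polytabloid ?E (u(k := b)) w = 0"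
      proof
        fix k assume "k \<in> {k \<in> {1..n}. u k = d} - ?K"
        then have "k \<in> {1..n}" "w k \<noteq> a" by auto
        then show "polytabloid ?E (u(k := b)) w = 0"
          using ab(2) by (intro polytabloid_eq_0[of k]) (auto simp: card)
      qed
    qed auto
    also have "\<dots> = (\<Sum>k \<in> ?K. orientation ?E ((\<lambda>l. (w l, u l))(k := (a, b))))"
    proof (rule sum.cong[OF refl])
      fix k assume "k \<in> ?K"
      then have "w k = a" by simp
      then show "polytabloid ?E (u(k := b)) w = orientation ?E ((\<lambda>l. (w l, u l))(k := (a, b)))"
        unfolding polytabloid_def upd by (simp only:)
    qed
    finally have "polytabloid ?C u w = z' * (\<Sum>k\<in>{k \<in> {1..n}. u k = d}. polytabloid ?E (u(k := b)) w)"
      using z'(2)[of "\<lambda>l. (w l, u l)"] by (simp only: polytabloid_def[of ?C])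
    then show "polytabloid ?C u w = (\<Sum>k\<in>{k \<in> {1..n}. u k = d}. cscale z' (polytabloid ?E (u(k := b)))) w"
      by (simp only: sum_apply cscale_def sum_distrib_left)
  qed
  \<comment> \<open>If the letter \<open>k0\<close> occupies \<open>(a, d)\<close> and \<open>k1\<close> occupies \<open>(c, d)\<close>, then the terms of \<open>k0\<close> and \<open>k1\<close>
    differ by a transposition and cancel, and all other terms vanish.\<close>
  have ker: "\<Phi> (polytabloid ?C u) = 0" for u
  proof
    fix w
    let ?K = "{k \<in> {1..n}. w k = c}" and ?t = "\<lambda>k. polytabloid ?C u (w(k := a))"
    have "(\<Sum>k\<in>?K. ?t k) = 0"
    proof (cases "\<forall>k\<in>?K. ?t k = 0")
      case True
      then show ?thesis by (simp add: sum.neutral)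
    next
      case False
      then obtain k0 where k0: "k0 \<in> {1..n}" "w k0 = c" "?t k0 \<noteq> 0" by blast
      let ?p = "\<lambda>k. ((w(k0 := a)) k, u k)"
      have bij: "bij_betw ?p {1..n} ?C"
        using polytabloid_nonzero_imp_bij[OF k0(3)] card by simp
      have inj: "k = l" if "k \<in> {1..n}" "l \<in> {1..n}" "?p k = ?p l" for k l
        by (rule inj_onD[OF bij_betw_imp_inj_on[OF bij] that(3,1,2)])
      have u_d: "u k = d" if "k \<in> {1..n}" "?t k \<noteq> 0" for k
        using polytabloid_eq_0[of k ?C "w(k := a)" u] that ab(1) by (auto simp: card)
      have "(c, d) \<in> ?p ` {1..n}"
        unfolding bij_betw_imp_surj_on[OF bij] using H(2) by (rule insertI2)
      then obtain k1 where k1: "(c, d) = ?p k1" "k1 \<in> {1..n}" by (rule imageE)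
      then have k01: "k1 \<noteq> k0" "w k1 = c" "u k1 = d" using notin(4) by (auto split: if_splits)
      have zero: "?t k = 0" if k: "k \<in> ?K - {k0, k1}" for k
      proof (rule ccontr)
        assume "?t k \<noteq> 0"
        then have "u k = d" using u_d k by auto
        then have "?p k = ?p k1" using k k01 by auto
        then show False using inj[of k k1] k k1(2) by auto
      qed
      have neg: "?t k1 = - ?t k0"
      proof -
        let ?\<tau> = "transpose k0 k1"
        have \<tau>: "?\<tau> permutes {1..card ?C}" using k0(1) k1(2) card by (intro permutes_swap_id) simp_all
        have "(\<lambda>k. u (?\<tau> k)) = u" "(\<lambda>k. (w(k0 := a)) (?\<tau> k)) = w(k1 := a)"
          using u_d[OF k0(1,3)] k0(2) k01 by (auto simp: fun_eq_iff transpose_def)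
        moreover have "sign ?\<tau> = -1" using k01(1) by (simp add: sign_swap_id)
        ultimately show ?thesis using polytabloid_permute[OF \<tau>, of u "w(k0 := a)"] by simp
      qed
      have "(\<Sum>k\<in>?K. ?t k) = (\<Sum>k\<in>{k0, k1}. ?t k)"
        using k0 k1 k01 zero by (intro sum.mono_neutral_right) auto
      also have "\<dots> = ?t k0 + ?t k1" using k01 by simp
      also have "\<dots> = 0" unfolding neg by (rule add.right_inverse)
      finally show ?thesis .
    qed
    then show "\<Phi> (polytabloid ?C u) w = 0 w" by (simp add: \<Phi>_def)
  qed
  obtain A where A: "finite A" "word_module ?E \<subseteq> cfun.span A"
    using word_module_subset_finite_span[of ?E] H(1) by auto
  have "word_module ?R \<subseteq> \<Phi> ` word_module ?E"
    unfolding word_module_def[of ?R]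
  proof (rule cfun.span_minimal)
    show sub: "cfun.subspace (\<Phi> ` word_module ?E)"
      by (rule cfun_pair.linear_subspace_image[OF \<Phi> subspace_word_module])
    have "polytabloid ?R u = cscale z (\<Phi> (polytabloid ?E u))" for u
      using z(1) by (simp add: R cscale_def)
    then show "range (polytabloid ?R) \<subseteq> \<Phi> ` word_module ?E"
      by (auto intro!: cfun.subspace_scale[OF sub] imageI polytabloid_in_word_module)
  qed
  moreover have "\<Phi> ` word_module ?E \<subseteq> cfun.span (\<Phi> ` A)"
    using A(2) cfun_pair.linear_spans_image[OF \<Phi>] by blast
  ultimately have 1: "specht_dim ?R \<le> cfun.dim (\<Phi> ` word_module ?E)"
    unfolding specht_dim_def using A(1) by (intro cfun_dim_mono[of _ _ "\<Phi> ` A"]) auto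
  have sub: "cfun.subspace {x \<in> word_module ?E. \<Phi> x = 0}"
    using \<Phi> cfun_pair.linear_0[OF \<Phi>] subspace_word_module[of ?E]
    unfolding clinear_iff cfun.subspace_def by auto
  have "polytabloid ?C u \<in> {x \<in> word_module ?E. \<Phi> x = 0}" for u
  proof -
    have "polytabloid ?C u \<in> word_module ?E"
      unfolding C
      by (intro cfun.subspace_sum cfun.subspace_scale subspace_word_module polytabloid_in_word_module)
    then show ?thesis using ker by simp
  qed
  then have "word_module ?C \<subseteq> {x \<in> word_module ?E. \<Phi> x = 0}"
    unfolding word_module_def[of ?C] by (intro cfun.span_minimal[OF _ sub]) auto
  then have 2: "specht_dim ?C \<le> cfun.dim {x \<in> word_module ?E. \<Phi> x = 0}"
    unfolding specht_dim_def using A by (intro cfun_dim_mono[of _ _ A]) auto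
  show ?thesis
    using 1 2 cfun_pair.dim_kernel_plus_dim_image[OF \<Phi> subspace_word_module A(2,1)]
    unfolding specht_dim_def by linarith
qed

text \<open>The letter that occupies the isolated box can be chosen in \<open>|H| + 1\<close> ways, and the other letters fill
\<open>H\<close>: the Specht module is induced from that of \<open>H\<close>.\<close>

theorem specht_dim_isolated_box_le:
  fixes H :: "('r \<times> 'c) set"
  assumes H: "finite H" and ab: "a \<notin> Domain H" "b \<notin> Range H"
  shows "specht_dim (insert (a, b) H) \<le> Suc (card H) * specht_dim H"
proof -
  define n where "n = Suc (card H)"
  let ?E = "insert (a, b) H"
  have notin: "(a, b) \<notin> H" using ab by blast
  then have card: "card ?E = n" and rem: "?E - {(a, b)} = H" and fin: "finite ?E"
    using H by (auto simp: n_def)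
  \<comment> \<open>The letter \<open>k\<close> is put on the isolated box, and the letter \<open>n\<close> takes over its role in \<open>F\<close>.\<close>
  define \<Lambda> where "\<Lambda> k F = (\<lambda>w. if w k = a then F (\<lambda>l. w (transpose k n l)) else 0)"
    for k and F :: "(nat \<Rightarrow> 'r) \<Rightarrow> complex"
  have \<Lambda>: "clinear (\<Lambda> k)" for k
    by (auto simp: clinear_iff \<Lambda>_def cscale_def fun_eq_iff)
  obtain A where A: "finite A" "word_module H \<subseteq> cfun.span A"
    using word_module_subset_finite_span[OF H] by auto
  obtain B where B: "word_module H \<subseteq> cfun.span B" "card B = cfun.dim (word_module H)" and finB: "finite B"
    by (rule cfun_finite_basis[OF A(2,1)]) blast
  let ?S = "\<Union>k\<in>{1..n}. \<Lambda> k ` B"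
  obtain z where "z \<noteq> 0" and z: "\<And>u w. polytabloid ?E (u(n := b)) (w(n := a)) = z * polytabloid H u w"
    using polytabloid_fix_last[OF fin insertI1] unfolding card rem fst_conv snd_conv by blast
  have n: "n \<in> {1..n}" by (simp add: n_def)
  have "polytabloid ?E u \<in> cfun.span ?S" for u
  proof (cases "polytabloid ?E u = 0")
    case True
    then show ?thesis by (simp add: cfun.span_zero)
  next
    case False
    then obtain w0 where "polytabloid ?E u w0 \<noteq> 0" by (auto simp: fun_eq_iff)
    then have "bij_betw (\<lambda>k. (w0 k, u k)) {1..n} ?E"
      unfolding card[symmetric] by (rule polytabloid_nonzero_imp_bij)
    then have "(a, b) \<in> (\<lambda>k. (w0 k, u k)) ` {1..n}"
      by (simp only: bij_betw_imp_surj_on insertI1)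
    then obtain k where "(a, b) = (w0 k, u k)" and k1: "k \<in> {1..n}" by (rule imageE)
    then have k: "k \<in> {1..n}" "u k = b" by simp_all
    let ?\<tau> = "transpose k n"
    let ?s = "of_int (sign ?\<tau>) :: complex"
    have \<tau>: "?\<tau> permutes {1..card ?E}" using k n card by (intro permutes_swap_id) simp_all
    have s: "?s * ?s = 1" by (simp flip: of_int_mult)
    let ?u = "\<lambda>l. u (?\<tau> l)"
    have u: "?u = ?u(n := b)" using k(2) by (simp add: fun_eq_iff)
    have "polytabloid ?E u = \<Lambda> k (cscale (?s * z) (polytabloid H ?u))"
    proof
      fix w :: "nat \<Rightarrow> 'r"
      let ?w = "\<lambda>l. w (?\<tau> l)"
      show "polytabloid ?E u w = \<Lambda> k (cscale (?s * z) (polytabloid H ?u)) w"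
      proof (cases "w k = a")
        case True
        then have w: "?w = ?w(n := a)" by (simp add: fun_eq_iff)
        have "polytabloid ?E u w = ?s * polytabloid ?E ?u ?w"
          unfolding polytabloid_permute[OF \<tau>] using s by (simp add: mult.assoc[symmetric])
        also have "polytabloid ?E ?u ?w = polytabloid ?E (?u(n := b)) (?w(n := a))"
          by (simp only: u[symmetric] w[symmetric])
        also have "\<dots> = z * polytabloid H ?u ?w" by (rule z)
        finally show ?thesis using True by (simp add: \<Lambda>_def cscale_def)
      next
        case False
        then have "polytabloid ?E u w = 0"
          using k ab(2) by (intro polytabloid_eq_0[of k]) (auto simp: card)
        then show ?thesis using False by (simp add: \<Lambda>_def)
      qed
    qed
    also have "\<dots> \<in> \<Lambda> k ` cfun.span B"
      using B(1) polytabloid_in_word_module[of H] by (auto intro: cfun.span_scale)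
    also have "\<dots> = cfun.span (\<Lambda> k ` B)"
      by (rule cfun_pair.linear_span_image[OF \<Lambda>, symmetric])
    also have "\<dots> \<subseteq> cfun.span ?S" using k(1) by (intro cfun.span_mono) auto
    finally show ?thesis .
  qed
  then have "word_module ?E \<subseteq> cfun.span ?S"
    unfolding word_module_def[of ?E] by (intro cfun.span_minimal cfun.subspace_span) auto
  then have "specht_dim ?E \<le> card ?S"
    unfolding specht_dim_def using finB by (intro cfun.dim_le_card) auto
  also have "\<dots> \<le> (\<Sum>k\<in>{1..n}. card (\<Lambda> k ` B))" by (rule card_UN_le) simp
  also have "\<dots> \<le> (\<Sum>k\<in>{1..n}. card B)" using finB by (intro sum_mono card_image_le)
  finally show ?thesis using B(2) by (simp add: n_def specht_dim_def)
qed

lemma specht_dim_rename: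
  fixes f :: "'r \<Rightarrow> 'r" and h :: "'c \<Rightarrow> 'c"
  assumes D: "finite D" and f: "bij f" and h: "bij h"
  shows "specht_dim (map_prod f h ` D) = specht_dim D"
proof -
  let ?f = "map_prod f h" and ?g = "Hilbert_Choice.inv f" and ?i = "Hilbert_Choice.inv h"
  have "inj ?f" using f h by (simp add: bij_is_inj prod.inj_map)
  then obtain z where z: "z \<noteq> 0" "\<And>p. orientation (?f ` D) (\<lambda>k. ?f (p k)) = z * orientation D p"
    using orientation_image[OF D, of ?f] by blast
  define \<rho> where "\<rho> F = (\<lambda>w. F (\<lambda>k. ?g (w k)))" for F :: "(nat \<Rightarrow> 'r) \<Rightarrow> complex"
  have \<rho>: "clinear \<rho>" by (simp add: clinear_iff \<rho>_def cscale_def plus_fun_def)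
  have fg: "f (?g x) = x" "?g (f x) = x" "h (?i y) = y" for x y
    using f h by (simp_all add: bij_is_surj surj_f_inv_f bij_is_inj)
  have *: "cscale z (\<rho> (polytabloid D u)) = polytabloid (?f ` D) (\<lambda>k. h (u k))" for u
    using z(2)[of "\<lambda>k. (?g (w k), u k)" for w]
    by (simp add: \<rho>_def polytabloid_def cscale_def fg)
  have "\<rho> ` word_module D = word_module (?f ` D)"
  proof
    have "\<rho> (polytabloid D u) = cscale (1 / z) (polytabloid (?f ` D) (\<lambda>k. h (u k)))" for u
      using z(1) by (simp add: *[symmetric] cscale_def)
    then have "\<rho> (polytabloid D u) \<in> word_module (?f ` D)" for u
      by (simp add: cfun.subspace_scale subspace_word_module polytabloid_in_word_module)
    then show "\<rho> ` word_module D \<subseteq> word_module (?f ` D)"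
      unfolding word_module_def[of D] cfun_pair.linear_span_image[OF \<rho>, symmetric]
      by (intro cfun.span_minimal subspace_word_module) auto
    have sub: "cfun.subspace (\<rho> ` word_module D)"
      by (rule cfun_pair.linear_subspace_image[OF \<rho> subspace_word_module])
    have eq: "polytabloid (?f ` D) u = cscale z (\<rho> (polytabloid D (\<lambda>k. ?i (u k))))" for u
      by (simp add: * fg)
    have "polytabloid (?f ` D) u \<in> \<rho> ` word_module D" for u
      unfolding eq by (intro cfun.subspace_scale[OF sub] imageI polytabloid_in_word_module)
    then show "word_module (?f ` D) \<subseteq> \<rho> ` word_module D"
      unfolding word_module_def[of "?f ` D"] by (intro cfun.span_minimal sub) auto
  qed
  moreover have "cfun.dim (\<rho> ` word_module D) = cfun.dim (word_module D)"
  proof -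
    obtain A where A: "finite A" "word_module D \<subseteq> cfun.span A"
      using word_module_subset_finite_span[OF D] by auto
    have "F = 0" if "\<rho> F = 0" for F
    proof
      fix w show "F w = 0 w"
        using fun_cong[OF that, of "\<lambda>k. f (w k)"] by (simp add: \<rho>_def fg)
    qed
    then show ?thesis by (intro cfun_dim_inj_image[OF \<rho> subspace_word_module A(2,1)])
  qed
  ultimately show ?thesis by (simp add: specht_dim_def)
qed

section \<open>Forests and saturating matchings\<close>

definition partial_transversal :: "('r \<times> 'c) set \<Rightarrow> bool" where
  "partial_transversal M \<longleftrightarrow> inj_on fst M \<and> inj_on snd M"

text \<open>The almost perfect matchings, in terms of boxes. The last condition, for an edge both of whose ends are
leaves, says that isolated edges are matched.\<close>

definition saturating :: "('r \<times> 'c) set \<Rightarrow> ('r \<times> 'c) set \<Rightarrow> bool" where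
  "saturating D M \<longleftrightarrow> M \<subseteq> D \<and> partial_transversal M \<and>
     (\<forall>i j. (i, j) \<in> D \<longrightarrow>
        (i \<in> Domain M \<or> (\<forall>j'. (i, j') \<in> D \<longrightarrow> j' = j)) \<and>
        (j \<in> Range M \<or> (\<forall>i'. (i', j) \<in> D \<longrightarrow> i' = i)) \<and>
        (i \<in> Domain M \<or> j \<in> Range M))"

lemma partial_transversalD:
  assumes "partial_transversal M" "(i, j) \<in> M" "(i', j') \<in> M"
  shows "i = i' \<Longrightarrow> j = j'" "j = j' \<Longrightarrow> i = i'"
proof -
  have "inj_on fst M" "inj_on snd M" using assms(1) unfolding partial_transversal_def by simp_all
  from inj_onD[OF this(1) _ assms(2,3)] inj_onD[OF this(2) _ assms(2,3)]
  show "i = i' \<Longrightarrow> j = j'" "j = j' \<Longrightarrow> i = i'" by simp_all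
qed

lemma partial_transversalI:
  assumes "\<And>i j j'. (i, j) \<in> M \<Longrightarrow> (i, j') \<in> M \<Longrightarrow> j = j'"
    and "\<And>i i' j. (i, j) \<in> M \<Longrightarrow> (i', j) \<in> M \<Longrightarrow> i = i'"
  shows "partial_transversal M"
proof -
  have "inj_on fst M" by (rule inj_onI, clarsimp, erule (1) assms(1))
  moreover have "inj_on snd M" by (rule inj_onI, clarsimp, erule (1) assms(2))
  ultimately show ?thesis by (simp add: partial_transversal_def)
qed

lemma partial_transversal_subset:
  "partial_transversal M \<Longrightarrow> M' \<subseteq> M \<Longrightarrow> partial_transversal M'"
  unfolding partial_transversal_def by (blast intro: inj_on_subset)

lemma partial_transversal_insert:
  assumes "partial_transversal M" "a \<notin> Domain M" "b \<notin> Range M"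
  shows "partial_transversal (insert (a, b) M)"
proof (rule partial_transversalI)
  show "j = j'" if "(i, j) \<in> insert (a, b) M" "(i, j') \<in> insert (a, b) M" for i j j'
    using that assms(2) partial_transversalD(1)[OF assms(1), of i j i j'] by auto
  show "i = i'" if "(i, j) \<in> insert (a, b) M" "(i', j) \<in> insert (a, b) M" for i i' j
    using that assms(3) partial_transversalD(2)[OF assms(1), of i j i' j] by auto
qed

lemma partial_transversal_converse: "partial_transversal (M\<inverse>) \<longleftrightarrow> partial_transversal M"
proof -
  have "partial_transversal (M\<inverse>)" if "partial_transversal M" for M :: "('x \<times> 'y) set"
  proof (rule partial_transversalI)
    show "j = j'" if "(i, j) \<in> M\<inverse>" "(i, j') \<in> M\<inverse>" for i j j'
      using that partial_transversalD(2)[OF \<open>partial_transversal M\<close>, of j i j' i] by simp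
    show "i = i'" if "(i, j) \<in> M\<inverse>" "(i', j) \<in> M\<inverse>" for i i' j
      using that partial_transversalD(1)[OF \<open>partial_transversal M\<close>, of j i j i'] by simp
  qed
  from this[of M] this[of "M\<inverse>"] show ?thesis by auto
qed

definition leaf_box :: "('r \<times> 'c) set \<Rightarrow> 'r \<Rightarrow> 'c \<Rightarrow> bool" where
  "leaf_box D i j \<longleftrightarrow> (i, j) \<in> D \<and> ((\<forall>j'. (i, j') \<in> D \<longrightarrow> j' = j) \<or> (\<forall>i'. (i', j) \<in> D \<longrightarrow> i' = i))"

text \<open>A finite graph has no cycle if and only if each of its nonempty subgraphs has an edge ending in a leaf.
This form passes to subgraphs and to the exchange of the colours at once.\<close>

definition forest_relation :: "('r \<times> 'c) set \<Rightarrow> bool" where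
  "forest_relation D \<longleftrightarrow> (\<forall>D'\<subseteq>D. D' \<noteq> {} \<longrightarrow> (\<exists>i j. leaf_box D' i j))"

lemma forest_relationI:
  "(\<And>D'. D' \<subseteq> D \<Longrightarrow> D' \<noteq> {} \<Longrightarrow> \<exists>i j. leaf_box D' i j) \<Longrightarrow> forest_relation D"
  by (simp add: forest_relation_def)

lemma forest_relation_leaf_box:
  assumes "forest_relation D" "D' \<subseteq> D" "D' \<noteq> {}"
  obtains i j where "leaf_box D' i j"
  using assms unfolding forest_relation_def by meson

lemma leaf_box_converse: "leaf_box (D\<inverse>) j i \<longleftrightarrow> leaf_box D i j"
  by (auto simp: leaf_box_def)

lemma forest_relation_subset: "forest_relation D \<Longrightarrow> E \<subseteq> D \<Longrightarrow> forest_relation E"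
  by (rule forest_relationI) (meson forest_relation_leaf_box subset_trans)

lemma forest_relation_converse: "forest_relation (D\<inverse>) \<longleftrightarrow> forest_relation D"
proof -
  have *: "forest_relation (D\<inverse>)" if D: "forest_relation D" for D :: "('x \<times> 'y) set"
  proof (rule forest_relationI)
    fix D' assume D': "D' \<subseteq> D\<inverse>" "D' \<noteq> {}"
    then have "D'\<inverse> \<subseteq> D" "D'\<inverse> \<noteq> {}" by auto
    then obtain i j where "leaf_box (D'\<inverse>) i j"
      using forest_relation_leaf_box[OF D] by metis
    then show "\<exists>i j. leaf_box D' i j" unfolding leaf_box_converse by blast
  qed
  from *[of D] *[of "D\<inverse>"] show ?thesis unfolding converse_converse by (rule iffI[rotated])
qed

lemma forest_relation_insert_column:
  assumes "forest_relation H" "b \<notin> Range H"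
  shows "forest_relation (insert (c, b) H)"
proof (rule forest_relationI)
  fix D' assume D': "D' \<subseteq> insert (c, b) H" "D' \<noteq> {}"
  show "\<exists>i j. leaf_box D' i j"
  proof (cases "(c, b) \<in> D'")
    case True
    have "\<forall>i'. (i', b) \<in> D' \<longrightarrow> i' = c" using D'(1) assms(2) by blast
    with True show ?thesis unfolding leaf_box_def by blast
  next
    case False
    then have "D' \<subseteq> H" using D'(1) by blast
    with D'(2) assms(1) show ?thesis using forest_relation_leaf_box by metis
  qed
qed

lemma forest_relation_insert_row:
  assumes "forest_relation H" "a \<notin> Domain H"
  shows "forest_relation (insert (a, d) H)"
proof -
  have "(insert (a, d) H)\<inverse> = insert (d, a) (H\<inverse>)" by auto
  moreover have "forest_relation (insert (d, a) (H\<inverse>))"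
    by (rule forest_relation_insert_column) (simp_all add: forest_relation_converse assms)
  ultimately have "forest_relation ((insert (a, d) H)\<inverse>)" by (simp only:)
  then show ?thesis by (simp only: forest_relation_converse)
qed

lemma saturating_converse: "saturating (D\<inverse>) (M\<inverse>) \<longleftrightarrow> saturating D M"
proof -
  have "saturating (D\<inverse>) (M\<inverse>)" if "saturating D M" for D M :: "('x \<times> 'y) set"
    using that
    unfolding saturating_def Domain_converse Range_converse converse_iff converse_mono
      partial_transversal_converse by blast
  from this[of D M] this[of "D\<inverse>" "M\<inverse>"] show ?thesis by auto
qed

text \<open>Among the edges joining matched vertices there is a leaf edge. The matching edge at this leaf can be put
first if the leaf is a row, and last if it is a column.\<close>

lemma ex_triangular_order:
  assumes "finite M" "forest_relation D" "M \<subseteq> D" "partial_transversal M"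
  shows "\<exists>es. distinct es \<and> set es = M \<and> sorted_wrt (\<lambda>e f. (fst e, snd f) \<notin> D) es"
  using assms(1,3,4)
proof (induction "card M" arbitrary: M)
  case 0
  then show ?case by (intro exI[of _ "[]"]) auto
next
  case (Suc m)
  note inj = partial_transversalD[OF Suc.prems(3)]
  define D' where "D' = {(i, j) \<in> D. i \<in> Domain M \<and> j \<in> Range M}"
  have "M \<subseteq> D'" "D' \<subseteq> D" using Suc.prems(2) by (auto simp: D'_def)
  moreover have "M \<noteq> {}" using Suc.hyps(2) by auto
  ultimately have "D' \<noteq> {}" by blast
  then obtain i j where "leaf_box D' i j"
    using forest_relation_leaf_box[OF assms(2) \<open>D' \<subseteq> D\<close>] by metis
  then have ij: "(i, j) \<in> D'"
    and alt: "(\<forall>j'. (i, j') \<in> D' \<longrightarrow> j' = j) \<or> (\<forall>i'. (i', j) \<in> D' \<longrightarrow> i' = i)"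
    unfolding leaf_box_def by simp_all
  have IH: "\<exists>es. distinct es \<and> set es = M - {e} \<and> sorted_wrt (\<lambda>e f. (fst e, snd f) \<notin> D) es"
    if "e \<in> M" for e
  proof (rule Suc.hyps(1))
    show "m = card (M - {e})" using Suc.hyps(2) Suc.prems(1) that by simp
    show "partial_transversal (M - {e})"
      by (rule partial_transversal_subset[OF Suc.prems(3)]) blast
    show "finite (M - {e})" using Suc.prems(1) by simp
    show "M - {e} \<subseteq> D" using Suc.prems(2) by blast
  qed
  obtain i1 j1 where "(i, j1) \<in> M" "(i1, j) \<in> M" using ij unfolding D'_def by blast
  then have ijM: "(i, j) \<in> M" using alt \<open>M \<subseteq> D'\<close> by blast
  from IH[OF this] obtain es where es: "distinct es" "set es = M - {(i, j)}"
    "sorted_wrt (\<lambda>e f. (fst e, snd f) \<notin> D) es"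
    by (elim exE conjE)
  from alt show ?case
  proof
    assume row: "\<forall>j'. (i, j') \<in> D' \<longrightarrow> j' = j"
    have no: "(i, j') \<notin> D" if f: "(i', j') \<in> M" "(i', j') \<noteq> (i, j)" for i' j'
    proof
      assume "(i, j') \<in> D"
      then have "(i, j') \<in> D'" using ijM f(1) unfolding D'_def by blast
      then have "j' = j" using row by (elim allE impE)
      moreover from this have "i' = i" by (rule inj(2)[OF f(1) ijM])
      ultimately show False using f(2) by simp
    qed
    have "\<forall>f\<in>set es. (i, snd f) \<notin> D"
    proof
      fix f assume "f \<in> set es"
      then show "(i, snd f) \<notin> D" using no[of "fst f" "snd f"] es(2) by simp
    qed
    then show ?thesis
      using es ijM by (intro exI[of _ "(i, j) # es"]) auto
  next
    assume col: "\<forall>i'. (i', j) \<in> D' \<longrightarrow> i' = i"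
    have no: "(i', j) \<notin> D" if f: "(i', j') \<in> M" "(i', j') \<noteq> (i, j)" for i' j'
    proof
      assume "(i', j) \<in> D"
      then have "(i', j) \<in> D'" using ijM f(1) unfolding D'_def by blast
      then have "i' = i" using col by (elim allE impE)
      moreover from this have "j' = j" by (rule inj(1)[OF f(1) ijM])
      ultimately show False using f(2) by simp
    qed
    have "\<forall>f\<in>set es. (fst f, j) \<notin> D"
    proof
      fix f assume "f \<in> set es"
      then show "(fst f, j) \<notin> D" using no[of "fst f" "snd f"] es(2) by simp
    qed
    then show ?thesis
      using es ijM by (intro exI[of _ "es @ [(i, j)]"]) (auto simp: sorted_wrt_append)
  qed
qed

definition isolated_box :: "('r \<times> 'c) set \<Rightarrow> bool" where
  "isolated_box D \<longleftrightarrow> (\<exists>a b. (a, b) \<in> D \<and> (\<forall>j. (a, j) \<in> D \<longrightarrow> j = b) \<and> (\<forall>i. (i, b) \<in> D \<longrightarrow> i = a))"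

text \<open>What is found at an end of a longest path whose last vertex but one has several leaves, if that vertex
is a row; if it is a column, the transposed relation has the property.\<close>

definition twin_leaves :: "('r \<times> 'c) set \<Rightarrow> bool" where
  "twin_leaves D \<longleftrightarrow> (\<exists>c b d. (c, b) \<in> D \<and> (c, d) \<in> D \<and> b \<noteq> d \<and>
     (\<forall>i. (i, b) \<in> D \<longrightarrow> i = c) \<and> (\<forall>i. (i, d) \<in> D \<longrightarrow> i = c))"

text \<open>What is found at an end \<open>a, d, c\<close> of a longest path with at least three edges, if \<open>d\<close> has a single leaf
and is a column.\<close>

definition pendant_path :: "('r \<times> 'c) set \<Rightarrow> bool" where
  "pendant_path D \<longleftrightarrow> (\<exists>a c d. (a, d) \<in> D \<and> (c, d) \<in> D \<and> a \<noteq> c \<and>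
     (\<forall>j. (a, j) \<in> D \<longrightarrow> j = d) \<and> (\<forall>i. (i, d) \<in> D \<longrightarrow> i = a \<or> i = c) \<and>
     (\<exists>j. (c, j) \<in> D \<and> j \<noteq> d))"

lemma isolated_box_converse: "isolated_box (D\<inverse>) \<longleftrightarrow> isolated_box D"
  unfolding isolated_box_def converse_iff by blast

lemma star_forest_cases:
  assumes cd: "(c, d) \<in> D" "\<forall>i. (i, d) \<in> D \<longrightarrow> i = c"
    and leaf: "\<And>i j. (i, j) \<in> D \<Longrightarrow> leaf_box D i j"
  shows "isolated_box D \<or> twin_leaves D"
proof (cases "\<forall>j. (c, j) \<in> D \<longrightarrow> j = d")
  case True
  have "isolated_box D"
    unfolding isolated_box_def by (rule exI[of _ c], rule exI[of _ d], intro conjI cd True)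
  then show ?thesis ..
next
  case False
  then obtain b where b: "(c, b) \<in> D" "b \<noteq> d" by blast
  have "\<not> (\<forall>j'. (c, j') \<in> D \<longrightarrow> j' = b)" using cd(1) b(2) by metis
  then have col: "\<forall>i. (i, b) \<in> D \<longrightarrow> i = c" using leaf[OF b(1)] unfolding leaf_box_def by meson
  have "twin_leaves D"
    unfolding twin_leaves_def
    by (rule exI[of _ c], rule exI[of _ b], rule exI[of _ d], intro conjI b cd col)
  then show ?thesis ..
qed

lemma pendant_star_cases:
  assumes xy: "(x, y) \<in> D" "\<exists>j. (x, j) \<in> D \<and> j \<noteq> y" "\<exists>i. (i, y) \<in> D \<and> i \<noteq> x"
    and leaves: "\<And>i. (i, y) \<in> D \<Longrightarrow> i \<noteq> x \<Longrightarrow> \<forall>j. (i, j) \<in> D \<longrightarrow> j = y"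
  shows "twin_leaves (D\<inverse>) \<or> pendant_path D"
proof -
  obtain a where a: "(a, y) \<in> D" "a \<noteq> x" using xy(3) by blast
  show ?thesis
  proof (cases "\<forall>i. (i, y) \<in> D \<longrightarrow> i = a \<or> i = x")
    case True
    have "pendant_path D"
      unfolding pendant_path_def
      by (rule exI[of _ a], rule exI[of _ x], rule exI[of _ y], intro conjI a xy True leaves[OF a])
    then show ?thesis ..
  next
    case False
    then obtain a' where a': "(a', y) \<in> D" "a' \<noteq> a" "a' \<noteq> x" by blast
    have "twin_leaves (D\<inverse>)"
      unfolding twin_leaves_def converse_iff
      by (rule exI[of _ y], rule exI[of _ a], rule exI[of _ a'],
          intro conjI a(1) a'(1) a'(2)[symmetric] leaves[OF a] leaves[OF a'(1,3)])
    then show ?thesis ..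
  qed
qed

text \<open>If every edge is a leaf edge, then the components are stars. Otherwise remove all leaf edges; a leaf of
the remaining forest is adjacent, in the original one, only to leaves and to a single further vertex.\<close>

lemma forest_relation_cases:
  assumes forest: "forest_relation D" and ne: "D \<noteq> {}"
  shows "isolated_box D \<or> twin_leaves D \<or> twin_leaves (D\<inverse>) \<or> pendant_path D \<or> pendant_path (D\<inverse>)"
proof -
  define D' where "D' = {(i, j). (i, j) \<in> D \<and> \<not> leaf_box D i j}"
  have D': "(i, j) \<in> D' \<longleftrightarrow> (i, j) \<in> D \<and> \<not> leaf_box D i j" for i j by (simp add: D'_def)
  show ?thesis
  proof (cases "D' = {}")
    case True
    then have leaf: "leaf_box D i j" if "(i, j) \<in> D" for i j
      using that D'[of i j] by simp
    obtain c d where cd: "(c, d) \<in> D" using ne by (metis equals0I surj_pair)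
    have "leaf_box D c d" by (rule leaf[OF cd])
    then consider "\<forall>j. (c, j) \<in> D \<longrightarrow> j = d" | "\<forall>i. (i, d) \<in> D \<longrightarrow> i = c"
      unfolding leaf_box_def by meson
    then show ?thesis
    proof cases
      case 1
      have "isolated_box (D\<inverse>) \<or> twin_leaves (D\<inverse>)"
      proof (rule star_forest_cases[of d c])
        show "(d, c) \<in> D\<inverse>" using cd by simp
        show "\<forall>j. (j, c) \<in> D\<inverse> \<longrightarrow> j = d" unfolding converse_iff by (rule 1)
        show "leaf_box (D\<inverse>) j i" if "(j, i) \<in> D\<inverse>" for i j
          using leaf[of i j] that by (simp add: leaf_box_converse)
      qed
      then show ?thesis unfolding isolated_box_converse by argo
    next
      case 2
      have "isolated_box D \<or> twin_leaves D"
        by (rule star_forest_cases[OF cd 2]) (rule leaf)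
      then show ?thesis by argo
    qed
  next
    case False
    have "D' \<subseteq> D" by (auto simp: D'_def)
    then obtain x y where xy: "leaf_box D' x y"
      using forest_relation_leaf_box[OF forest _ False] by metis
    then have "(x, y) \<in> D'" unfolding leaf_box_def by simp
    then have xyD: "(x, y) \<in> D" "\<exists>j. (x, j) \<in> D \<and> j \<noteq> y" "\<exists>i. (i, y) \<in> D \<and> i \<noteq> x"
      unfolding D' leaf_box_def by simp_all
    from xy consider "\<forall>j'. (x, j') \<in> D' \<longrightarrow> j' = y" | "\<forall>i'. (i', y) \<in> D' \<longrightarrow> i' = x"
      unfolding leaf_box_def by meson
    then show ?thesis
    proof cases
      case 1
      have "\<forall>i. (i, j) \<in> D \<longrightarrow> i = x" if j: "(x, j) \<in> D" "j \<noteq> y" for j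
      proof -
        have "(x, j) \<notin> D'" using 1 j(2) by metis
        then have "leaf_box D x j" using D' j(1) by simp
        moreover have "\<not> (\<forall>j'. (x, j') \<in> D \<longrightarrow> j' = j)" using xyD(1) j(2) by metis
        ultimately show ?thesis unfolding leaf_box_def by meson
      qed
      then have "twin_leaves ((D\<inverse>)\<inverse>) \<or> pendant_path (D\<inverse>)"
        using pendant_star_cases[of y x "D\<inverse>"] xyD unfolding converse_iff by blast
      then show ?thesis unfolding converse_converse by argo
    next
      case 2
      have "\<forall>j. (i, j) \<in> D \<longrightarrow> j = y" if i: "(i, y) \<in> D" "i \<noteq> x" for i
      proof -
        have "(i, y) \<notin> D'" using 2 i(2) by metis
        then have "leaf_box D i y" using D' i(1) by simp
        moreover have "\<not> (\<forall>i'. (i', y) \<in> D \<longrightarrow> i' = i)" using xyD(1) i(2) by metis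
        ultimately show ?thesis unfolding leaf_box_def by meson
      qed
      then have "twin_leaves (D\<inverse>) \<or> pendant_path D"
        by (rule pendant_star_cases[OF xyD])
      then show ?thesis by argo
    qed
  qed
qed

section \<open>The deletion recursion for forests\<close>

text \<open>The properties of the dimension of the Specht module from which its recursion on forests follows. They
are symmetric under the exchange of rows and columns, so each statement about a leaf column also
yields the one about a leaf row, by passing to \<open>\<lambda>D. g (D\<inverse>)\<close>.\<close>

locale forest_dimension =
  fixes g :: "(nat \<times> nat) set \<Rightarrow> nat"
  assumes rename: "finite D \<Longrightarrow> bij f \<Longrightarrow> bij h \<Longrightarrow> g (map_prod f h ` D) = g D"
    and deletion_le: "finite D \<Longrightarrow> forest_relation D \<Longrightarrow> M \<subseteq> D \<Longrightarrow> partial_transversal M \<Longrightarrow>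
      (\<Sum>e\<in>M. g (D - {e})) \<le> g D"
    and attach_le: "finite H \<Longrightarrow> (c, d) \<in> H \<Longrightarrow> a \<notin> Domain H \<Longrightarrow> b \<notin> Range H \<Longrightarrow>
      g (insert (c, b) H) + g (insert (a, d) H) \<le> g (insert (a, b) H)"
    and isolated_le: "finite H \<Longrightarrow> a \<notin> Domain H \<Longrightarrow> b \<notin> Range H \<Longrightarrow>
      g (insert (a, b) H) \<le> Suc (card H) * g H"

lemma sum_over_converse:
  "(\<Sum>e\<in>M\<inverse>. g ((D\<inverse> - {e})\<inverse>)) = (\<Sum>e\<in>M. g (D - {e}))" for M :: "('r \<times> 'c) set"
proof -
  have im: "M\<inverse> = prod.swap ` M" by auto
  have inj: "inj_on prod.swap M" by (rule inj_onI) (auto simp: prod.swap_def)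
  have eq: "(D\<inverse> - {prod.swap e})\<inverse> = D - {e}" for e
    by (cases e) auto
  show ?thesis unfolding im by (simp only: sum.reindex[OF inj] o_def eq)
qed

lemma (in forest_dimension) forest_dimension_converse: "forest_dimension (\<lambda>D. g (D\<inverse>))"
proof
  fix D :: "(nat \<times> nat) set" and f h :: "nat \<Rightarrow> nat"
  assume D: "finite D" "bij f" "bij h"
  have "(map_prod f h ` D)\<inverse> = map_prod h f ` (D\<inverse>)" by force
  then show "g ((map_prod f h ` D)\<inverse>) = g (D\<inverse>)"
    using rename[of "D\<inverse>" h f] D by simp
next
  fix D M :: "(nat \<times> nat) set"
  assume *: "finite D" "forest_relation D" "M \<subseteq> D" "partial_transversal M"
  have "(\<Sum>e\<in>M. g ((D - {e})\<inverse>)) = (\<Sum>e\<in>M\<inverse>. g (D\<inverse> - {e}))"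
    using sum_over_converse[of g "D\<inverse>" "M\<inverse>"] by simp
  also have "\<dots> \<le> g (D\<inverse>)"
    by (rule deletion_le)
       (simp_all add: * forest_relation_converse partial_transversal_converse)
  finally show "(\<Sum>e\<in>M. g ((D - {e})\<inverse>)) \<le> g (D\<inverse>)" .
next
  fix H :: "(nat \<times> nat) set" and a b c d
  assume *: "finite H" "(c, d) \<in> H" "a \<notin> Domain H" "b \<notin> Range H"
  have ins: "(insert (x, y) H)\<inverse> = insert (y, x) (H\<inverse>)" for x y by auto
  have "g (insert (d, a) (H\<inverse>)) + g (insert (b, c) (H\<inverse>)) \<le> g (insert (b, a) (H\<inverse>))"
    by (rule attach_le) (simp_all add: *)
  then show "g ((insert (c, b) H)\<inverse>) + g ((insert (a, d) H)\<inverse>) \<le> g ((insert (a, b) H)\<inverse>)"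
    unfolding ins by simp
next
  fix H :: "(nat \<times> nat) set" and a b
  assume *: "finite H" "a \<notin> Domain H" "b \<notin> Range H"
  have ins: "(insert (a, b) H)\<inverse> = insert (b, a) (H\<inverse>)" by auto
  have "g (insert (b, a) (H\<inverse>)) \<le> Suc (card (H\<inverse>)) * g (H\<inverse>)"
    by (rule isolated_le) (simp_all add: *)
  then show "g ((insert (a, b) H)\<inverse>) \<le> Suc (card H) * g (H\<inverse>)" unfolding ins by simp
qed

definition isolated_rule :: "((nat \<times> nat) set \<Rightarrow> nat) \<Rightarrow> nat \<Rightarrow> bool" where
  "isolated_rule g m \<longleftrightarrow> (\<forall>H a b. finite H \<longrightarrow> card H = m \<longrightarrow> forest_relation H \<longrightarrow>
     a \<notin> Domain H \<longrightarrow> b \<notin> Range H \<longrightarrow> g (insert (a, b) H) = Suc m * g H)"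

text \<open>In terms of the matching polytope this is the decomposition of a prism over the polytope of \<open>H\<close> into the
polytopes of the two forests obtained by attaching a leaf to either end of a leaf edge.\<close>

definition attach_rule :: "((nat \<times> nat) set \<Rightarrow> nat) \<Rightarrow> nat \<Rightarrow> bool" where
  "attach_rule g m \<longleftrightarrow> (\<forall>H a b c d. finite H \<longrightarrow> card H = m \<longrightarrow> forest_relation H \<longrightarrow>
     leaf_box H c d \<longrightarrow> a \<notin> Domain H \<longrightarrow> b \<notin> Range H \<longrightarrow>
     g (insert (c, b) H) + g (insert (a, d) H) = Suc m * g H)"

definition deletion_rule :: "((nat \<times> nat) set \<Rightarrow> nat) \<Rightarrow> nat \<Rightarrow> bool" where
  "deletion_rule g m \<longleftrightarrow> (\<forall>D M. finite D \<longrightarrow> card D = m \<longrightarrow> D \<noteq> {} \<longrightarrow> forest_relation D \<longrightarrow>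
     saturating D M \<longrightarrow> g D = (\<Sum>e\<in>M. g (D - {e})))"

definition forest_rules :: "((nat \<times> nat) set \<Rightarrow> nat) \<Rightarrow> nat \<Rightarrow> bool" where
  "forest_rules g m \<longleftrightarrow> isolated_rule g m \<and> attach_rule g m \<and> deletion_rule g m"

lemma saturating_subset:
  assumes "saturating D M" "M \<subseteq> E" "E \<subseteq> D"
  shows "saturating E M"
  using assms unfolding saturating_def by (meson subsetD)

context forest_dimension
begin

text \<open>Deleting the isolated edge leaves \<open>H\<close>; deleting an edge \<open>e\<close> of \<open>M\<close> leaves \<open>H - {e}\<close> with an isolated edge,
which contributes \<open>|H| * g (H - {e})\<close> by induction. The sum is \<open>(|H| + 1) * g H\<close>, the upper bound.\<close>

lemma isolated_step:
  assumes H: "finite H" "forest_relation H" and ab: "a \<notin> Domain H" "b \<notin> Range H"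
    and M: "saturating H M" and rules: "\<And>m. m < card H \<Longrightarrow> forest_rules g m"
    and rec: "H \<noteq> {} \<Longrightarrow> g H = (\<Sum>e\<in>M. g (H - {e}))"
  shows "g (insert (a, b) H) = Suc (card H) * g H"
    and "g (insert (a, b) H) = (\<Sum>e\<in>insert (a, b) M. g (insert (a, b) H - {e}))"
proof -
  let ?E = "insert (a, b) H"
  have ab_H: "(a, b) \<notin> H" using ab by blast
  have M': "M \<subseteq> H" "partial_transversal M" using M by (simp_all add: saturating_def)
  then have fin: "finite M" and ab_M: "(a, b) \<notin> M" using H(1) ab_H by (auto intro: finite_subset)
  have "g (?E - {e}) = card H * g (H - {e})" if e: "e \<in> M" for e
  proof -
    have eH: "e \<in> H" "e \<noteq> (a, b)" using e M'(1) ab_H by auto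
    then have card: "Suc (card (H - {e})) = card H" by (intro card_Suc_Diff1 H(1))
    have "isolated_rule g (card (H - {e}))" using rules card by (simp add: forest_rules_def)
    moreover have "?E - {e} = insert (a, b) (H - {e})" using eH by auto
    moreover have "forest_relation (H - {e})" by (rule forest_relation_subset[OF H(2)]) auto
    moreover have "a \<notin> Domain (H - {e})" "b \<notin> Range (H - {e})" using ab by auto
    ultimately show ?thesis using H(1) card unfolding isolated_rule_def by (simp del: card_Diff_singleton)
  qed
  then have "(\<Sum>e\<in>M. g (?E - {e})) = card H * (\<Sum>e\<in>M. g (H - {e}))"
    by (simp add: sum_distrib_left)
  also have "\<dots> = card H * g H" using rec by (cases "H = {}") simp_all
  finally have sum: "(\<Sum>e\<in>insert (a, b) M. g (?E - {e})) = Suc (card H) * g H"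
    using fin ab_M ab_H by simp
  have "(\<Sum>e\<in>insert (a, b) M. g (?E - {e})) \<le> g ?E"
  proof (rule deletion_le)
    show "forest_relation ?E" by (rule forest_relation_insert_column[OF H(2) ab(2)])
    have "a \<notin> Domain M" "b \<notin> Range M" using ab M'(1) by blast+
    then show "partial_transversal (insert (a, b) M)" by (rule partial_transversal_insert[OF M'(2)])
    show "insert (a, b) M \<subseteq> ?E" using M'(1) by blast
  qed (use H in simp)
  with sum isolated_le[OF H(1) ab]
  show "g ?E = Suc (card H) * g H" "g ?E = (\<Sum>e\<in>insert (a, b) M. g (?E - {e}))" by simp_all
qed

text \<open>For an edge \<open>e \<noteq> (c, d)\<close> of \<open>M\<close>, the two deletions of \<open>e\<close> contribute \<open>|H| * g (H - {e})\<close> together, by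
induction. What remains contributes \<open>|H| * g (H - {(c, d)}) + g H\<close> if \<open>(c, d) \<in> M\<close>: one deletion has
an isolated edge and the other renames a leaf of \<open>H\<close>. It contributes \<open>g H\<close> if \<open>(c, d) \<notin> M\<close>, from
deleting \<open>(a, d)\<close>. In both cases the total is \<open>(|H| + 1) * g H\<close>, which is also an upper bound.\<close>

lemma attach_step:
  assumes H: "finite H" "forest_relation H" and cd: "(c, d) \<in> H" "\<forall>i. (i, d) \<in> H \<longrightarrow> i = c"
    and ab: "a \<notin> Domain H" "b \<notin> Range H"
    and M: "saturating H M" and rules: "\<And>m. m < card H \<Longrightarrow> forest_rules g m"
    and rec: "g H = (\<Sum>e\<in>M. g (H - {e}))"
    and M': "M' = (if (c, d) \<in> M then M else insert (a, d) M)"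
  shows "g (insert (c, b) H) = (\<Sum>e\<in>M. g (insert (c, b) H - {e}))"
    and "g (insert (a, d) H) = (\<Sum>e\<in>M'. g (insert (a, d) H - {e}))"
    and "g (insert (c, b) H) + g (insert (a, d) H) = Suc (card H) * g H"
proof -
  let ?R = "insert (c, b) H" and ?C = "insert (a, d) H"
  have MH: "M \<subseteq> H" "partial_transversal M" using M by (simp_all add: saturating_def)
  have fin: "finite M" using H(1) MH(1) by (rule finite_subset[rotated])
  have new: "(c, b) \<notin> H" "(a, d) \<notin> H" using ab by blast+
  have card: "Suc (card (H - {e})) = card H" if "e \<in> H" for e
    by (rule card_Suc_Diff1[OF H(1) that])
  have forest: "forest_relation (H - {e})" for e by (rule forest_relation_subset[OF H(2)]) auto
  have fresh: "a \<notin> Domain (H - {e})" "b \<notin> Range (H - {e})" for e using ab by auto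
  have other: "g (?R - {e}) + g (?C - {e}) = card H * g (H - {e})" if e: "e \<in> M" "e \<noteq> (c, d)" for e
  proof -
    have eH: "e \<in> H" using e(1) MH(1) by blast
    have "attach_rule g (card (H - {e}))" using rules card[OF eH] by (simp add: forest_rules_def)
    moreover have "?R - {e} = insert (c, b) (H - {e})" "?C - {e} = insert (a, d) (H - {e})"
      using eH new by auto
    moreover have "leaf_box (H - {e}) c d"
    proof -
      have "(c, d) \<in> H - {e}" using cd(1) e(2) by simp
      moreover have "\<forall>i. (i, d) \<in> H - {e} \<longrightarrow> i = c" using cd(2) by simp
      ultimately show ?thesis unfolding leaf_box_def by (intro conjI disjI2)
    qed
    ultimately show ?thesis
      using H(1) card[OF eH] forest[of e] fresh[of e] unfolding attach_rule_def by simp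
  qed
  have total: "(\<Sum>e\<in>M. g (?R - {e})) + (\<Sum>e\<in>M'. g (?C - {e})) = Suc (card H) * g H"
  proof (cases "(c, d) \<in> M")
    case True
    \<comment> \<open>Without the leaf \<open>d\<close>, the new leaf \<open>b\<close> at \<open>c\<close> takes its place.\<close>
    have "g (?R - {(c, d)}) = g H"
    proof -
      have b: "b \<noteq> d" using ab(2) cd(1) by blast
      have "map_prod id (transpose b d) x = (if x = (c, d) then (c, b) else x)" if "x \<in> H" for x
      proof -
        obtain i j where x: "x = (i, j)" by (cases x)
        have "j \<noteq> b" using that ab(2) unfolding x by (blast intro: RangeI)
        moreover have "i = c" if "j = d" using cd(2) \<open>x \<in> H\<close> that unfolding x by simp
        ultimately show ?thesis by (auto simp: x transpose_def)
      qed
      then have "map_prod id (transpose b d) ` H = (\<lambda>x. if x = (c, d) then (c, b) else x) ` H"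
        by (rule image_cong[OF refl])
      also have "\<dots> = ?R - {(c, d)}" using cd(1) b by auto
      finally show ?thesis using rename[OF H(1) bij_id bij_transpose, of b d] by simp
    qed
    moreover have "g (?C - {(c, d)}) = card H * g (H - {(c, d)})"
    proof -
      have "isolated_rule g (card (H - {(c, d)}))"
        using rules card[OF cd(1)] by (simp add: forest_rules_def)
      moreover have "?C - {(c, d)} = insert (a, d) (H - {(c, d)})" using cd(1) new by auto
      moreover have "d \<notin> Range (H - {(c, d)})" using cd(2) by blast
      ultimately show ?thesis
        using H(1) card[OF cd(1)] forest[of "(c, d)"] fresh(1)[of "(c, d)"]
        unfolding isolated_rule_def by simp
    qed
    moreover have "(\<Sum>e\<in>M - {(c, d)}. g (?R - {e})) + (\<Sum>e\<in>M - {(c, d)}. g (?C - {e}))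
        = card H * (\<Sum>e\<in>M - {(c, d)}. g (H - {e}))"
      unfolding sum.distrib[symmetric] sum_distrib_left by (rule sum.cong) (use other in auto)
    moreover have split: "(\<Sum>e\<in>M. f e) = f (c, d) + (\<Sum>e\<in>M - {(c, d)}. f e)" for f :: "_ \<Rightarrow> nat"
      by (rule sum.remove[OF fin True])
    moreover have "g H = g (H - {(c, d)}) + (\<Sum>e\<in>M - {(c, d)}. g (H - {e}))"
      unfolding rec[symmetric] split[symmetric] using rec split[of "\<lambda>e. g (H - {e})"] by simp
    ultimately show ?thesis
      unfolding M' if_P[OF True] split[of "\<lambda>e. g (?R - {e})"] split[of "\<lambda>e. g (?C - {e})"]
      by (simp add: algebra_simps)
  next
    case False
    have "?C - {(a, d)} = H" using new(2) by simp
    moreover have "(a, d) \<notin> M" using MH(1) new(2) by blast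
    ultimately have "(\<Sum>e\<in>M'. g (?C - {e})) = g H + (\<Sum>e\<in>M. g (?C - {e}))"
      using False fin by (simp add: M')
    moreover have "(\<Sum>e\<in>M. g (?R - {e})) + (\<Sum>e\<in>M. g (?C - {e})) = card H * (\<Sum>e\<in>M. g (H - {e}))"
      unfolding sum.distrib[symmetric] sum_distrib_left
      by (rule sum.cong) (use other False in auto)
    ultimately show ?thesis using rec by simp
  qed
  have R: "(\<Sum>e\<in>M. g (?R - {e})) \<le> g ?R"
    by (rule deletion_le)
       (use H MH forest_relation_insert_column[OF H(2) ab(2)] in auto)
  have C: "(\<Sum>e\<in>M'. g (?C - {e})) \<le> g ?C"
  proof (rule deletion_le)
    show "forest_relation ?C" by (rule forest_relation_insert_row[OF H(2) ab(1)])
    show "M' \<subseteq> ?C" using MH(1) by (auto simp: M')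
    show "partial_transversal M'"
    proof (cases "(c, d) \<in> M")
      case False
      then have "d \<notin> Range M" using cd(2) MH(1) by blast
      moreover have "a \<notin> Domain M" using ab(1) MH(1) by blast
      ultimately show ?thesis using False MH(2) by (simp add: M' partial_transversal_insert)
    qed (use MH(2) in \<open>simp add: M'\<close>)
  qed (use H in simp)
  have "g ?R + g ?C \<le> Suc (card H) * g H"
    using attach_le[OF H(1) cd(1) ab] isolated_le[OF H(1) ab] by (rule order_trans)
  with R C total
  show "g ?R = (\<Sum>e\<in>M. g (?R - {e}))" "g ?C = (\<Sum>e\<in>M'. g (?C - {e}))"
    "g ?R + g ?C = Suc (card H) * g H" by linarith+
qed

end

lemma saturatingI:
  assumes "M \<subseteq> D" "partial_transversal M"
    and "\<And>i j j'. (i, j) \<in> D \<Longrightarrow> (i, j') \<in> D \<Longrightarrow> i \<notin> Domain M \<Longrightarrow> j' = j"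
    and "\<And>i j i'. (i, j) \<in> D \<Longrightarrow> (i', j) \<in> D \<Longrightarrow> j \<notin> Range M \<Longrightarrow> i' = i"
    and "\<And>i j. (i, j) \<in> D \<Longrightarrow> i \<in> Domain M \<or> j \<in> Range M"
  shows "saturating D M"
  unfolding saturating_def using assms by blast

lemma saturatingD:
  assumes "saturating D M"
  shows "M \<subseteq> D" "partial_transversal M"
    and "(i, j) \<in> D \<Longrightarrow> (i, j') \<in> D \<Longrightarrow> i \<notin> Domain M \<Longrightarrow> j' = j"
    and "(i, j) \<in> D \<Longrightarrow> (i', j) \<in> D \<Longrightarrow> j \<notin> Range M \<Longrightarrow> i' = i"
    and "(i, j) \<in> D \<Longrightarrow> i \<in> Domain M \<or> j \<in> Range M"
  using assms unfolding saturating_def by meson+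

lemma saturating_insert_isolated:
  assumes "saturating H M" "a \<notin> Domain H" "b \<notin> Range H"
  shows "saturating (insert (a, b) H) (insert (a, b) M)"
proof (rule saturatingI)
  note M = saturatingD[OF assms(1)]
  have ab: "(a, j) \<notin> H" "(i, b) \<notin> H" for i j using assms(2,3) by blast+
  show "insert (a, b) M \<subseteq> insert (a, b) H" using M(1) by blast
  show "partial_transversal (insert (a, b) M)"
    by (rule partial_transversal_insert[OF M(2)]) (use M(1) assms(2,3) in blast)+
  fix i j
  assume ij: "(i, j) \<in> insert (a, b) H"
  show "i \<in> Domain (insert (a, b) M) \<or> j \<in> Range (insert (a, b) M)"
    using M(5)[of i j] ij by auto
  show "j' = j" if "(i, j') \<in> insert (a, b) H" "i \<notin> Domain (insert (a, b) M)" for j'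
    using M(3)[of i j j'] ij that by auto
  show "i' = i" if "(i', j) \<in> insert (a, b) H" "j \<notin> Range (insert (a, b) M)" for i'
    using M(4)[of i j i'] ij that by auto
qed

text \<open>The row \<open>c\<close> is already matched, because its column \<open>d\<close> is a leaf.\<close>

lemma saturating_insert_column:
  assumes sat: "saturating H M" and cd: "(c, d) \<in> H" "\<forall>i. (i, d) \<in> H \<longrightarrow> i = c" and b: "b \<notin> Range H"
  shows "saturating (insert (c, b) H) M"
proof (rule saturatingI)
  note M = saturatingD[OF sat]
  have c: "c \<in> Domain M"
  proof (rule ccontr)
    assume c: "c \<notin> Domain M"
    then obtain i where i: "(i, d) \<in> M" using M(5)[OF cd(1)] by blast
    then have "i = c" using M(1) cd(2) by blast
    then show False using c i by blast
  qed
  have bH: "(i, b) \<notin> H" for i using b by blast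
  show "M \<subseteq> insert (c, b) H" "partial_transversal M" using M(1,2) by blast+
  fix i j
  assume ij: "(i, j) \<in> insert (c, b) H"
  show "i \<in> Domain M \<or> j \<in> Range M"
    using M(5)[of i j] ij c by auto
  show "j' = j" if "(i, j') \<in> insert (c, b) H" "i \<notin> Domain M" for j'
    using M(3)[of i j j'] ij that c by auto
  show "i' = i" if "(i', j) \<in> insert (c, b) H" "j \<notin> Range M" for i'
    using M(4)[of i j i'] ij that bH by auto
qed

text \<open>The new row makes \<open>d\<close> a vertex of degree two, which has to be matched.\<close>

lemma saturating_insert_row:
  assumes sat: "saturating H M" and cd: "(c, d) \<in> H" "\<forall>i. (i, d) \<in> H \<longrightarrow> i = c" and a: "a \<notin> Domain H"
  shows "saturating (insert (a, d) H) (if (c, d) \<in> M then M else insert (a, d) M)" (is "saturating _ ?M'")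
proof (rule saturatingI)
  note M = saturatingD[OF sat]
  have aH: "(a, j) \<notin> H" for j using a by blast
  have d: "d \<in> Range ?M'" by (auto intro: RangeI)
  have sub: "Domain M \<subseteq> Domain ?M'" "Range M \<subseteq> Range ?M'" by auto
  show "?M' \<subseteq> insert (a, d) H" using M(1) by auto
  show "partial_transversal ?M'"
  proof (cases "(c, d) \<in> M")
    case False
    have "a \<notin> Domain M" using M(1) a by blast
    moreover have "d \<notin> Range M" using M(1) cd(2) False by blast
    ultimately show ?thesis using False partial_transversal_insert[OF M(2)] by simp
  qed (use M(2) in simp)
  fix i j
  assume ij: "(i, j) \<in> insert (a, d) H"
  show "i \<in> Domain ?M' \<or> j \<in> Range ?M'"
    using M(5)[of i j] ij d sub by (metis Pair_inject insertE subsetD)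
  show "j' = j" if "(i, j') \<in> insert (a, d) H" "i \<notin> Domain ?M'" for j'
    using M(3)[of i j j'] ij that sub(1) aH by (metis Pair_inject insertE subsetD)
  show "i' = i" if "(i', j) \<in> insert (a, d) H" "j \<notin> Range ?M'" for i'
    using M(4)[of i j i'] ij that sub(2) d by (metis Pair_inject insertE subsetD)
qed

lemma ex_saturating_step:
  fixes D :: "('r \<times> 'c) set"
  assumes D: "finite D" "forest_relation D"
    and cases: "isolated_box D \<or> twin_leaves D \<or> pendant_path D"
    and IH: "\<And>H :: ('r \<times> 'c) set. finite H \<Longrightarrow> forest_relation H \<Longrightarrow> card H < card D \<Longrightarrow> \<exists>M. saturating H M"
  shows "\<exists>M. saturating D M"
proof -
  have reduce: "\<exists>M. saturating (D - {e}) M" "insert e (D - {e}) = D" if "e \<in> D" for e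
  proof -
    show "\<exists>M. saturating (D - {e}) M"
    proof (rule IH)
      show "card (D - {e}) < card D" by (rule card_Diff1_less[OF D(1) that])
      show "forest_relation (D - {e})" by (rule forest_relation_subset[OF D(2)]) blast
    qed (use D in simp)
    show "insert e (D - {e}) = D" using that by blast
  qed
  from cases consider "isolated_box D" | "twin_leaves D" | "pendant_path D" by argo
  then show ?thesis
  proof cases
    case 1
    then obtain a b where ab: "(a, b) \<in> D" "\<forall>j. (a, j) \<in> D \<longrightarrow> j = b" "\<forall>i. (i, b) \<in> D \<longrightarrow> i = a"
      unfolding isolated_box_def by (elim exE conjE)
    obtain M where "saturating (D - {(a, b)}) M" using reduce(1)[OF ab(1)] by (elim exE)
    moreover have "a \<notin> Domain (D - {(a, b)})" "b \<notin> Range (D - {(a, b)})" using ab(2,3) by blast+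
    ultimately have "saturating D (insert (a, b) M)"
      using saturating_insert_isolated[of "D - {(a, b)}" M a b] unfolding reduce(2)[OF ab(1)] by simp
    then show ?thesis by (rule exI)
  next
    case 2
    then obtain c b d where cbd: "(c, b) \<in> D" "(c, d) \<in> D" "b \<noteq> d"
      "\<forall>i. (i, b) \<in> D \<longrightarrow> i = c" "\<forall>i. (i, d) \<in> D \<longrightarrow> i = c"
      unfolding twin_leaves_def by (elim exE conjE)
    obtain M where "saturating (D - {(c, b)}) M" using reduce(1)[OF cbd(1)] by (elim exE)
    moreover have "(c, d) \<in> D - {(c, b)}" using cbd(2,3) by simp
    moreover have "\<forall>i. (i, d) \<in> D - {(c, b)} \<longrightarrow> i = c" using cbd(5) by simp
    moreover have "b \<notin> Range (D - {(c, b)})" using cbd(4) by blast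
    ultimately have "saturating (insert (c, b) (D - {(c, b)})) M" by (rule saturating_insert_column)
    then show ?thesis unfolding reduce(2)[OF cbd(1)] by (rule exI)
  next
    case 3
    then obtain a c d where acd: "(a, d) \<in> D" "(c, d) \<in> D" "a \<noteq> c"
      "\<forall>j. (a, j) \<in> D \<longrightarrow> j = d" "\<forall>i. (i, d) \<in> D \<longrightarrow> i = a \<or> i = c"
      unfolding pendant_path_def by (elim exE conjE)
    obtain M where "saturating (D - {(a, d)}) M" using reduce(1)[OF acd(1)] by (elim exE)
    moreover have "(c, d) \<in> D - {(a, d)}" using acd(2,3) by simp
    moreover have "\<forall>i. (i, d) \<in> D - {(a, d)} \<longrightarrow> i = c" using acd(5) by blast
    moreover have "a \<notin> Domain (D - {(a, d)})" using acd(4) by blast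
    ultimately have "saturating (insert (a, d) (D - {(a, d)}))
      (if (c, d) \<in> M then M else insert (a, d) M)" by (rule saturating_insert_row)
    then show ?thesis unfolding reduce(2)[OF acd(1)] by (rule exI)
  qed
qed

lemma ex_saturating:
  fixes D :: "('r \<times> 'c) set"
  assumes "finite D" "forest_relation D"
  shows "\<exists>M. saturating D M"
  using assms
proof (induction "card D" arbitrary: D rule: less_induct)
  case less
  show ?case
  proof (cases "D = {}")
    case True
    then have "saturating D {}" by (simp add: saturating_def partial_transversal_def)
    then show ?thesis by (rule exI)
  next
    case False
    consider "isolated_box D \<or> twin_leaves D \<or> pendant_path D"
      | "twin_leaves (D\<inverse>) \<or> pendant_path (D\<inverse>)"
      using forest_relation_cases[OF less.prems(2) False] by argo
    then show ?thesis
    proof cases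
      case 1
      show ?thesis
        by (rule ex_saturating_step[OF less.prems 1]) (rule less.hyps)
    next
      case 2
      have "\<exists>M. saturating (D\<inverse>) M"
      proof (rule ex_saturating_step)
        show "isolated_box (D\<inverse>) \<or> twin_leaves (D\<inverse>) \<or> pendant_path (D\<inverse>)" using 2 by argo
        fix H :: "('c \<times> 'r) set"
        assume H: "finite H" "forest_relation H" "card H < card (D\<inverse>)"
        then have "\<exists>M. saturating (H\<inverse>) M"
          by (intro less.hyps) (simp_all add: forest_relation_converse)
        then obtain M where "saturating (H\<inverse>) ((M\<inverse>)\<inverse>)" unfolding converse_converse by (elim exE)
        then have "saturating H (M\<inverse>)" by (simp only: saturating_converse)
        then show "\<exists>M. saturating H M" by (rule exI)
      qed (use less.prems in \<open>simp_all add: forest_relation_converse\<close>)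
      then obtain M where "saturating (D\<inverse>) ((M\<inverse>)\<inverse>)" unfolding converse_converse by (elim exE)
      then have "saturating D (M\<inverse>)" by (simp only: saturating_converse)
      then show ?thesis by (rule exI)
    qed
  qed
qed

lemma saturating_delete_leaf:
  assumes sat: "saturating D M" and a: "a \<notin> Domain (D - {(a, d)})"
    and col: "\<And>i. (i, d) \<in> D - {(a, d)} \<Longrightarrow> i = c" and c: "(c, d) \<in> D \<Longrightarrow> c \<noteq> a \<Longrightarrow> c \<in> Domain M"
  shows "saturating (D - {(a, d)}) (M - {(a, d)})" (is "saturating ?H ?N")
proof (rule saturatingI)
  note M = saturatingD[OF sat]
  show "?N \<subseteq> ?H" using M(1) by blast
  show "partial_transversal ?N" by (rule partial_transversal_subset[OF M(2)]) blast
  fix i j assume ij: "(i, j) \<in> ?H"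
  have "i \<noteq> a" using a ij by blast
  then have row: "i \<in> Domain ?N \<longleftrightarrow> i \<in> Domain M" by blast
  have j: "j \<in> Range ?N \<longleftrightarrow> j \<in> Range M" if "j \<noteq> d" using that by blast
  have i: "i = c" "i \<in> Domain M" if "j = d"
  proof -
    show "i = c" using col ij that by simp
    then show "i \<in> Domain M" using c ij that \<open>i \<noteq> a\<close> by simp
  qed
  show "i \<in> Domain ?N \<or> j \<in> Range ?N"
    using M(5)[of i j] ij row j i(2) by (cases "j = d") simp_all
  show "j' = j" if "(i, j') \<in> ?H" "i \<notin> Domain ?N" for j'
    using M(3)[of i j j'] ij that row by simp
  show "i' = i" if i': "(i', j) \<in> ?H" "j \<notin> Range ?N" for i'
  proof (cases "j = d")
    case True
    then show ?thesis using col[of i'] i'(1) i(1) by simp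
  next
    case False
    then show ?thesis using M(4)[of i j i'] ij i' j by simp
  qed
qed

text \<open>The given matching of \<open>D\<close> is turned into one of \<open>D\<close> minus a leaf edge, to which the previous two steps
apply. For two leaves \<open>b\<close> and \<open>d\<close> at \<open>c\<close>, at most one of them is matched, and an unmatched one is removed.\<close>

lemma (in forest_dimension) deletion_step:
  assumes D: "finite D" "forest_relation D" "saturating D M"
    and cases: "isolated_box D \<or> twin_leaves D \<or> pendant_path D"
    and rules: "\<And>m. m < card D \<Longrightarrow> forest_rules g m"
  shows "g D = (\<Sum>e\<in>M. g (D - {e}))"
proof -
  note M = saturatingD[OF D(3)]
  have forest: "forest_relation (D - {e})" for e by (rule forest_relation_subset[OF D(2)]) blast
  have fin: "finite (D - {e})" for e using D(1) by simp
  have card: "card (D - {e}) < card D" if "e \<in> D" for e by (rule card_Diff1_less[OF D(1) that])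
  have rules': "forest_rules g m" if "m < card (D - {e})" "e \<in> D" for m e
    using rules that card[of e] by simp
  have rec: "g (D - {e}) = (\<Sum>f\<in>N. g (D - {e} - {f}))"
    if "e \<in> D" "saturating (D - {e}) N" "D - {e} \<noteq> {}" for e N
  proof -
    have "deletion_rule g (card (D - {e}))"
      using rules card[OF that(1)] by (simp add: forest_rules_def)
    then show ?thesis using fin forest that(2,3) unfolding deletion_rule_def by simp
  qed
  from cases consider "isolated_box D" | "twin_leaves D" | "pendant_path D" by argo
  then show ?thesis
  proof cases
    case 1
    then obtain a b where ab: "(a, b) \<in> D" "\<forall>j. (a, j) \<in> D \<longrightarrow> j = b" "\<forall>i. (i, b) \<in> D \<longrightarrow> i = a"
      unfolding isolated_box_def by (elim exE conjE)
    let ?H = "D - {(a, b)}" and ?N = "M - {(a, b)}"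
    have eq: "insert (a, b) ?H = D" using ab(1) by blast
    have fresh: "a \<notin> Domain ?H" "b \<notin> Range ?H" using ab(2,3) by blast+
    have abM: "(a, b) \<in> M" using M(1) M(5)[OF ab(1)] ab(2,3) by blast
    have sat: "saturating ?H ?N"
      by (rule saturating_delete_leaf[OF D(3) fresh(1), of a]) (use fresh(2) in blast)+
    have "g (insert (a, b) ?H) = (\<Sum>e\<in>insert (a, b) ?N. g (insert (a, b) ?H - {e}))"
      by (rule isolated_step(2)[OF fin forest fresh sat rules'[OF _ ab(1)] rec[OF ab(1) sat]])
    moreover have "insert (a, b) ?N = M" using abM by blast
    ultimately show ?thesis unfolding eq by simp
  next
    case 2
    then obtain c b d where cbd: "(c, b) \<in> D" "(c, d) \<in> D" "b \<noteq> d"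
      "\<forall>i. (i, b) \<in> D \<longrightarrow> i = c" "\<forall>i. (i, d) \<in> D \<longrightarrow> i = c"
      unfolding twin_leaves_def by (elim exE conjE)
    have step: ?thesis
      if cbd: "(c, b) \<in> D" "(c, d) \<in> D" "b \<noteq> d"
        "\<forall>i. (i, b) \<in> D \<longrightarrow> i = c" "\<forall>i. (i, d) \<in> D \<longrightarrow> i = c" and cb: "(c, b) \<notin> M" for b d
    proof -
      let ?H = "D - {(c, b)}"
      have eq: "insert (c, b) ?H = D" using cbd(1) by blast
      obtain a where a: "a \<notin> Domain ?H" using ex_new_if_finite[OF infinite_UNIV_nat] fin[of "(c, b)"]
        by (metis finite_Domain)
      have b: "b \<notin> Range ?H" using cbd(4) by blast
      have sat: "saturating ?H M" by (rule saturating_subset[OF D(3)]) (use M(1) cb in blast)+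
      have cd: "(c, d) \<in> ?H" "\<forall>i. (i, d) \<in> ?H \<longrightarrow> i = c" using cbd(2,3,5) by blast+
      then have "?H \<noteq> {}" by blast
      have "g (insert (c, b) ?H) = (\<Sum>e\<in>M. g (insert (c, b) ?H - {e}))"
        by (rule attach_step(1)[OF fin forest cd a b sat rules'[OF _ cbd(1)]
              rec[OF cbd(1) sat \<open>?H \<noteq> {}\<close>] refl])
      then show ?thesis unfolding eq .
    qed
    show ?thesis
    proof (cases "(c, b) \<in> M")
      case True
      then have "(c, d) \<notin> M" using partial_transversalD(1)[OF M(2) True _ refl] cbd(3) by blast
      then show ?thesis using step[OF cbd(2,1) cbd(3)[symmetric] cbd(5,4)] by blast
    next
      case False
      then show ?thesis by (rule step[OF cbd])
    qed
  next
    case 3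
    then obtain a c d j' where acd: "(a, d) \<in> D" "(c, d) \<in> D" "a \<noteq> c"
      "\<forall>j. (a, j) \<in> D \<longrightarrow> j = d" "\<forall>i. (i, d) \<in> D \<longrightarrow> i = a \<or> i = c" "(c, j') \<in> D" "j' \<noteq> d"
      unfolding pendant_path_def by (elim exE conjE)
    let ?H = "D - {(a, d)}" and ?N = "M - {(a, d)}"
    have eq: "insert (a, d) ?H = D" using acd(1) by blast
    have a: "a \<notin> Domain ?H" using acd(4) by blast
    obtain b where b: "b \<notin> Range ?H" using ex_new_if_finite[OF infinite_UNIV_nat] fin[of "(a, d)"]
      by (metis finite_Range)
    have cd: "(c, d) \<in> ?H" "\<forall>i. (i, d) \<in> ?H \<longrightarrow> i = c" using acd(2,3,5) by blast+
    have c: "c \<in> Domain M" using M(3)[OF acd(2,6)] acd(7) by blast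
    have d: "d \<in> Range M" using M(4)[OF acd(2,1)] acd(3) by blast
    have M': "M = (if (c, d) \<in> ?N then ?N else insert (a, d) ?N)"
    proof (cases "(c, d) \<in> M")
      case True
      then have "(a, d) \<notin> M" using partial_transversalD(2)[OF M(2) True _ refl] acd(3) by blast
      then show ?thesis using True by simp
    next
      case False
      then have "(a, d) \<in> M" using d M(1) acd(5) by blast
      then show ?thesis using False by auto
    qed
    have sat: "saturating ?H ?N"
      by (rule saturating_delete_leaf[OF D(3) a cd(2)[rule_format] c])
    have "?H \<noteq> {}" using cd(1) by blast
    have "g (insert (a, d) ?H) = (\<Sum>e\<in>M. g (insert (a, d) ?H - {e}))"
      by (rule attach_step(2)[OF fin forest cd a b sat rules'[OF _ acd(1)]
            rec[OF acd(1) sat \<open>?H \<noteq> {}\<close>] M'])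
    then show ?thesis unfolding eq .
  qed
qed

lemma forest_rules_all:
  assumes "forest_dimension g"
  shows "forest_rules g m"
  using assms
proof (induction m arbitrary: g rule: less_induct)
  case (less m)
  interpret forest_dimension g by (rule less.prems)
  interpret conv: forest_dimension "\<lambda>D. g (D\<inverse>)" by (rule forest_dimension_converse)
  note rules = less.IH[OF _ forest_dimension_axioms] and conv_rules = less.IH[OF _ conv.forest_dimension_axioms]
  have deletion: "g D = (\<Sum>e\<in>M. g (D - {e}))"
    if D: "finite D" "card D = m" "D \<noteq> {}" "forest_relation D" "saturating D M" for D M
  proof -
    consider "isolated_box D \<or> twin_leaves D \<or> pendant_path D"
      | "twin_leaves (D\<inverse>) \<or> pendant_path (D\<inverse>)"
      using forest_relation_cases[OF D(4,3)] by argo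
    then show ?thesis
    proof cases
      case 1
      show ?thesis by (rule deletion_step[OF D(1,4,5) 1 rules]) (use D(2) in simp)
    next
      case 2
      have "g ((D\<inverse>)\<inverse>) = (\<Sum>e\<in>M\<inverse>. g ((D\<inverse> - {e})\<inverse>))"
      proof (rule conv.deletion_step)
        show "isolated_box (D\<inverse>) \<or> twin_leaves (D\<inverse>) \<or> pendant_path (D\<inverse>)" using 2 by argo
        show "forest_rules (\<lambda>D. g (D\<inverse>)) k" if "k < card (D\<inverse>)" for k
          by (rule conv_rules) (use that D(2) in simp)
      qed (use D in \<open>simp_all add: forest_relation_converse saturating_converse\<close>)
      then show ?thesis unfolding sum_over_converse converse_converse .
    qed
  qed
  have attach: "g (insert (c, b) H) + g (insert (a, d) H) = Suc (card H) * g H"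
    if H: "finite H" "card H = m" "forest_relation H" and leaf: "leaf_box H c d"
      and ab: "a \<notin> Domain H" "b \<notin> Range H" for H a b c d
  proof -
    have cd: "(c, d) \<in> H" using leaf by (simp add: leaf_box_def)
    obtain M where M: "saturating H M" using ex_saturating[OF H(1,3)] by (elim exE)
    have rec: "g H = (\<Sum>e\<in>M. g (H - {e}))" by (rule deletion[OF H(1,2) _ H(3) M]) (use cd in blast)
    consider "\<forall>i. (i, d) \<in> H \<longrightarrow> i = c" | "\<forall>j. (c, j) \<in> H \<longrightarrow> j = d"
      using leaf unfolding leaf_box_def by meson
    then show ?thesis
    proof cases
      case 1
      show ?thesis by (rule attach_step(3)[OF H(1,3) cd 1 ab M rules rec refl]) (use H(2) in simp)
    next
      case 2
      have ins: "(insert (x, y) (H\<inverse>))\<inverse> = insert (y, x) H" for x y by auto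
      have "g ((insert (d, a) (H\<inverse>))\<inverse>) + g ((insert (b, c) (H\<inverse>))\<inverse>) = Suc (card (H\<inverse>)) * g ((H\<inverse>)\<inverse>)"
      proof (rule conv.attach_step(3)[OF _ _ _ _ _ _ _ _ _ refl])
        show "saturating (H\<inverse>) (M\<inverse>)" using M by (simp add: saturating_converse)
        show "g ((H\<inverse>)\<inverse>) = (\<Sum>e\<in>M\<inverse>. g ((H\<inverse> - {e})\<inverse>))"
          unfolding sum_over_converse converse_converse by (rule rec)
        show "forest_rules (\<lambda>D. g (D\<inverse>)) k" if "k < card (H\<inverse>)" for k
          by (rule conv_rules) (use that H(2) in simp)
        show "\<forall>i. (i, c) \<in> H\<inverse> \<longrightarrow> i = d" unfolding converse_iff by (rule 2)
      qed (use H cd ab in \<open>simp_all add: forest_relation_converse\<close>)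
      then show ?thesis unfolding ins converse_converse by simp
    qed
  qed
  have isolated: "g (insert (a, b) H) = Suc (card H) * g H"
    if H: "finite H" "card H = m" "forest_relation H" and ab: "a \<notin> Domain H" "b \<notin> Range H" for H a b
  proof -
    obtain M where M: "saturating H M" using ex_saturating[OF H(1,3)] by (elim exE)
    show ?thesis
      by (rule isolated_step(1)[OF H(1,3) ab M rules deletion[OF H(1,2) _ H(3) M]]) (use H(2) in simp_all)
  qed
  show ?case
    unfolding forest_rules_def isolated_rule_def attach_rule_def deletion_rule_def
    using deletion attach isolated by (intro conjI allI impI) auto
qed

theorem (in forest_dimension) deletion_recursion:
  assumes "finite D" "D \<noteq> {}" "forest_relation D" "saturating D M"
  shows "g D = (\<Sum>e\<in>M. g (D - {e}))"
  using forest_rules_all[OF forest_dimension_axioms, of "card D"] assms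
  unfolding forest_rules_def deletion_rule_def by blast

section \<open>Isomorphisms of representations\<close>

definition rep_isomorphism ::
  "'g set \<Rightarrow> ('g, 'v::ab_group_add) representation \<Rightarrow> ('g, 'w::ab_group_add) representation \<Rightarrow> ('v \<Rightarrow> 'w) \<Rightarrow> bool"
  where
  "rep_isomorphism H V W \<phi> \<longleftrightarrow> bij_betw \<phi> (space V) (space W) \<and>
     (\<forall>x \<in> space V. \<forall>y \<in> space V. \<phi> (x + y) = \<phi> x + \<phi> y) \<and>
     (\<forall>c. \<forall>x \<in> space V. \<phi> (scale V c x) = scale W c (\<phi> x)) \<and>
     (\<forall>g \<in> H. \<forall>x \<in> space V. \<phi> (action V g x) = action W g (\<phi> x))"

lemma rep_isomorphic_iff: "rep_isomorphic H V W \<longleftrightarrow> (\<exists>\<phi>. rep_isomorphism H V W \<phi>)"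
  by (simp only: rep_isomorphic_def rep_isomorphism_def)

lemma rep_isomorphismD:
  assumes "rep_isomorphism H V W \<phi>"
  shows "bij_betw \<phi> (space V) (space W)"
    and "x \<in> space V \<Longrightarrow> y \<in> space V \<Longrightarrow> \<phi> (x + y) = \<phi> x + \<phi> y"
    and "x \<in> space V \<Longrightarrow> \<phi> (scale V c x) = scale W c (\<phi> x)"
    and "g \<in> H \<Longrightarrow> x \<in> space V \<Longrightarrow> \<phi> (action V g x) = action W g (\<phi> x)"
    and "x \<in> space V \<Longrightarrow> \<phi> x \<in> space W"
  using assms unfolding rep_isomorphism_def by (blast dest: bij_betw_apply)+

lemma rep_isomorphic_trans:
  assumes "rep_isomorphic H U V" "rep_isomorphic H V W"
  shows "rep_isomorphic H U W"
proof -
  obtain \<phi> where "rep_isomorphism H U V \<phi>" using assms(1) unfolding rep_isomorphic_iff by (elim exE)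
  note \<phi> = rep_isomorphismD[OF this]
  obtain \<psi> where "rep_isomorphism H V W \<psi>" using assms(2) unfolding rep_isomorphic_iff by (elim exE)
  note \<psi> = rep_isomorphismD[OF this]
  show ?thesis
    unfolding rep_isomorphic_def
    by (rule exI[of _ "\<psi> \<circ> \<phi>"], intro conjI ballI allI bij_betw_trans[OF \<phi>(1) \<psi>(1)])
       (simp_all add: \<phi>(2-5) \<psi>(2-4))
qed

lemma rep_isomorphic_sym:
  assumes iso: "rep_isomorphic H V W"
    and "\<And>x y. x \<in> space V \<Longrightarrow> y \<in> space V \<Longrightarrow> x + y \<in> space V"
    and "\<And>c x. x \<in> space V \<Longrightarrow> scale V c x \<in> space V"
    and "\<And>g x. g \<in> H \<Longrightarrow> x \<in> space V \<Longrightarrow> action V g x \<in> space V"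
  shows "rep_isomorphic H W V"
proof -
  obtain \<phi> where "rep_isomorphism H V W \<phi>" using iso unfolding rep_isomorphic_iff by (elim exE)
  note \<phi> = rep_isomorphismD[OF this]
  let ?\<psi> = "inv_into (space V) \<phi>"
  have \<psi>: "bij_betw ?\<psi> (space W) (space V)" by (rule bij_betw_inv_into[OF \<phi>(1)])
  note \<phi>\<psi> = bij_betw_inv_into_right[OF \<phi>(1)] and \<psi>\<phi> = bij_betw_inv_into_left[OF \<phi>(1)]
  have mem: "?\<psi> y \<in> space V" if "y \<in> space W" for y using \<psi> that by (rule bij_betw_apply)
  have 1: "?\<psi> (x + y) = ?\<psi> x + ?\<psi> y" if "x \<in> space W" "y \<in> space W" for x y
    using \<psi>\<phi>[OF assms(2)[OF mem[OF that(1)] mem[OF that(2)]]] \<phi>(2) mem that by (simp add: \<phi>\<psi>)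
  have 2: "?\<psi> (scale W c x) = scale V c (?\<psi> x)" if "x \<in> space W" for c x
    using \<psi>\<phi>[OF assms(3)[OF mem[OF that]], of c] \<phi>(3) mem[OF that] that by (simp add: \<phi>\<psi>)
  have 3: "?\<psi> (action W g x) = action V g (?\<psi> x)" if "g \<in> H" "x \<in> space W" for g x
    using \<psi>\<phi>[OF assms(4)[OF that(1) mem[OF that(2)]]] \<phi>(4) mem that by (simp add: \<phi>\<psi>)
  show ?thesis
    unfolding rep_isomorphic_def
    by (rule exI[of _ ?\<psi>], intro conjI ballI allI \<psi> 1 2 3)
qed

lemma rep_isomorphic_subgroup:
  "rep_isomorphic H V W \<Longrightarrow> K \<subseteq> H \<Longrightarrow> rep_isomorphic K V W"
  unfolding rep_isomorphic_def by (elim exE) (rule exI, fast)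

lemma space_direct_sum:
  fixes V :: "'i \<Rightarrow> ('g, 'v::ab_group_add) representation"
  assumes "finite I"
  shows "space (direct_sum I V) = {x. (\<forall>i\<in>I. x i \<in> space (V i)) \<and> (\<forall>i. i \<notin> I \<longrightarrow> x i = 0)}"
proof -
  have "finite {i. x i \<noteq> 0}" if "\<forall>i. i \<notin> I \<longrightarrow> x i = 0" for x :: "'i \<Rightarrow> 'v"
    by (rule finite_subset[OF _ assms]) (use that in blast)
  then show ?thesis unfolding direct_sum_def by auto
qed

lemma rep_isomorphic_direct_sum:
  assumes I: "finite I" and iso: "\<And>i. i \<in> I \<Longrightarrow> rep_isomorphic H (V i) (W i)"
  shows "rep_isomorphic H (direct_sum I V) (direct_sum I W)"
proof -
  have "\<forall>i\<in>I. \<exists>\<phi>. rep_isomorphism H (V i) (W i) \<phi>"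
    using iso unfolding rep_isomorphic_iff by blast
  then obtain \<phi> where iso_\<phi>: "\<forall>i\<in>I. rep_isomorphism H (V i) (W i) (\<phi> i)"
    by (rule bchoice[THEN exE])
  note \<phi> = rep_isomorphismD[OF iso_\<phi>[rule_format]]
  define \<Phi> where "\<Phi> x = (\<lambda>i. if i \<in> I then \<phi> i (x i) else 0)" for x
  define \<Psi> where "\<Psi> y = (\<lambda>i. if i \<in> I then inv_into (space (V i)) (\<phi> i) (y i) else 0)" for y
  note sp = space_direct_sum[OF I]
  have inv: "inv_into (space (V i)) (\<phi> i) (\<phi> i x) = x" if "i \<in> I" "x \<in> space (V i)" for i x
    by (rule bij_betw_inv_into_left[OF \<phi>(1)[OF that(1)] that(2)])
  have inv': "\<phi> i (inv_into (space (V i)) (\<phi> i) y) = y" if "i \<in> I" "y \<in> space (W i)" for i y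
    by (rule bij_betw_inv_into_right[OF \<phi>(1)[OF that(1)] that(2)])
  have mem': "inv_into (space (V i)) (\<phi> i) y \<in> space (V i)" if "i \<in> I" "y \<in> space (W i)" for i y
    using bij_betw_inv_into[OF \<phi>(1)[OF that(1)]] that(2) by (rule bij_betw_apply)
  have "bij_betw \<Phi> (space (direct_sum I V)) (space (direct_sum I W))"
  proof (rule bij_betw_byWitness[where f' = \<Psi>])
    show "\<forall>x\<in>space (direct_sum I V). \<Psi> (\<Phi> x) = x"
      by (simp add: sp \<Phi>_def \<Psi>_def fun_eq_iff inv)
    show "\<forall>y\<in>space (direct_sum I W). \<Phi> (\<Psi> y) = y"
      by (simp add: sp \<Phi>_def \<Psi>_def fun_eq_iff inv')
    show "\<Phi> ` space (direct_sum I V) \<subseteq> space (direct_sum I W)"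
      by (rule image_subsetI) (simp add: sp \<Phi>_def \<phi>(5))
    show "\<Psi> ` space (direct_sum I W) \<subseteq> space (direct_sum I V)"
      by (rule image_subsetI) (simp add: sp \<Psi>_def mem')
  qed
  then have "rep_isomorphism H (direct_sum I V) (direct_sum I W) \<Phi>"
    unfolding rep_isomorphism_def sp
    by (simp add: \<Phi>_def fun_eq_iff direct_sum_def \<phi>(2-4))
  then show ?thesis unfolding rep_isomorphic_iff by (rule exI[where x = \<Phi>])
qed

section \<open>The branching rule for diagrams of forests\<close>

interpretation specht: forest_dimension "specht_dim :: (nat \<times> nat) set \<Rightarrow> nat"
proof
  fix D M :: "(nat \<times> nat) set"
  assume *: "finite D" "forest_relation D" "M \<subseteq> D" "partial_transversal M"
  have "finite M" using *(1,3) by (rule finite_subset[rotated])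
  from ex_triangular_order[OF this *(2,3,4)]
  obtain es where "distinct es" "set es = M" "sorted_wrt (\<lambda>e f. (fst e, snd f) \<notin> D) es"
    by (elim exE conjE)
  then show "(\<Sum>e\<in>M. specht_dim (D - {e})) \<le> specht_dim D"
    using branching[OF *(1), of es] *(3) by simp
qed (rule specht_dim_rename specht_dim_attach_le specht_dim_isolated_box_le; assumption)+

text \<open>By the recursion for the dimensions, the term for the common kernel in \<open>branching\<close> is \<open>0\<close>.\<close>

lemma branch_maps_bijective:
  fixes D M :: "(nat \<times> nat) set"
  assumes D: "finite D" "D \<noteq> {}" "forest_relation D" "saturating D M"
  shows "\<And>F. F \<in> word_module D \<Longrightarrow> (\<And>e. e \<in> M \<Longrightarrow> branch_map D e F = 0) \<Longrightarrow> F = 0"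
    and "\<And>y. (\<And>e. e \<in> M \<Longrightarrow> y e \<in> word_module (D - {e})) \<Longrightarrow>
           \<exists>F\<in>word_module D. \<forall>e\<in>M. branch_map D e F = y e"
proof -
  note M = saturatingD[OF D(4)]
  have "finite M" using D(1) M(1) by (rule finite_subset[rotated])
  from ex_triangular_order[OF this D(3) M(1,2)]
  obtain es where es: "distinct es" "set es = M" "sorted_wrt (\<lambda>e f. (fst e, snd f) \<notin> D) es"
    by (elim exE conjE)
  have br: "specht_dim D = (\<Sum>e\<in>M. specht_dim (D - {e}))
            + cfun.dim {x \<in> word_module D. \<forall>e\<in>M. branch_map D e x = 0}"
      "\<forall>y. (\<forall>e\<in>M. y e \<in> word_module (D - {e})) \<longrightarrow>
            (\<exists>x\<in>word_module D. \<forall>e\<in>M. branch_map D e x = y e)"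
    using branching[OF D(1) es(1) _ es(3)] M(1) unfolding es(2) by blast+
  have 0: "cfun.dim {x \<in> word_module D. \<forall>e\<in>M. branch_map D e x = 0} = 0"
    using br(1) specht.deletion_recursion[OF D] by simp
  obtain A where A: "finite A" "word_module D \<subseteq> cfun.span A"
    using word_module_subset_finite_span[OF D(1)] by (elim exE conjE)
  show "F = 0" if "F \<in> word_module D" "\<And>e. e \<in> M \<Longrightarrow> branch_map D e F = 0" for F
    by (rule cfun_dim_eq_0_imp_trivial[OF 0 _ A(1)]) (use A(2) that in auto)
  show "\<exists>F\<in>word_module D. \<forall>e\<in>M. branch_map D e F = y e"
    if "\<And>e. e \<in> M \<Longrightarrow> y e \<in> word_module (D - {e})" for y
    using br(2) that by simp
qed

lemma branch_map_permute:
  assumes D: "finite D" "e \<in> D" and \<sigma>: "\<sigma> permutes {1..card D - 1}"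
  shows "branch_map D e (\<lambda>w. F (\<lambda>k. w (\<sigma> k))) = (\<lambda>w. branch_map D e F (\<lambda>k. w (\<sigma> k)))"
proof -
  let ?n = "card D"
  have card: "card (D - {e}) = ?n - 1" and "?n > 0" using D by (auto simp: card_gt_0_iff)
  then show ?thesis
    unfolding branch_map_def permute_before_last(2)[OF \<sigma> \<open>?n > 0\<close>]
    using gram_permute[of \<sigma> "D - {e}" "\<lambda>w. F (w(?n := fst e))"] \<sigma> card by simp
qed

definition word_rep :: "(nat \<times> nat) set \<Rightarrow> (nat \<Rightarrow> nat, (nat \<Rightarrow> nat) \<Rightarrow> complex) representation" where
  "word_rep D = \<lparr> space = word_module D, scale = cscale, action = (\<lambda>\<sigma> F w. F (\<lambda>k. w (\<sigma> k))) \<rparr>"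

text \<open>Deleting the last letter commutes with permutations of the others, so the bijection formed by the
\<open>branch_map\<close>s is equivariant. The matching is indexed by an arbitrary set to allow for edges of a graph.\<close>

lemma word_rep_branching:
  fixes D :: "(nat \<times> nat) set"
  assumes D: "finite D" "D \<noteq> {}" "forest_relation D" "saturating D (\<beta> ` I)"
    and I: "finite I" "inj_on \<beta> I"
  shows "rep_isomorphic {\<sigma> \<in> carrier (sym_group (card D)). \<sigma> (card D) = card D}
           (word_rep D) (direct_sum I (\<lambda>i. word_rep (D - {\<beta> i})))"
proof -
  let ?n = "card D"
  define \<phi> where "\<phi> F = (\<lambda>i. if i \<in> I then branch_map D (\<beta> i) F else 0)" for F
  note M = saturatingD[OF D(4)]
  have lin: "branch_map D e (x + y) = branch_map D e x + branch_map D e y"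
    "branch_map D e (cscale c x) = cscale c (branch_map D e x)" for e x y c
    using clinear_branch_map[of D e] unfolding clinear_iff by blast+
  have space: "space (direct_sum I (\<lambda>i. word_rep (D - {\<beta> i})))
      = {y. (\<forall>i\<in>I. y i \<in> word_module (D - {\<beta> i})) \<and> (\<forall>i. i \<notin> I \<longrightarrow> y i = 0)}"
    unfolding space_direct_sum[OF I(1)] by (simp add: word_rep_def)
  have inj: "x = y" if x: "x \<in> word_module D" and y: "y \<in> word_module D" and eq: "\<phi> x = \<phi> y" for x y
  proof -
    have "x - y = 0"
    proof (rule branch_maps_bijective(1)[OF D])
      show "x - y \<in> word_module D" by (rule cfun.subspace_diff[OF subspace_word_module x y])
      fix e assume "e \<in> \<beta> ` I"
      then obtain i where i: "i \<in> I" "e = \<beta> i" by blast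
      have "branch_map D e x = branch_map D e y" using fun_cong[OF eq, of i] i by (simp add: \<phi>_def)
      then show "branch_map D e (x - y) = 0"
        using cfun_pair.linear_diff[OF clinear_branch_map[of D e], of x y] by simp
    qed
    then show ?thesis by simp
  qed
  have "bij_betw \<phi> (word_module D) (space (direct_sum I (\<lambda>i. word_rep (D - {\<beta> i}))))"
    unfolding bij_betw_def
  proof
    show "inj_on \<phi> (word_module D)" by (rule inj_onI) (rule inj)
    show "\<phi> ` word_module D = space (direct_sum I (\<lambda>i. word_rep (D - {\<beta> i})))"
      unfolding space
    proof (intro Set.equalityI image_subsetI subsetI)
      fix x
      show "\<phi> x \<in> {y. (\<forall>i\<in>I. y i \<in> word_module (D - {\<beta> i})) \<and> (\<forall>i. i \<notin> I \<longrightarrow> y i = 0)}"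
        by (simp add: \<phi>_def branch_map_def gram_in_word_module)
    next
      fix y assume y: "y \<in> {y. (\<forall>i\<in>I. y i \<in> word_module (D - {\<beta> i})) \<and> (\<forall>i. i \<notin> I \<longrightarrow> y i = 0)}"
      have "y (inv_into I \<beta> e) \<in> word_module (D - {e})" if "e \<in> \<beta> ` I" for e
        using y that inv_into_f_f[OF I(2)] by auto
      then obtain F where F: "F \<in> word_module D" "\<forall>e\<in>\<beta> ` I. branch_map D e F = y (inv_into I \<beta> e)"
        using branch_maps_bijective(2)[OF D, of "\<lambda>e. y (inv_into I \<beta> e)"] by blast
      have "\<phi> F = y"
      proof
        fix i show "\<phi> F i = y i"
          using F(2) y inv_into_f_f[OF I(2), of i] by (cases "i \<in> I") (simp_all add: \<phi>_def)
      qed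
      then show "y \<in> \<phi> ` word_module D" using F(1) by blast
    qed
  qed
  moreover have "\<phi> (\<lambda>w. F (\<lambda>k. w (\<sigma> k))) = (\<lambda>i. if i \<in> I then \<lambda>w. \<phi> F i (\<lambda>k. w (\<sigma> k)) else 0)"
    if \<sigma>: "\<sigma> permutes {1..?n}" "\<sigma> ?n = ?n" for \<sigma> F
  proof -
    have \<sigma>': "\<sigma> permutes {1..?n - 1}"
      by (rule permutes_fixing_last[OF \<sigma>])
    show ?thesis
    proof
      fix i
      show "\<phi> (\<lambda>w. F (\<lambda>k. w (\<sigma> k))) i = (if i \<in> I then \<lambda>w. \<phi> F i (\<lambda>k. w (\<sigma> k)) else 0)"
      proof (cases "i \<in> I")
        case True
        then have "\<beta> i \<in> D" using M(1) by blast
        then show ?thesis using True branch_map_permute[OF D(1) _ \<sigma>'] by (simp add: \<phi>_def)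
      qed (simp add: \<phi>_def)
    qed
  qed
  ultimately show ?thesis
    unfolding rep_isomorphic_def
    by (intro exI[of _ \<phi>])
       (simp add: word_rep_def direct_sum_def sym_group_carrier, simp add: \<phi>_def lin fun_eq_iff)
qed

section \<open>Specht modules in the group algebra\<close>

lemma conv_sym_group:
  "conv (sym_group n) x y \<sigma> =
     (if \<sigma> permutes {1..n} then \<Sum>a | a permutes {1..n}. x a * y (inv' a \<circ> \<sigma>) else 0)"
proof -
  let ?A = "{(a, b). a \<in> carrier (sym_group n) \<and> b \<in> carrier (sym_group n) \<and> a \<otimes>\<^bsub>sym_group n\<^esub> b = \<sigma>}"
  have A: "(a, b) \<in> ?A \<longleftrightarrow> a permutes {1..n} \<and> b permutes {1..n} \<and> a \<circ> b = \<sigma>" for a b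
    by (simp add: sym_group_def)
  show ?thesis
  proof (cases "\<sigma> permutes {1..n}")
    case True
    have "?A = (\<lambda>a. (a, inv' a \<circ> \<sigma>)) ` {a. a permutes {1..n}}"
    proof (intro Set.set_eqI iffI)
      fix p assume "p \<in> ?A"
      then obtain a b where p: "p = (a, b)" and ab: "a permutes {1..n}" "a \<circ> b = \<sigma>"
        using A by (cases p) blast
      have "b = inv' a \<circ> \<sigma>"
        unfolding ab(2)[symmetric] o_assoc permutes_inv_o(2)[OF ab(1)] by simp
      then show "p \<in> (\<lambda>a. (a, inv' a \<circ> \<sigma>)) ` {a. a permutes {1..n}}" using p ab(1) by blast
    next
      fix p assume "p \<in> (\<lambda>a. (a, inv' a \<circ> \<sigma>)) ` {a. a permutes {1..n}}"
      then obtain a where p: "p = (a, inv' a \<circ> \<sigma>)" and a: "a permutes {1..n}" by blast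
      have "inv' a \<circ> \<sigma> permutes {1..n}" by (rule permutes_compose[OF True permutes_inv[OF a]])
      moreover have "a \<circ> (inv' a \<circ> \<sigma>) = \<sigma>" unfolding o_assoc permutes_inv_o(1)[OF a] by simp
      ultimately show "p \<in> ?A" using a unfolding p A by blast
    qed
    moreover have "inj_on (\<lambda>a. (a, inv' a \<circ> \<sigma>)) {a. a permutes {1..n}}" by (rule inj_onI) simp
    ultimately show ?thesis using True by (simp add: conv_def sum.reindex)
  next
    case False
    have "(a, b) \<notin> ?A" for a b
    proof
      assume "(a, b) \<in> ?A"
      then have "a permutes {1..n}" "b permutes {1..n}" "a \<circ> b = \<sigma>" using A by blast+
      then show False using False permutes_compose[of b "{1..n}" a] by simp
    qed
    then have "?A = {}" by fast
    then show ?thesis using False by (simp only: conv_def sum.empty if_False)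
  qed
qed

lemma row_stabilizer_eq:
  "row_stabilizer D t = {\<sigma>. \<sigma> permutes {1..card D} \<and> (\<forall>k\<in>{1..card D}. fst (t (\<sigma> k)) = fst (t k))}"
  and column_stabilizer_eq:
  "column_stabilizer D t = {\<sigma>. \<sigma> permutes {1..card D} \<and> (\<forall>k\<in>{1..card D}. snd (t (\<sigma> k)) = snd (t k))}"
proof -
  have *: "(\<forall>i. \<sigma> ` {k \<in> A. f k = i} = {k \<in> A. f k = i}) \<longleftrightarrow> (\<forall>k\<in>A. f (\<sigma> k) = f k)"
    if \<sigma>: "\<sigma> permutes A" for \<sigma> and A :: "nat set" and f :: "nat \<Rightarrow> nat"
  proof
    assume fib: "\<forall>i. \<sigma> ` {k \<in> A. f k = i} = {k \<in> A. f k = i}"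
    show "\<forall>k\<in>A. f (\<sigma> k) = f k"
    proof
      fix k assume "k \<in> A"
      then have "\<sigma> k \<in> \<sigma> ` {l \<in> A. f l = f k}" by simp
      then show "f (\<sigma> k) = f k" using fib by simp
    qed
  next
    assume f: "\<forall>k\<in>A. f (\<sigma> k) = f k"
    show "\<forall>i. \<sigma> ` {k \<in> A. f k = i} = {k \<in> A. f k = i}"
    proof (intro allI Set.set_eqI iffI)
      fix i k assume "k \<in> \<sigma> ` {k \<in> A. f k = i}"
      then obtain l where "k = \<sigma> l" "l \<in> A" "f l = i" by blast
      then show "k \<in> {k \<in> A. f k = i}" using f permutes_in_image[OF \<sigma>] by simp
    next
      fix i k assume k: "k \<in> {k \<in> A. f k = i}"
      have l: "inv' \<sigma> k \<in> A" using k permutes_in_image[OF permutes_inv[OF \<sigma>]] by simp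
      have "f (inv' \<sigma> k) = i" using f l k permutes_inverses(1)[OF \<sigma>] by force
      then show "k \<in> \<sigma> ` {k \<in> A. f k = i}"
        using l permutes_inverses(1)[OF \<sigma>, of k] by (intro image_eqI[of _ _ "inv' \<sigma> k"]) simp_all
    qed
  qed
  show "row_stabilizer D t = {\<sigma>. \<sigma> permutes {1..card D} \<and> (\<forall>k\<in>{1..card D}. fst (t (\<sigma> k)) = fst (t k))}"
    using *[of _ "{1..card D}" "\<lambda>k. fst (t k)"] unfolding row_stabilizer_def sym_group_carrier by blast
  show "column_stabilizer D t = {\<sigma>. \<sigma> permutes {1..card D} \<and> (\<forall>k\<in>{1..card D}. snd (t (\<sigma> k)) = snd (t k))}"
    using *[of _ "{1..card D}" "\<lambda>k. snd (t k)"] unfolding column_stabilizer_def sym_group_carrier by blast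
qed

text \<open>The row and column stabilizers only see which letters share a row or a column.\<close>

lemma specht_module_cong:
  assumes "card D = card D'"
    and "\<And>k l. k \<in> {1..card D} \<Longrightarrow> l \<in> {1..card D} \<Longrightarrow> fst (t k) = fst (t l) \<longleftrightarrow> fst (t' k) = fst (t' l)"
    and "\<And>k l. k \<in> {1..card D} \<Longrightarrow> l \<in> {1..card D} \<Longrightarrow> snd (t k) = snd (t l) \<longleftrightarrow> snd (t' k) = snd (t' l)"
  shows "specht_module D t = specht_module D' t'"
proof -
  have "row_stabilizer D t = row_stabilizer D' t'"
    unfolding row_stabilizer_eq assms(1)[symmetric]
    by (rule Collect_cong, rule conj_cong[OF refl], rule ball_cong[OF refl], rule assms(2)) (simp_all only: permutes_in_image)
  moreover have "column_stabilizer D t = column_stabilizer D' t'"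
    unfolding column_stabilizer_eq assms(1)[symmetric]
    by (rule Collect_cong, rule conj_cong[OF refl], rule ball_cong[OF refl], rule assms(3)) (simp_all only: permutes_in_image)
  ultimately show ?thesis
    using assms(1) by (simp add: specht_module_def row_symmetrizer_def column_antisymmetrizer_def)
qed

text \<open>An element of the left ideal generated by \<open>R(D)\<close> is constant on the left cosets of the row stabilizer.
So it depends on \<open>\<sigma>\<close> only through the rows of \<open>t \<circ> \<sigma>\<^sup>-\<^sup>1\<close>, that is, it is a function of row words.\<close>

definition specht_map ::
  "nat \<Rightarrow> (nat \<Rightarrow> nat \<times> nat) \<Rightarrow> ((nat \<Rightarrow> nat) \<Rightarrow> complex) \<Rightarrow> (nat \<Rightarrow> nat) \<Rightarrow> complex" where
  "specht_map n t F = (\<lambda>\<sigma>. if \<sigma> permutes {1..n} then F (\<lambda>k. fst (t (inv' \<sigma> k))) else 0)"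

lemma clinear_specht_map: "clinear (specht_map n t)"
  by (auto simp: clinear_iff specht_map_def cscale_def fun_eq_iff)

lemma conv_basis_elem:
  assumes "g permutes {1..n}"
  shows "conv (sym_group n) (basis_elem g) y = (\<lambda>\<sigma>. if \<sigma> permutes {1..n} then y (inv' g \<circ> \<sigma>) else 0)"
proof
  fix \<sigma>
  have "(\<Sum>a | a permutes {1..n}. basis_elem g a * y (inv' a \<circ> \<sigma>))
      = (\<Sum>a | a permutes {1..n}. if a = g then y (inv' a \<circ> \<sigma>) else 0)"
    by (rule sum.cong) (auto simp: basis_elem_def)
  also have "\<dots> = y (inv' g \<circ> \<sigma>)" using assms by (simp add: finite_permutations)
  finally show "conv (sym_group n) (basis_elem g) y \<sigma> = (if \<sigma> permutes {1..n} then y (inv' g \<circ> \<sigma>) else 0)"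
    by (simp only: conv_sym_group)
qed

lemma conv_eq_sum:
  "conv (sym_group n) x y = (\<Sum>a | a permutes {1..n}. cscale (x a) (conv (sym_group n) (basis_elem a) y))"
proof
  fix \<sigma>
  have "(\<Sum>a | a permutes {1..n}. cscale (x a) (conv (sym_group n) (basis_elem a) y)) \<sigma>
      = (\<Sum>a | a permutes {1..n}. if \<sigma> permutes {1..n} then x a * y (inv' a \<circ> \<sigma>) else 0)"
    unfolding sum_apply by (rule sum.cong) (simp_all add: conv_basis_elem cscale_def)
  then show "conv (sym_group n) x y \<sigma>
      = (\<Sum>a | a permutes {1..n}. cscale (x a) (conv (sym_group n) (basis_elem a) y)) \<sigma>"
    by (simp add: conv_sym_group)
qed

lemma specht_map_act:
  assumes g: "g permutes {1..n}"
  shows "specht_map n t (\<lambda>w. F (\<lambda>k. w (g k))) = conv (sym_group n) (basis_elem g) (specht_map n t F)"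
proof
  fix \<sigma>
  show "specht_map n t (\<lambda>w. F (\<lambda>k. w (g k))) \<sigma> = conv (sym_group n) (basis_elem g) (specht_map n t F) \<sigma>"
  proof (cases "\<sigma> permutes {1..n}")
    case True
    have p: "inv' g \<circ> \<sigma> permutes {1..n}" by (rule permutes_compose[OF True permutes_inv[OF g]])
    have "inv' (inv' g \<circ> \<sigma>) = inv' \<sigma> \<circ> g"
      using o_inv_distrib[OF permutes_bij[OF permutes_inv[OF g]] permutes_bij[OF True]]
        permutes_inv_inv[OF g] by simp
    then show ?thesis using True p by (simp add: conv_basis_elem[OF g] specht_map_def)
  qed (simp add: conv_basis_elem[OF g] specht_map_def)
qed

lemma specht_map_eq_0_imp:
  assumes t: "bij_betw t {1..card D} D" and F: "F \<in> word_module D" "specht_map (card D) t F = 0"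
  shows "F = 0"
proof
  fix w
  show "F w = 0 w"
  proof (rule ccontr)
    assume "F w \<noteq> 0 w"
    then have "F w \<noteq> 0" by simp
    then obtain c where "polytabloid D c w \<noteq> 0" by (rule word_module_support[OF F(1)])
    then have bij: "bij_betw (\<lambda>k. (w k, c k)) {1..card D} D" by (rule polytabloid_nonzero_imp_bij)
    obtain \<rho> where \<rho>: "\<rho> permutes {1..card D}" "\<And>k. k \<in> {1..card D} \<Longrightarrow> (w k, c k) = t (\<rho> k)"
      by (rule bij_betw_factor[OF bij t]) blast
    have "w k = fst (t (\<rho> k))" if "k \<in> {1..card D}" for k
      using \<rho>(2)[OF that] by (metis fst_conv)
    then have "F w = F (\<lambda>k. fst (t (\<rho> k)))" by (rule word_module_cong[OF F(1)])
    also have "\<dots> = specht_map (card D) t F (inv' \<rho>)"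
      using permutes_inv[OF \<rho>(1)] permutes_inv_inv[OF \<rho>(1)] by (simp add: specht_map_def)
    also have "\<dots> = 0" using F(2) by simp
    finally show False using \<open>F w \<noteq> 0\<close> by simp
  qed
qed

lemma row_symmetrizer_apply:
  "row_symmetrizer D t \<tau> = (if \<tau> \<in> row_stabilizer D t then 1 else 0)"
proof -
  have "finite (row_stabilizer D t)"
    by (rule finite_subset[OF _ finite_permutations[of "{1..card D}"]]) (auto simp: row_stabilizer_eq)
  then show ?thesis by (simp add: row_symmetrizer_def sum_apply basis_elem_def)
qed

lemma column_antisymmetrizer_apply:
  "column_antisymmetrizer D t \<tau> = (if \<tau> \<in> column_stabilizer D t then of_int (sign \<tau>) else 0)"
proof -
  have fin: "finite (column_stabilizer D t)"
    by (rule finite_subset[OF _ finite_permutations[of "{1..card D}"]]) (auto simp: column_stabilizer_eq)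
  have "column_antisymmetrizer D t \<tau> = (\<Sum>\<sigma>\<in>column_stabilizer D t. if \<tau> = \<sigma> then of_int (sign \<sigma>) else 0)"
    unfolding column_antisymmetrizer_def sum_apply by (rule sum.cong) (simp_all add: basis_elem_def)
  also have "\<dots> = (if \<tau> \<in> column_stabilizer D t then of_int (sign \<tau>) else 0)" by (rule sum.delta'[OF fin])
  finally show ?thesis .
qed

lemma column_stabilizer_inv:
  assumes "\<sigma> \<in> column_stabilizer D t"
  shows "inv' \<sigma> \<in> column_stabilizer D t"
proof -
  have \<sigma>: "\<sigma> permutes {1..card D}" and col: "\<forall>k\<in>{1..card D}. snd (t (\<sigma> k)) = snd (t k)"
    using assms by (simp_all add: column_stabilizer_eq)
  have "snd (t (inv' \<sigma> k)) = snd (t k)" if k: "k \<in> {1..card D}" for k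
  proof -
    have "inv' \<sigma> k \<in> {1..card D}" using k permutes_in_image[OF permutes_inv[OF \<sigma>]] by simp
    then show ?thesis using bspec[OF col, of "inv' \<sigma> k"] permutes_inverses(1)[OF \<sigma>] by simp
  qed
  then show ?thesis using permutes_inv[OF \<sigma>] by (simp add: column_stabilizer_eq)
qed

text \<open>The coefficient of \<open>C(D)R(D)\<close> at \<open>\<sigma>\<close> is the sign of the column permutation \<open>a\<close> with \<open>a\<^sup>-\<^sup>1\<sigma>\<close> a row
permutation, if there is one; it is unique because a box is determined by its row and column. Such an \<open>a\<close>
exists precisely if the rows of \<open>t \<circ> \<sigma>\<^sup>-\<^sup>1\<close> and the columns of \<open>t\<close> together enumerate \<open>D\<close>.\<close>

lemma young_symmetrizer_eq:
  assumes t: "bij_betw t {1..card D} D"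
  obtains z where "z \<noteq> 0"
    "conv (sym_group (card D)) (column_antisymmetrizer D t) (row_symmetrizer D t)
       = cscale z (specht_map (card D) t (polytabloid D (\<lambda>k. snd (t k))))"
proof -
  let ?n = "card D"
  let ?z = "1 / orientation D t"
  have nz: "orientation D t \<noteq> 0" using t by (simp only: orientation_eq_0_iff not_not)
  have "conv (sym_group ?n) (column_antisymmetrizer D t) (row_symmetrizer D t) \<sigma>
       = ?z * specht_map ?n t (polytabloid D (\<lambda>k. snd (t k))) \<sigma>" for \<sigma>
  proof (cases "\<sigma> permutes {1..?n}")
    case False
    then show ?thesis by (simp add: conv_sym_group specht_map_def)
  next
    case \<sigma>: True
    \<comment> \<open>The map whose orientation is the value of the polytabloid. A column permutation \<open>a\<close> with a
      nonzero term in the coefficient turns it into a rearrangement of \<open>t\<close>.\<close>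
    let ?p = "\<lambda>k. (fst (t (inv' \<sigma> k)), snd (t k))"
    let ?f = "\<lambda>a. column_antisymmetrizer D t a * row_symmetrizer D t (inv' a \<circ> \<sigma>)"
    have p: "?p k = t (inv' a k)"
      if a: "a \<in> column_stabilizer D t" "inv' a \<circ> \<sigma> \<in> row_stabilizer D t" and k: "k \<in> {1..?n}" for a k
    proof -
      have ap: "a permutes {1..?n}" using a(1) by (simp add: column_stabilizer_eq)
      let ?l = "inv' \<sigma> k"
      have "?l \<in> {1..?n}" using k permutes_in_image[OF permutes_inv[OF \<sigma>]] by simp
      then have "fst (t ((inv' a \<circ> \<sigma>) ?l)) = fst (t ?l)" using a(2) unfolding row_stabilizer_eq by simp
      then have "fst (t (inv' a k)) = fst (t ?l)" using permutes_inverses(1)[OF \<sigma>] by simp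
      moreover have "snd (t (inv' a k)) = snd (t k)"
        using column_stabilizer_inv[OF a(1)] k unfolding column_stabilizer_eq by simp
      ultimately show ?thesis by (simp add: prod_eq_iff)
    qed
    have "(\<Sum>a | a permutes {1..?n}. ?f a) = ?z * orientation D ?p"
    proof (cases "\<exists>a. a \<in> column_stabilizer D t \<and> inv' a \<circ> \<sigma> \<in> row_stabilizer D t")
      case True
      then obtain a where a: "a \<in> column_stabilizer D t" "inv' a \<circ> \<sigma> \<in> row_stabilizer D t" by blast
      have ap: "a permutes {1..?n}" using a(1) by (simp add: column_stabilizer_eq)
      have unique: "b = a" if b: "b permutes {1..?n}" "?f b \<noteq> 0" for b
      proof -
        have b': "b \<in> column_stabilizer D t" "inv' b \<circ> \<sigma> \<in> row_stabilizer D t"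
          using b(2) by (auto simp: column_antisymmetrizer_apply row_symmetrizer_apply split: if_splits)
        have "inv' b k = inv' a k" for k
        proof (cases "k \<in> {1..?n}")
          case k: True
          have "t (inv' b k) = t (inv' a k)" using p[OF a k] p[OF b' k] by simp
          moreover have "inv' b k \<in> {1..?n}" "inv' a k \<in> {1..?n}"
            using k permutes_in_image[OF permutes_inv[OF b(1)]] permutes_in_image[OF permutes_inv[OF ap]]
            by simp_all
          ultimately show ?thesis using inj_onD[OF bij_betw_imp_inj_on[OF t]] by simp
        next
          case False
          then show ?thesis
            using permutes_not_in[OF permutes_inv[OF b(1)]] permutes_not_in[OF permutes_inv[OF ap]] by simp
        qed
        then have "inv' b = inv' a" by (rule ext)
        then have "inv' (inv' b) = inv' (inv' a)" by (rule arg_cong)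
        then show ?thesis using permutes_inv_inv[OF b(1)] permutes_inv_inv[OF ap] by simp
      qed
      have "(\<Sum>b | b permutes {1..?n}. ?f b) = (\<Sum>b\<in>{a}. ?f b)"
      proof (rule sum.mono_neutral_right)
        show "finite {b. b permutes {1..?n}}" by (rule finite_permutations) simp
        show "{a} \<subseteq> {b. b permutes {1..?n}}" using ap by simp
        show "\<forall>b\<in>{b. b permutes {1..?n}} - {a}. ?f b = 0" using unique by blast
      qed
      also have "\<dots> = of_int (sign a)"
        using a by (simp add: column_antisymmetrizer_apply row_symmetrizer_apply)
      also have "\<dots> = ?z * orientation D (\<lambda>k. t (inv' a k))"
      proof -
        have "permutation a" using ap permutation_permutes finite_atLeastAtMost by blast
        then show ?thesis using nz orientation_permute[OF permutes_inv[OF ap], of t] by (simp add: sign_inverse)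
      qed
      also have "orientation D (\<lambda>k. t (inv' a k)) = orientation D ?p"
        by (rule orientation_cong) (rule p[OF a, symmetric])
      finally show ?thesis .
    next
      case False
      then have "?f a = 0" for a
        by (simp add: column_antisymmetrizer_apply row_symmetrizer_apply)
      moreover have "orientation D ?p = 0"
      proof (rule ccontr)
        assume "orientation D ?p \<noteq> 0"
        then have bij: "bij_betw ?p {1..?n} D" by (simp only: orientation_eq_0_iff not_not)
        obtain \<rho> where \<rho>: "\<rho> permutes {1..?n}" "\<And>k. k \<in> {1..?n} \<Longrightarrow> ?p k = t (\<rho> k)"
          by (rule bij_betw_factor[OF bij t]) blast
        have "\<rho> \<in> column_stabilizer D t"
          unfolding column_stabilizer_eq using \<rho>(1) \<rho>(2)[THEN arg_cong[where f = snd]] by simp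
        moreover have "\<rho> \<circ> \<sigma> \<in> row_stabilizer D t"
        proof -
          have "fst (t (\<rho> (\<sigma> k))) = fst (t k)" if "k \<in> {1..?n}" for k
            using \<rho>(2)[of "\<sigma> k", THEN arg_cong[where f = fst]] that permutes_in_image[OF \<sigma>]
              permutes_inverses(2)[OF \<sigma>] by simp
          then show ?thesis
            unfolding row_stabilizer_eq using permutes_compose[OF \<sigma> \<rho>(1)] by simp
        qed
        ultimately show False
          using False column_stabilizer_inv[of \<rho> D t] permutes_inv_inv[OF \<rho>(1)] by metis
      qed
      ultimately show ?thesis by (simp only: sum.neutral_const mult_zero_right)
    qed
    then show ?thesis using \<sigma> by (simp add: conv_sym_group specht_map_def polytabloid_def)
  qed
  then have "conv (sym_group ?n) (column_antisymmetrizer D t) (row_symmetrizer D t)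
       = cscale ?z (specht_map ?n t (polytabloid D (\<lambda>k. snd (t k))))"
    by (simp add: fun_eq_iff cscale_def)
  then show ?thesis using that[of ?z] nz by simp
qed

text \<open>Both sides are spanned by the translates of one element: every nonzero polytabloid is, up to sign, a
translate of the polytabloid of the columns of \<open>t\<close>, which corresponds to \<open>C(D)R(D)\<close>.\<close>

lemma specht_map_image:
  assumes t: "bij_betw t {1..card D} D"
  shows "specht_map (card D) t ` word_module D = space (specht_module D t)"
proof -
  let ?n = "card D"
  let ?S = "sym_group ?n" and ?\<Theta> = "specht_map ?n t"
  define E where "E = conv ?S (column_antisymmetrizer D t) (row_symmetrizer D t)"
  define u where "u = polytabloid D (\<lambda>k. snd (t k))"
  obtain z where z: "z \<noteq> 0" "E = cscale z (?\<Theta> u)"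
    unfolding E_def u_def by (rule young_symmetrizer_eq[OF t])
  have u: "u \<in> word_module D" by (simp add: u_def polytabloid_in_word_module)
  interpret \<Theta>: Vector_Spaces.linear cscale cscale ?\<Theta> by (rule clinear_specht_map)
  let ?V = "?\<Theta> ` word_module D"
  have V: "cfun.subspace ?V" by (rule \<Theta>.subspace_image[OF subspace_word_module])
  have lin: "clinear (\<lambda>x. conv ?S x y)" for y
    by (auto simp: clinear_iff conv_sym_group fun_eq_iff cscale_def sum_distrib_left sum.distrib distrib_right mult.assoc)
  have shift: "conv ?S (basis_elem a) E = cscale z (?\<Theta> (\<lambda>w. u (\<lambda>k. w (a k))))" if "a permutes {1..?n}" for a
    unfolding specht_map_act[OF that] z(2) by (auto simp: conv_basis_elem[OF that] cscale_def)
  have space: "space (specht_module D t) = (\<lambda>x. conv ?S x E) ` group_algebra ?S"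
    unfolding specht_module_def Let_def E_def by auto
  show ?thesis
    unfolding space
  proof
    show "(\<lambda>x. conv ?S x E) ` group_algebra ?S \<subseteq> ?V"
    proof (rule image_subsetI)
      fix x
      show "conv ?S x E \<in> ?V"
        unfolding conv_eq_sum[of ?n x]
      proof (rule cfun.subspace_sum[OF V], rule cfun.subspace_scale[OF V])
        fix a assume "a \<in> {a. a permutes {1..?n}}"
        then have a: "a permutes {1..?n}" by simp
        show "conv ?S (basis_elem a) E \<in> ?V"
          unfolding shift[OF a] by (intro cfun.subspace_scale[OF V] imageI word_module_act[OF a u])
      qed
    qed
    have W: "cfun.subspace ((\<lambda>x. conv ?S x E) ` group_algebra ?S)"
      by (rule cfun_pair.linear_subspace_image[OF lin])
         (auto simp: cfun.subspace_def group_algebra_def cscale_def)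
    have "?\<Theta> (polytabloid D c) \<in> (\<lambda>x. conv ?S x E) ` group_algebra ?S" for c
    proof (cases "polytabloid D c = 0")
      case True
      then show ?thesis using cfun.subspace_0[OF W] \<Theta>.zero by simp
    next
      case False
      then obtain w where "polytabloid D c w \<noteq> 0" by (auto simp: fun_eq_iff)
      then have bij: "bij_betw (\<lambda>k. (w k, c k)) {1..?n} D" by (rule polytabloid_nonzero_imp_bij)
      obtain \<rho> where \<rho>: "\<rho> permutes {1..?n}" "\<And>k. k \<in> {1..?n} \<Longrightarrow> (w k, c k) = t (\<rho> k)"
        by (rule bij_betw_factor[OF bij t]) blast
      let ?a = "inv' \<rho>"
      let ?s = "of_int (sign ?a) :: complex"
      have a: "?a permutes {1..?n}" by (rule permutes_inv[OF \<rho>(1)])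
      have s: "?s * ?s = 1" by (simp flip: of_int_mult)
      have "polytabloid D c = polytabloid D (\<lambda>k. snd (t (\<rho> k)))"
        by (rule ext, rule polytabloid_cong) (use \<rho>(2)[THEN arg_cong[where f = snd]] in simp_all)
      also have "\<dots> = cscale ?s (\<lambda>v. u (\<lambda>k. v (?a k)))"
        unfolding u_def polytabloid_act[OF a] permutes_inv_inv[OF \<rho>(1)]
        using s by (simp add: cscale_def mult.assoc[symmetric])
      finally have "?\<Theta> (polytabloid D c) = cscale ?s (?\<Theta> (\<lambda>v. u (\<lambda>k. v (?a k))))"
        by (simp only: \<Theta>.scale)
      also have "\<dots> = cscale (?s / z) (conv ?S (basis_elem ?a) E)"
        unfolding shift[OF a] using z(1) by (simp add: cscale_def)
      also have "\<dots> \<in> (\<lambda>x. conv ?S x E) ` group_algebra ?S"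
        by (intro cfun.subspace_scale[OF W] imageI)
           (use a in \<open>auto simp: group_algebra_def basis_elem_def sym_group_carrier\<close>)
      finally show ?thesis .
    qed
    then show "?V \<subseteq> (\<lambda>x. conv ?S x E) ` group_algebra ?S"
      unfolding word_module_def \<Theta>.span_image[symmetric]
      by (intro cfun.span_minimal[OF _ W]) auto
  qed
qed

lemma word_rep_specht_module:
  assumes t: "bij_betw t {1..card D} D"
  shows "rep_isomorphic (carrier (sym_group (card D))) (word_rep D) (specht_module D t)"
proof -
  let ?\<Theta> = "specht_map (card D) t"
  interpret \<Theta>: Vector_Spaces.linear cscale cscale ?\<Theta> by (rule clinear_specht_map)
  have "inj_on ?\<Theta> (word_module D)"
    unfolding \<Theta>.inj_on_iff_eq_0[OF subspace_word_module] using specht_map_eq_0_imp[OF t] by blast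
  then have "bij_betw ?\<Theta> (space (word_rep D)) (space (specht_module D t))"
    unfolding bij_betw_def specht_map_image[OF t, symmetric] by (simp add: word_rep_def)
  then show ?thesis
    unfolding rep_isomorphic_def
    by (intro exI[of _ ?\<Theta>])
       (simp add: word_rep_def specht_module_def Let_def \<Theta>.add \<Theta>.scale specht_map_act sym_group_carrier,
        simp add: cscale_def)
qed

section \<open>Diagrams of graphs\<close>

text \<open>An end of a longest path has a second neighbour, which lies on the path by maximality.\<close>

lemma ex_closed_walk:
  fixes R :: "'a \<Rightarrow> 'a \<Rightarrow> bool"
  assumes A: "finite A" and R: "\<And>x y. R x y \<Longrightarrow> x \<in> A \<and> y \<in> A \<and> x \<noteq> y \<and> R y x"
    and deg: "\<And>x y. R x y \<Longrightarrow> \<exists>z. z \<noteq> y \<and> R x z" and start: "R x0 y0"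
  shows "\<exists>p. length p \<ge> 3 \<and> distinct p \<and> (\<forall>i<length p. R (p ! i) (p ! (Suc i mod length p)))"
proof -
  define path where "path p \<longleftrightarrow> distinct p \<and> length p \<ge> 2 \<and> (\<forall>i. Suc i < length p \<longrightarrow> R (p ! i) (p ! Suc i))" for p
  have sub: "set p \<subseteq> A" if "path p" for p
  proof
    fix v assume "v \<in> set p"
    then obtain i where i: "i < length p" "v = p ! i" by (metis in_set_conv_nth)
    show "v \<in> A"
    proof (cases "Suc i < length p")
      case True
      then have "R (p ! i) (p ! Suc i)" using that unfolding path_def by blast
      then show ?thesis using R i(2) by blast
    next
      case False
      then have "i = Suc (i - 1)" "Suc (i - 1) < length p" using i(1) that unfolding path_def by linarith+
      then have "R (p ! (i - 1)) (p ! i)" using that unfolding path_def by metis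
      then show ?thesis using R i(2) by blast
    qed
  qed
  have bound: "length p \<le> card A" if "path p" for p
    using card_mono[OF A sub[OF that]] that distinct_card[of p] unfolding path_def by simp
  have "path [x0, y0]" using start R by (auto simp: path_def)
  moreover have "\<forall>p. path p \<longrightarrow> length p < Suc (card A)" using bound by (simp add: less_Suc_eq_le)
  ultimately have "\<exists>p. path p \<and> (\<forall>q. path q \<longrightarrow> length q \<le> length p)"
    by (rule ex_has_greatest_nat)
  then obtain p where p: "path p" "\<And>q. path q \<Longrightarrow> length q \<le> length p" by blast
  have len: "length p \<ge> 2" and dist: "distinct p"
    and edge: "\<And>i. Suc i < length p \<Longrightarrow> R (p ! i) (p ! Suc i)"
    using p(1) unfolding path_def by blast+
  have "R (p ! 0) (p ! Suc 0)" using edge[of 0] len by simp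
  then obtain z where z: "z \<noteq> p ! Suc 0" "R (p ! 0) z" using deg by blast
  have "z \<in> set p"
  proof (rule ccontr)
    assume "z \<notin> set p"
    moreover have "R ((z # p) ! i) ((z # p) ! Suc i)" if "Suc i < length (z # p)" for i
      using that z(2) R edge by (cases i) simp_all
    ultimately have "path (z # p)" using len dist unfolding path_def by simp
    then show False using p(2)[of "z # p"] by simp
  qed
  then obtain k where k: "k < length p" "z = p ! k" by (metis in_set_conv_nth)
  have "z \<noteq> p ! 0" using R z(2) by blast
  then have k2: "k \<ge> 2" using k(2) z(1) by (cases k; cases "k - 1") auto
  let ?q = "take (Suc k) p"
  have lenq: "length ?q = Suc k" using k(1) by simp
  have "R (?q ! i) (?q ! (Suc i mod length ?q))" if "i < length ?q" for i
  proof (cases "i = k")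
    case True
    then show ?thesis using z(2) R k by (simp add: lenq)
  next
    case False
    then have "i < k" using that lenq by simp
    then show ?thesis using edge[of i] k(1) by (simp add: lenq)
  qed
  then show ?thesis using lenq k2 dist by (intro exI[of _ ?q]) (simp add: distinct_take)
qed

lemma graph_diagram_iff:
  "(i, j) \<in> graph_diagram G \<nu> \<longleftrightarrow>
     (\<exists>u v. u \<in> whites G \<and> v \<in> blacks G \<and> {u, v} \<in> edges G \<and> i = \<nu> u \<and> j = \<nu> v)"
  by (auto simp: graph_diagram_def)

lemma numbering_inj:
  assumes "numbering G \<nu>"
  shows "u \<in> whites G \<Longrightarrow> u' \<in> whites G \<Longrightarrow> \<nu> u = \<nu> u' \<longleftrightarrow> u = u'"
    and "v \<in> blacks G \<Longrightarrow> v' \<in> blacks G \<Longrightarrow> \<nu> v = \<nu> v' \<longleftrightarrow> v = v'"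
proof -
  have "inj_on \<nu> (whites G)" "inj_on \<nu> (blacks G)" using assms by (simp_all add: numbering_def)
  then show "u \<in> whites G \<Longrightarrow> u' \<in> whites G \<Longrightarrow> \<nu> u = \<nu> u' \<longleftrightarrow> u = u'"
    "v \<in> blacks G \<Longrightarrow> v' \<in> blacks G \<Longrightarrow> \<nu> v = \<nu> v' \<longleftrightarrow> v = v'"
    by (simp_all add: inj_on_eq_iff)
qed

lemma graph_diagram_mem:
  assumes "numbering G \<nu>" "u \<in> whites G" "v \<in> blacks G"
  shows "(\<nu> u, \<nu> v) \<in> graph_diagram G \<nu> \<longleftrightarrow> {u, v} \<in> edges G"
proof
  assume "(\<nu> u, \<nu> v) \<in> graph_diagram G \<nu>"
  then obtain u' v' where "u' \<in> whites G" "v' \<in> blacks G" "{u', v'} \<in> edges G" "\<nu> u = \<nu> u'" "\<nu> v = \<nu> v'"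
    unfolding graph_diagram_iff by (elim exE conjE)
  then show "{u, v} \<in> edges G" using numbering_inj[OF assms(1)] assms(2,3) by metis
qed (use assms graph_diagram_iff in blast)

lemma forest_relation_graph_diagram:
  assumes G: "bipartitioned_graph G" "acyclic_graph G" and \<nu>: "numbering G \<nu>"
  shows "forest_relation (graph_diagram G \<nu>)"
proof (rule forest_relationI, rule ccontr)
  fix D' assume D': "D' \<subseteq> graph_diagram G \<nu>" "D' \<noteq> {}" and no_leaf: "\<nexists>i j. leaf_box D' i j"
  define R where "R x y \<longleftrightarrow> (x \<in> whites G \<and> y \<in> blacks G \<and> (\<nu> x, \<nu> y) \<in> D') \<or>
      (x \<in> blacks G \<and> y \<in> whites G \<and> (\<nu> y, \<nu> x) \<in> D')" for x y
  have disj: "whites G \<inter> blacks G = {}" and fin: "finite (whites G \<union> blacks G)"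
    using G(1) by (simp_all add: bipartitioned_graph_def)
  have vertices: "\<exists>u v. u \<in> whites G \<and> v \<in> blacks G \<and> i = \<nu> u \<and> j = \<nu> v" if "(i, j) \<in> D'" for i j
    using D'(1) that graph_diagram_iff[of i j G \<nu>] by blast
  have edge: "{x, y} \<in> edges G" if "R x y" for x y
    using that D'(1) graph_diagram_mem[OF \<nu>, of x y] graph_diagram_mem[OF \<nu>, of y x]
    unfolding R_def by (auto simp: insert_commute)
  obtain i0 j0 where ij0: "(i0, j0) \<in> D'" using D'(2) by (metis equals0I surj_pair)
  then obtain x0 y0 where start: "R x0 y0" using vertices[OF ij0] unfolding R_def by blast
  have deg: "\<exists>z. z \<noteq> y \<and> R x z" if xy: "R x y" for x y
  proof -
    consider "x \<in> whites G" "y \<in> blacks G" "(\<nu> x, \<nu> y) \<in> D'" | "x \<in> blacks G" "y \<in> whites G" "(\<nu> y, \<nu> x) \<in> D'"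
      using xy unfolding R_def by blast
    then show ?thesis
    proof cases
      case 1
      then obtain j where j: "(\<nu> x, j) \<in> D'" "j \<noteq> \<nu> y" using no_leaf unfolding leaf_box_def by blast
      obtain v where "v \<in> blacks G" "j = \<nu> v" using vertices[OF j(1)] by blast
      then show ?thesis using 1(1) j unfolding R_def by (intro exI[of _ v]) auto
    next
      case 2
      then obtain i where i: "(i, \<nu> x) \<in> D'" "i \<noteq> \<nu> y" using no_leaf unfolding leaf_box_def by blast
      obtain u where "u \<in> whites G" "i = \<nu> u" using vertices[OF i(1)] by blast
      then show ?thesis using 2(1) i unfolding R_def by (intro exI[of _ u]) auto
    qed
  qed
  have symm: "x \<in> whites G \<union> blacks G \<and> y \<in> whites G \<union> blacks G \<and> x \<noteq> y \<and> R y x" if "R x y" for x y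
    using that disj unfolding R_def by blast
  have "\<exists>p. length p \<ge> 3 \<and> distinct p \<and> (\<forall>i<length p. R (p ! i) (p ! (Suc i mod length p)))"
    by (rule ex_closed_walk[where R = R, OF fin _ _ start]) (erule symm, erule deg)
  then obtain p where p: "length p \<ge> 3" "distinct p" "\<forall>i<length p. R (p ! i) (p ! (Suc i mod length p))"
    by (elim exE conjE)
  then have "is_cycle G p" using edge unfolding is_cycle_def by simp
  then show False using G(2) unfolding acyclic_graph_def by blast
qed

definition box_of :: "'v bigraph \<Rightarrow> ('v \<Rightarrow> nat) \<Rightarrow> 'v set \<Rightarrow> nat \<times> nat" where
  "box_of G \<nu> e = (\<nu> (THE u. u \<in> whites G \<and> u \<in> e), \<nu> (THE v. v \<in> blacks G \<and> v \<in> e))"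

lemma box_of_edge:
  assumes "bipartitioned_graph G" "u \<in> whites G" "v \<in> blacks G"
  shows "box_of G \<nu> {u, v} = (\<nu> u, \<nu> v)"
proof -
  have "whites G \<inter> blacks G = {}" using assms(1) by (simp add: bipartitioned_graph_def)
  then have "(THE x. x \<in> whites G \<and> x \<in> {u, v}) = u" "(THE x. x \<in> blacks G \<and> x \<in> {u, v}) = v"
    using assms(2,3) by (auto intro!: the_equality)
  then show ?thesis by (simp add: box_of_def)
qed

lemma edge_vertices:
  assumes "bipartitioned_graph G" "e \<in> edges G"
  obtains u v where "u \<in> whites G" "v \<in> blacks G" "e = {u, v}"
  using assms unfolding bipartitioned_graph_def by blast

lemma inj_on_box_of:
  assumes G: "bipartitioned_graph G" and \<nu>: "numbering G \<nu>"
  shows "inj_on (box_of G \<nu>) (edges G)"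
proof (rule inj_onI)
  fix e f assume e: "e \<in> edges G" and f: "f \<in> edges G" and eq: "box_of G \<nu> e = box_of G \<nu> f"
  obtain u v where uv: "u \<in> whites G" "v \<in> blacks G" "e = {u, v}" by (rule edge_vertices[OF G e])
  obtain u' v' where uv': "u' \<in> whites G" "v' \<in> blacks G" "f = {u', v'}" by (rule edge_vertices[OF G f])
  show "e = f"
    using eq numbering_inj[OF \<nu>] uv(1,2) uv'(1,2) unfolding uv(3) uv'(3) by (simp add: box_of_edge[OF G])
qed

lemma graph_diagram_delete_edge:
  assumes G: "bipartitioned_graph G" and \<nu>: "numbering G \<nu>" and e: "e \<in> edges G"
  shows "graph_diagram (delete_edge G e) \<nu> = graph_diagram G \<nu> - {box_of G \<nu> e}"
proof -
  obtain u v where uv: "u \<in> whites G" "v \<in> blacks G" "e = {u, v}" by (rule edge_vertices[OF G e])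
  have box: "box_of G \<nu> e = (\<nu> u, \<nu> v)" unfolding uv(3) by (rule box_of_edge[OF G uv(1,2)])
  have disj: "whites G \<inter> blacks G = {}" using G by (simp add: bipartitioned_graph_def)
  have "(i, j) \<in> graph_diagram (delete_edge G e) \<nu> \<longleftrightarrow> (i, j) \<in> graph_diagram G \<nu> \<and> (i, j) \<noteq> (\<nu> u, \<nu> v)" for i j
  proof
    assume "(i, j) \<in> graph_diagram (delete_edge G e) \<nu>"
    then obtain x y where xy: "x \<in> whites G" "y \<in> blacks G" "{x, y} \<in> edges G" "{x, y} \<noteq> e" "i = \<nu> x" "j = \<nu> y"
      unfolding graph_diagram_iff delete_edge_def by auto
    moreover have "(i, j) \<noteq> (\<nu> u, \<nu> v)"
      using xy(4) numbering_inj[OF \<nu>] xy(1,2) uv(1,2) unfolding xy(5,6) uv(3) by auto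
    ultimately show "(i, j) \<in> graph_diagram G \<nu> \<and> (i, j) \<noteq> (\<nu> u, \<nu> v)"
      unfolding graph_diagram_iff by blast
  next
    assume ij: "(i, j) \<in> graph_diagram G \<nu> \<and> (i, j) \<noteq> (\<nu> u, \<nu> v)"
    then obtain x y where xy: "x \<in> whites G" "y \<in> blacks G" "{x, y} \<in> edges G" "i = \<nu> x" "j = \<nu> y"
      unfolding graph_diagram_iff by blast
    have "{x, y} \<noteq> e"
      using ij xy disj uv(1,2) unfolding uv(3) by (auto simp: doubleton_eq_iff)
    then show "(i, j) \<in> graph_diagram (delete_edge G e) \<nu>"
      unfolding graph_diagram_iff using xy by (intro exI[of _ x] exI[of _ y]) (auto simp: delete_edge_def)
  qed
  then show ?thesis unfolding box by (intro Set.set_eqI) (simp add: split_paired_all)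
qed

lemma degree_1_edge_unique:
  assumes G: "bipartitioned_graph G" and "degree G x = 1" "e \<in> edges G" "x \<in> e" "f \<in> edges G" "x \<in> f"
  shows "e = f"
proof -
  have "card {e \<in> edges G. x \<in> e} = 1" using assms(2) by (simp add: degree_def)
  then obtain h where "{e \<in> edges G. x \<in> e} = {h}" by (rule card_1_singletonE)
  then have "e = h" "f = h" using assms(3-6) by blast+
  then show ?thesis by simp
qed

lemma saturating_almost_perfect_matching:
  assumes G: "bipartitioned_graph G" and \<nu>: "numbering G \<nu>" and M: "almost_perfect_matching G M"
  shows "saturating (graph_diagram G \<nu>) (box_of G \<nu> ` M)"
proof -
  let ?B = "box_of G \<nu> ` M" and ?D = "graph_diagram G \<nu>"
  have M_edges: "M \<subseteq> edges G" and disj: "\<And>e f. e \<in> M \<Longrightarrow> f \<in> M \<Longrightarrow> e \<noteq> f \<Longrightarrow> e \<inter> f = {}"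
    and iso: "\<And>e. isolated_edge G e \<Longrightarrow> e \<in> M"
    and cover: "\<And>x. x \<in> whites G \<union> blacks G \<Longrightarrow> \<not> leaf G x \<Longrightarrow> \<exists>e\<in>M. x \<in> e"
    using M unfolding almost_perfect_matching_def matching_def by blast+
  have wb: "whites G \<inter> blacks G = {}" using G by (simp add: bipartitioned_graph_def)
  have box: "(\<nu> u, \<nu> v) \<in> ?B \<longleftrightarrow> {u, v} \<in> M" if uv: "u \<in> whites G" "v \<in> blacks G" for u v
  proof
    assume "(\<nu> u, \<nu> v) \<in> ?B"
    then obtain e where e: "(\<nu> u, \<nu> v) = box_of G \<nu> e" "e \<in> M" by (rule imageE)
    obtain u' v' where uv': "u' \<in> whites G" "v' \<in> blacks G" "e = {u', v'}"
      by (rule edge_vertices[OF G]) (use e(2) M_edges in blast)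
    have "u = u'" "v = v'"
      using e(1) numbering_inj[OF \<nu>] uv uv'(1,2) unfolding uv'(3) box_of_edge[OF G uv'(1,2)] by simp_all
    then show "{u, v} \<in> M" using e(2) uv'(3) by simp
  next
    assume "{u, v} \<in> M"
    then show "(\<nu> u, \<nu> v) \<in> ?B" using box_of_edge[OF G uv, of \<nu>] by (metis image_eqI)
  qed
  have white: "\<nu> u \<in> Domain (?B)" if u: "u \<in> whites G" "u \<in> e" "e \<in> M" for u e
  proof -
    obtain u' v where uv: "u' \<in> whites G" "v \<in> blacks G" "e = {u', v}"
      by (rule edge_vertices[OF G]) (use u(3) M_edges in blast)
    then have "u = u'" using u(1,2) wb by blast
    then have "(\<nu> u, \<nu> v) \<in> ?B" using box[OF u(1) uv(2)] uv(3) u(3) by simp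
    then show ?thesis by (rule DomainI)
  qed
  have black: "\<nu> v \<in> Range (?B)" if v: "v \<in> blacks G" "v \<in> e" "e \<in> M" for v e
  proof -
    obtain u v' where uv: "u \<in> whites G" "v' \<in> blacks G" "e = {u, v'}"
      by (rule edge_vertices[OF G]) (use v(3) M_edges in blast)
    then have "v = v'" using v(1,2) wb by blast
    then have "(\<nu> u, \<nu> v) \<in> ?B" using box[OF uv(1) v(1)] uv(3) v(3) by simp
    then show ?thesis by (rule RangeI)
  qed
  have leaf_white: "degree G u = 1" if "u \<in> whites G" "\<nu> u \<notin> Domain (?B)" for u
    using cover[of u] white[of u] that unfolding leaf_def by blast
  have leaf_black: "degree G v = 1" if "v \<in> blacks G" "\<nu> v \<notin> Range (?B)" for v
    using cover[of v] black[of v] that unfolding leaf_def by blast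
  have in_M: "\<exists>u v. u \<in> whites G \<and> v \<in> blacks G \<and> {u, v} \<in> M \<and> b = (\<nu> u, \<nu> v)" if b: "b \<in> ?B" for b
  proof -
    obtain e where e: "b = box_of G \<nu> e" "e \<in> M" using b by (rule imageE)
    obtain u v where uv: "u \<in> whites G" "v \<in> blacks G" "e = {u, v}"
      by (rule edge_vertices[OF G]) (use e(2) M_edges in blast)
    then show ?thesis using e box_of_edge[OF G uv(1,2), of \<nu>] by blast
  qed
  show ?thesis
  proof (rule saturatingI)
    show "?B \<subseteq> ?D"
    proof
      fix b assume "b \<in> ?B"
      then obtain u v where "u \<in> whites G" "v \<in> blacks G" "{u, v} \<in> M" "b = (\<nu> u, \<nu> v)"
        using in_M by metis
      then show "b \<in> ?D" using graph_diagram_mem[OF \<nu>] M_edges by blast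
    qed
    show "partial_transversal (?B)"
    proof -
      have "b = b'" if b: "b \<in> ?B" "b' \<in> ?B" "fst b = fst b' \<or> snd b = snd b'" for b b'
      proof -
        obtain u v where uv: "u \<in> whites G" "v \<in> blacks G" "{u, v} \<in> M" "b = (\<nu> u, \<nu> v)"
          using in_M[OF b(1)] by (elim exE conjE)
        obtain u' v' where uv': "u' \<in> whites G" "v' \<in> blacks G" "{u', v'} \<in> M" "b' = (\<nu> u', \<nu> v')"
          using in_M[OF b(2)] by (elim exE conjE)
        have "u = u' \<or> v = v'" using b(3) numbering_inj[OF \<nu>] uv(1,2) uv'(1,2) unfolding uv(4) uv'(4) by simp
        then have "{u, v} = {u', v'}" using disj[OF uv(3) uv'(3)] by blast
        then show ?thesis using box_of_edge[OF G, of _ _ \<nu>] uv(1,2,4) uv'(1,2,4) by metis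
      qed
      then show ?thesis unfolding partial_transversal_def inj_on_def by blast
    qed
    fix i j assume "(i, j) \<in> ?D"
    then obtain u v where uv: "u \<in> whites G" "v \<in> blacks G" "{u, v} \<in> edges G" "i = \<nu> u" "j = \<nu> v"
      unfolding graph_diagram_iff by (elim exE conjE)
    show "j' = j" if j': "(i, j') \<in> ?D" "i \<notin> Domain (?B)" for j'
    proof -
      obtain u' v' where uv': "u' \<in> whites G" "v' \<in> blacks G" "{u', v'} \<in> edges G" "i = \<nu> u'" "j' = \<nu> v'"
        using j'(1) unfolding graph_diagram_iff by (elim exE conjE)
      have "u = u'" using numbering_inj(1)[OF \<nu> uv(1) uv'(1)] uv(4) uv'(4) by simp
      then have "{u, v} = {u, v'}"
        using degree_1_edge_unique[OF G leaf_white[OF uv(1)] uv(3) _ uv'(3)] j'(2) uv(4) by simp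
      then show ?thesis using uv(5) uv'(5) by (auto simp: doubleton_eq_iff)
    qed
    show "i' = i" if i': "(i', j) \<in> ?D" "j \<notin> Range (?B)" for i'
    proof -
      obtain u' v' where uv': "u' \<in> whites G" "v' \<in> blacks G" "{u', v'} \<in> edges G" "i' = \<nu> u'" "j = \<nu> v'"
        using i'(1) unfolding graph_diagram_iff by (elim exE conjE)
      have "v = v'" using numbering_inj(2)[OF \<nu> uv(2) uv'(2)] uv(5) uv'(5) by simp
      then have "{u, v} = {u', v}"
        using degree_1_edge_unique[OF G leaf_black[OF uv(2)] uv(3) _ uv'(3)] i'(2) uv(5) by simp
      then show ?thesis using uv(4) uv'(4) by (auto simp: doubleton_eq_iff)
    qed
    show "i \<in> Domain (?B) \<or> j \<in> Range (?B)"
    proof (rule ccontr)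
      assume "\<not> ?thesis"
      then have u: "degree G u = 1" and v: "degree G v = 1" and notM: "{u, v} \<notin> M"
        using leaf_white[OF uv(1)] leaf_black[OF uv(2)] box[OF uv(1,2)] uv(4,5) by blast+
      have "f \<inter> {u, v} = {}" if f: "f \<in> edges G" "f \<noteq> {u, v}" for f
        using degree_1_edge_unique[OF G u uv(3) _ f(1)] degree_1_edge_unique[OF G v uv(3) _ f(1)] f(2) by blast
      then have "isolated_edge G {u, v}" using uv(3) unfolding isolated_edge_def by blast
      then show False using iso notM by blast
    qed
  qed
qed

text \<open>The ordering of the boxes is carried along with the numbering, so that the same letters share a row or
a column as before; then the module is literally the same.\<close>

lemma specht_module_renumber:
  assumes \<nu>: "numbering G \<nu>" and \<nu>': "numbering G \<nu>'" and t': "box_ordering (graph_diagram G \<nu>') t'"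
  obtains t where "box_ordering (graph_diagram G \<nu>) t"
    "specht_module (graph_diagram G \<nu>) t = specht_module (graph_diagram G \<nu>') t'"
proof -
  let ?D = "graph_diagram G \<nu>" and ?D' = "graph_diagram G \<nu>'"
  define r where "r = (\<lambda>(i, j). (\<nu> (inv_into (whites G) \<nu>' i), \<nu> (inv_into (blacks G) \<nu>' j)))"
  have r: "r (\<nu>' u, \<nu>' v) = (\<nu> u, \<nu> v)" if "u \<in> whites G" "v \<in> blacks G" for u v
    using that \<nu>' by (simp add: r_def numbering_def)
  have fst_r: "fst (r b) = fst (r c) \<longleftrightarrow> fst b = fst c" and snd_r: "snd (r b) = snd (r c) \<longleftrightarrow> snd b = snd c"
    if bc: "b \<in> ?D'" "c \<in> ?D'" for b c
  proof -
    obtain u v where uv: "u \<in> whites G" "v \<in> blacks G" "b = (\<nu>' u, \<nu>' v)"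
      using bc(1) unfolding graph_diagram_def by blast
    obtain x y where xy: "x \<in> whites G" "y \<in> blacks G" "c = (\<nu>' x, \<nu>' y)"
      using bc(2) unfolding graph_diagram_def by blast
    show "fst (r b) = fst (r c) \<longleftrightarrow> fst b = fst c" "snd (r b) = snd (r c) \<longleftrightarrow> snd b = snd c"
      using numbering_inj[OF \<nu>] numbering_inj[OF \<nu>'] uv(1,2) xy(1,2)
      unfolding uv(3) xy(3) by (simp_all add: r)
  qed
  have bij: "bij_betw r ?D' ?D"
  proof (rule bij_betw_imageI)
    show "inj_on r ?D'" by (rule inj_onI) (use fst_r snd_r in \<open>auto simp: prod_eq_iff\<close>)
    show "r ` ?D' = ?D"
    proof (intro Set.equalityI subsetI)
      fix b assume "b \<in> r ` ?D'"
      then obtain u v where "u \<in> whites G" "v \<in> blacks G" "{u, v} \<in> edges G" "b = r (\<nu>' u, \<nu>' v)"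
        unfolding graph_diagram_def by blast
      then show "b \<in> ?D" using r unfolding graph_diagram_def by auto
    next
      fix b assume "b \<in> ?D"
      then obtain u v where uv: "u \<in> whites G" "v \<in> blacks G" "{u, v} \<in> edges G" "b = (\<nu> u, \<nu> v)"
        unfolding graph_diagram_def by blast
      then have "b = r (\<nu>' u, \<nu>' v)" using r by simp
      moreover have "(\<nu>' u, \<nu>' v) \<in> ?D'" using uv unfolding graph_diagram_def by blast
      ultimately show "b \<in> r ` ?D'" by (rule image_eqI)
    qed
  qed
  then have card: "card ?D' = card ?D" by (rule bij_betw_same_card)
  have t'_bij: "bij_betw t' {1..card ?D'} ?D'" using t' by (simp add: box_ordering_def)
  then have mem: "t' k \<in> ?D'" if "k \<in> {1..card ?D'}" for k using that by (rule bij_betw_apply)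
  have "box_ordering ?D (r \<circ> t')"
    unfolding box_ordering_def card[symmetric] by (rule bij_betw_trans[OF t'_bij bij])
  moreover have "specht_module ?D (r \<circ> t') = specht_module ?D' t'"
    by (rule specht_module_cong) (use card mem fst_r snd_r in simp_all)
  ultimately show ?thesis by (rule that)
qed

theorem corollary3p8:
  fixes G :: "'v bigraph"
    and n :: nat
    and M :: "'v set set"
    and V :: "(nat \<Rightarrow> nat, (nat \<Rightarrow> nat) \<Rightarrow> complex) representation"
    and W :: "'v set \<Rightarrow> (nat \<Rightarrow> nat, (nat \<Rightarrow> nat) \<Rightarrow> complex) representation"
  assumes "G \<in> bipartitioned_forests"
    and "card (edges G) = n" and "n \<ge> 1"
    and "almost_perfect_matching G M"
    and "is_specht_module_of G V"
    and "\<And>e. e \<in> M \<Longrightarrow> is_specht_module_of (delete_edge G e) (W e)"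
  shows "rep_isomorphic {\<sigma> \<in> carrier (sym_group n). \<sigma> n = n} V (direct_sum M W)"
proof -
  let ?H = "{\<sigma> \<in> carrier (sym_group n). \<sigma> n = n}"
  have G: "bipartitioned_graph G" "acyclic_graph G"
    using assms(1) by (simp_all add: bipartitioned_forests_def)
  have M_edges: "M \<subseteq> edges G" using assms(4) by (simp add: almost_perfect_matching_def matching_def)
  obtain \<nu> t where \<nu>: "numbering G \<nu>" and t: "box_ordering (graph_diagram G \<nu>) t"
    and V: "V = specht_module (graph_diagram G \<nu>) t"
    using assms(5) unfolding is_specht_module_of_def by (elim exE conjE)
  define D where "D = graph_diagram G \<nu>"
  define \<beta> where "\<beta> = box_of G \<nu>"
  have card: "card D = n" using card_graph_diagram[OF G(1) \<nu>] assms(2) by (simp add: D_def)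
  have fin: "finite D" and ne: "D \<noteq> {}" and fin_edges: "finite (edges G)"
    using card assms(2,3) by (auto intro: card_ge_0_finite)
  have forest: "forest_relation D" unfolding D_def by (rule forest_relation_graph_diagram[OF G \<nu>])
  have sat: "saturating D (\<beta> ` M)"
    unfolding D_def \<beta>_def by (rule saturating_almost_perfect_matching[OF G(1) \<nu> assms(4)])
  have fin_M: "finite M" by (rule finite_subset[OF M_edges fin_edges])
  have inj: "inj_on \<beta> M" unfolding \<beta>_def by (rule inj_on_subset[OF inj_on_box_of[OF G(1) \<nu>] M_edges])
  have t_bij: "bij_betw t {1..card D} D" using t by (simp add: box_ordering_def D_def)
  have "rep_isomorphic ?H (word_rep D) V"
    using rep_isomorphic_subgroup[OF word_rep_specht_module[OF t_bij], of ?H] card by (simp add: V D_def)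
  then have V_D: "rep_isomorphic ?H V (word_rep D)"
    by (rule rep_isomorphic_sym)
       (simp_all add: word_rep_def cfun.subspace_add cfun.subspace_scale subspace_word_module
         word_module_act sym_group_carrier card)
  have D_sum: "rep_isomorphic ?H (word_rep D) (direct_sum M (\<lambda>e. word_rep (D - {\<beta> e})))"
    using word_rep_branching[OF fin ne forest sat fin_M inj] card by simp
  have "rep_isomorphic ?H (direct_sum M (\<lambda>e. word_rep (D - {\<beta> e}))) (direct_sum M W)"
  proof (rule rep_isomorphic_direct_sum[OF fin_M])
    fix e assume e: "e \<in> M"
    then have eG: "e \<in> edges G" using M_edges by blast
    let ?G = "delete_edge G e"
    have diagram: "graph_diagram ?G \<nu> = D - {\<beta> e}"
      unfolding D_def \<beta>_def by (rule graph_diagram_delete_edge[OF G(1) \<nu> eG])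
    have "whites ?G \<subseteq> whites G" "blacks ?G \<subseteq> blacks G" by (auto simp: delete_edge_def)
    then have \<nu>_e: "numbering ?G \<nu>" using \<nu> unfolding numbering_def by (blast intro: inj_on_subset)
    obtain \<nu>' t' where \<nu>': "numbering ?G \<nu>'" "box_ordering (graph_diagram ?G \<nu>') t'"
      and W: "W e = specht_module (graph_diagram ?G \<nu>') t'"
      using assms(6)[OF e] unfolding is_specht_module_of_def by (elim exE conjE)
    obtain s where s: "box_ordering (D - {\<beta> e}) s" "specht_module (D - {\<beta> e}) s = W e"
      unfolding W diagram[symmetric] by (rule specht_module_renumber[OF \<nu>_e \<nu>'])
    have "\<beta> e \<in> D" using sat e saturatingD(1) by blast
    then have card_e: "card (D - {\<beta> e}) = n - 1" using card fin by simp
    have H: "?H \<subseteq> carrier (sym_group (card (D - {\<beta> e})))"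
    proof
      fix \<sigma> assume "\<sigma> \<in> ?H"
      then have \<sigma>: "\<sigma> permutes {1..n}" "\<sigma> n = n" by (simp_all add: sym_group_carrier)
      have "\<sigma> permutes {1..n - 1}"
        by (rule permutes_fixing_last[OF \<sigma>])
      then show "\<sigma> \<in> carrier (sym_group (card (D - {\<beta> e})))" by (simp add: sym_group_carrier card_e)
    qed
    have "bij_betw s {1..card (D - {\<beta> e})} (D - {\<beta> e})" using s(1) by (simp only: box_ordering_def)
    from rep_isomorphic_subgroup[OF word_rep_specht_module[OF this] H]
    show "rep_isomorphic ?H (word_rep (D - {\<beta> e})) (W e)" by (simp only: s(2))
  qed
  then show ?thesis by (rule rep_isomorphic_trans[OF rep_isomorphic_trans[OF V_D D_sum]])
qed

end
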